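(* Let $v_0\in L^\infty(\mathbb R)$ be a (continuous) nondecreasing function with $\partial_xv_0\in L^1(\mathbb R)\cap L\log L(\mathbb R)$, and let $\mathcal K\in L^1(\mathbb R)$ be even with $\int_{\mathbb R}\mathcal K\,dx=0$ and Fourier transform satisfying $\mathcal F(\mathcal K)(\xi)\le0$ for all $\xi\neq0$. Let $(M_\ell)_{\ell\in\mathbb N}$ be a sequence of positive integers with $M_\ell\to+\infty$ as $\ell\to+\infty$, and let $(P_k)_{k\in\mathbb N}$, with $P_0\ge1$, be a nondecreasing sequence with $P_k\to+\infty$ as $k\to+\infty$. For $k,\ell\in\mathbb N$ let $u_{k,\ell}:=u^{P_k}_{M_\ell}$ be the associated solution (in the sense specified in the context) of the periodic problem $$\partial_tu=\left(\sigma^{P_k}_{M_\ell}\ast u(\cdot,t)\right)(x)\,\left(\partial_xu+L^{P_k}\right)\ \text{in } I_{P_k}\times(0,T),\qquad u(\cdot,0)=u^{P_k}_0,$$ where $u^{P_k}_0$ is the $2P_k$-periodic function given by $u_0^{P_k}(x)=v_0(x)-L^{P_k}x$ for $x\in[-P_k,P_k]$. Then there exists $v\in C(\mathbb R\times[0,T))$ with $$v\in L^\infty(\mathbb R\times(0,T))\cap C(0,T;L\log L(\mathbb R)),\qquad \partial_xv\in L^\infty(0,T;L\log L(\mathbb R)),$$ such that the family $(u_{k,\ell})_{k,\ell\in\mathbb N}$ converges, up to a subsequence, uniformly on every compact subset of $\mathbb R\times(0,T)$ to $v$ when first $\ell\to+\infty$ and then $k\to+\infty$. Moreover, $v$ is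 a solution in the distributional sense of $$\partial_tv(x,t)=\left(\mathcal K\star v(\cdot,t)\right)(x)\,\partial_xv(x,t)\ \text{in }\mathbb R\times(0,T),\qquad v(\cdot,0)=v_0\ \text{in }\mathbb R,$$ where $(\mathcal K\star v(\cdot,t))(x)=\int_{\mathbb R}\mathcal K(x-z)v(z,t)\,dz$.
   Context: $T>0$ is fixed. For $P>0$: $I_P=\mathbb R/2P\mathbb Z$, functions on $I_P$ being identified with $2P$-periodic functions on $\mathbb R$; for $w,z\in L^1(I_P)$, $(w\ast z)(x)=\int_{I_P}w(x-y)z(y)\,dy$; $L^P=\frac{v_0(P)-v_0(-P)}{2P}$. For $I=\mathbb R$ or $I=I_P$, $L\log L(I)$ is the Banach space of $g\in L^1_{\rm loc}(I)$ with $\int_I|g|\ln(e+|g|)\,dx<\infty$, with norm $\|g\|_{L\log L(I)}=\inf\{\mu>0:\int_I\frac{|g|}\mu\ln(e+\frac{|g|}\mu)\,dx\le1\}$. $C(0,T;X)$ denotes continuous $X$-valued functions of $t$. Regularized periodic kernel: $\mathcal K^P$ is the $2P$-periodic function equal to $\mathcal K$ on $[-P,P]$; for a positive integer $m$, $F_m(x)=\frac1m\sum_{j=0}^{m-1}\sum_{|q|\le j}e^{i\pi qx/P}$ (Fejér kernel); and for a positive integer $M$ $$\mathcal K^P_M(x)=\mathcal K^P(x)-\frac{2F_{2M}(x)}{P}\int_{|y|\ge P}|\mathcal K(y)|\,dy,\qquad \sigma^P_M=\frac1{2P}\,F_M\ast\mathcal K^P_M.$$ Associated solutions: $u_{k,\ell}$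 denotes a solution whose existence is known for every $k,\ell$ and which has the following properties, with $P=P_k$, $M=M_\ell$ and a constant $C_{\rm GE}$ depending only on $\|v_0\|_{L^\infty}$, $T$ and $\|\mathcal K\|_{L^1(\mathbb R)}$: the equation holds in $\mathcal D'(I_P\times(0,T))$; $u_{k,\ell}\in C(I_P\times[0,T))\cap L^\infty(I_P\times(0,T))\cap C(0,T;L\log L(I_P))$ with $u_{k,\ell}(\cdot,0)=u_0^{P}$; $\|u_{k,\ell}\|_{L^\infty(I_P\times(0,T))}\le e^{10L^PT\|\mathcal K\|_{L^1(\mathbb R)}}\|u_0^P\|_{L^\infty(I_P)}$; $\|\partial_xu_{k,\ell}\|_{L^\infty(0,T;L\log L(I_P))}+\|\partial_tu_{k,\ell}\|_{L^\infty(0,T;L\log L(I_P))}\le C_{\rm GE}$; and $|u_{k,\ell}(x+\gamma,t+h)-u_{k,\ell}(x,t)|\le6C_{\rm GE}\left(\frac1{\ln(1+1/\gamma)}+\frac1{\ln(1+1/h)}\right)$ for all $\gamma,h\ge0$ and $(x,t)\in I_P\times(0,T-h)$ (terms with $\gamma=0$ or $h=0$ read as $0$). Iterated convergence "up to a subsequence, first $\ell\to+\infty$ then $k\to+\infty$" means: for each $k$, along a subsequence in $\ell$, $u_{k,\ell}$ converges uniformly to some $u_k$, and then, along a subsequence in $k$, $u_k$ converges to $v$ uniformly on compact sets. $v$ is a distributional solution if the equation holds in $\mathcal D'(\mathbb R\times(0,T))$ and the continuous function $v$ equals $v_0$ at $t=0$.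
   Formalization: The clause v ∈ C(0,T; L log L(R)) is replaced by v − v_0 ∈ C(0,T; L log L(R)), continuity including t=0; the literal clause fails, e.g. for v_0 = 1, K = 0, where v = 1 is not in L log L(R). *)

theory Defs
  imports "HOL-Probability.Essential_Supremum"
begin

text \<open>Functions of (x,t) are functions on \<^typ>\<open>real \<times> real\<close>. A function on the torus
  \<open>I\<^sub>P = \<real>/2P\<int>\<close> is a \<open>2P\<close>-periodic function on the line, and integrals and norms over
  \<open>I\<^sub>P\<close> are taken over the period cell \<open>[-P,P]\<close>.\<close>

subsection \<open>Smooth functions, test functions, distributional derivatives\<close>

text \<open>The greatest fixed point yields exactly the infinitely differentiable functions.\<close>

coinductive smooth :: "('a::euclidean_space \<Rightarrow> real) \<Rightarrow> bool" where
  "(\<forall>x. f differentiable (at x)) \<Longrightarrow>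
   (\<forall>e. smooth (\<lambda>x. frechet_derivative f (at x) e)) \<Longrightarrow> smooth f"

definition test_functions :: "'a::euclidean_space set \<Rightarrow> ('a \<Rightarrow> real) set" where
  "test_functions S =
     {\<phi>. smooth \<phi> \<and> (\<exists>C. compact C \<and> C \<subseteq> S \<and> (\<forall>z. \<phi> z \<noteq> 0 \<longrightarrow> z \<in> C))}"

text \<open>On \<open>I\<^sub>P \<times> (0,T)\<close> compactness of the support is only a condition on the time variable.\<close>

definition torus_test_functions :: "real \<Rightarrow> real \<Rightarrow> (real \<times> real \<Rightarrow> real) set" where
  "torus_test_functions P T =
     {\<phi>. smooth \<phi> \<and> (\<forall>x t. \<phi> (x + 2 * P, t) = \<phi> (x, t)) \<and>
         (\<exists>a b. 0 < a \<and> b < T \<and> (\<forall>x t. \<phi> (x, t) \<noteq> 0 \<longrightarrow> a \<le> t \<and> t \<le> b))}"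

text \<open>The function \<open>g\<close> represents the distributional derivative of \<open>f\<close> in direction \<open>e\<close>,
  with test space \<open>\<Phi>\<close> on the domain \<open>D\<close>. Integrability of all the products \<open>g \<phi>\<close>
  says that \<open>g\<close> is locally integrable on \<open>D\<close>.\<close>

definition distr_deriv ::
  "('a::euclidean_space \<Rightarrow> real) set \<Rightarrow> 'a set \<Rightarrow> 'a \<Rightarrow> ('a \<Rightarrow> real) \<Rightarrow> ('a \<Rightarrow> real) \<Rightarrow> bool" where
  "distr_deriv \<Phi> D e f g \<longleftrightarrow>
     (\<forall>\<phi>\<in>\<Phi>. set_integrable lborel D (\<lambda>z. g z * \<phi> z) \<and>
        (LINT z:D|lborel. f z * frechet_derivative \<phi> (at z) e) = - (LINT z:D|lborel. g z * \<phi> z))"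

subsection \<open>Function spaces\<close>

definition Linf_norm :: "'a::euclidean_space set \<Rightarrow> ('a \<Rightarrow> real) \<Rightarrow> ennreal" where
  "Linf_norm A f = esssup (restrict_space lborel A) (\<lambda>x. ennreal \<bar>f x\<bar>)"

definition L1_norm :: "(real \<Rightarrow> real) \<Rightarrow> real" where
  "L1_norm f = (LINT x|lborel. \<bar>f x\<bar>)"

definition LlogL :: "real set \<Rightarrow> (real \<Rightarrow> real) set" where
  "LlogL A = {g. (\<forall>a b. set_integrable lborel (A \<inter> {a..b}) g) \<and>
     (\<integral>\<^sup>+x\<in>A. ennreal (\<bar>g x\<bar> * ln (exp 1 + \<bar>g x\<bar>)) \<partial>lborel) < \<infinity>}"

text \<open>Extended-valued: the norm is \<open>\<infinity>\<close> if no admissible \<open>\<mu>\<close> exists.\<close>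

definition LlogL_norm :: "real set \<Rightarrow> (real \<Rightarrow> real) \<Rightarrow> ennreal" where
  "LlogL_norm A g =
     (INF \<mu>\<in>{\<mu>::real. 0 < \<mu> \<and>
        (\<integral>\<^sup>+x\<in>A. ennreal (\<bar>g x\<bar> / \<mu> * ln (exp 1 + \<bar>g x\<bar> / \<mu>)) \<partial>lborel) \<le> 1}. ennreal \<mu>)"

text \<open>The norm of \<open>L\<^sup>\<infinity>(0,T; L log L(A))\<close>. As \<open>L log L(A)\<close> is separable, strong measurability
  in time amounts to joint measurability in \<open>(x,t)\<close>.\<close>

definition Linf_LlogL_norm :: "real \<Rightarrow> real set \<Rightarrow> (real \<times> real \<Rightarrow> real) \<Rightarrow> ennreal" where
  "Linf_LlogL_norm T A w =
     esssup (restrict_space lborel {0<..<T}) (\<lambda>t. LlogL_norm A (\<lambda>x. w (x, t)))"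

definition Linf_LlogL :: "real \<Rightarrow> real set \<Rightarrow> (real \<times> real \<Rightarrow> real) set" where
  "Linf_LlogL T A =
     {w. set_borel_measurable lborel (A \<times> {0<..<T}) w \<and> Linf_LlogL_norm T A w < \<infinity>}"

text \<open>\<open>C(0,T; L log L(A))\<close>, with continuity required up to the initial time. On the whole line
  a nonzero monotone function is never in \<open>L log L(\<real>)\<close>, since that space is contained in
  \<open>L\<^sup>1(\<real>)\<close>. For a solution \<open>v\<close> on the line with monotone initial datum \<open>v0\<close> the space is therefore
  understood affinely: \<open>v - v0\<close> is the function required to lie in \<open>C(0,T; L log L(\<real>))\<close>.\<close>

definition C_LlogL :: "real \<Rightarrow> real set \<Rightarrow> (real \<times> real \<Rightarrow> real) set" where
  "C_LlogL T A =
     {w. \<forall>t\<in>{0..<T}. (\<lambda>x. w (x, t)) \<in> LlogL A \<and>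
        ((\<lambda>s. LlogL_norm A (\<lambda>x. w (x, s) - w (x, t))) \<longlongrightarrow> 0) (at t within {0..<T})}"

subsection \<open>The regularized periodic kernel\<close>

text \<open>The \<open>2P\<close>-periodic function that equals \<open>f\<close> on \<open>[-P,P)\<close>. It equals \<open>f\<close> on \<open>[-P,P]\<close>
  if \<open>f P = f (-P)\<close>, as is the case for an even kernel and in \<open>u_init\<close> below.\<close>

definition periodize :: "real \<Rightarrow> (real \<Rightarrow> real) \<Rightarrow> real \<Rightarrow> real" where
  "periodize P f x = f (x - 2 * P * of_int \<lfloor>(x + P) / (2 * P)\<rfloor>)"

definition torus_conv :: "real \<Rightarrow> (real \<Rightarrow> real) \<Rightarrow> (real \<Rightarrow> real) \<Rightarrow> real \<Rightarrow> real" where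
  "torus_conv P w z x = (LINT y:{-P..P}|lborel. w (x - y) * z y)"

text \<open>The sum is real because \<open>q\<close> and \<open>-q\<close> both occur.\<close>

definition fejer :: "real \<Rightarrow> nat \<Rightarrow> real \<Rightarrow> real" where
  "fejer P m x =
     Re (1 / of_nat m * (\<Sum>j<m. \<Sum>q\<in>{- int j..int j}. exp (\<i> * of_real (pi * of_int q * x / P))))"

definition kernel_reg :: "(real \<Rightarrow> real) \<Rightarrow> real \<Rightarrow> nat \<Rightarrow> real \<Rightarrow> real" where
  "kernel_reg K P M x =
     periodize P K x - 2 * fejer P (2 * M) x / P * (LINT y:{y. \<bar>y\<bar> \<ge> P}|lborel. \<bar>K y\<bar>)"

definition sigma :: "(real \<Rightarrow> real) \<Rightarrow> real \<Rightarrow> nat \<Rightarrow> real \<Rightarrow> real" where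
  "sigma K P M x = 1 / (2 * P) * torus_conv P (fejer P M) (kernel_reg K P M) x"

definition fourier :: "(real \<Rightarrow> real) \<Rightarrow> real \<Rightarrow> complex" where
  "fourier K \<xi> = (CLINT x|lborel. of_real (K x) * exp (- (\<i> * of_real (\<xi> * x))))"

subsection \<open>The periodic problem\<close>

definition mean_slope :: "(real \<Rightarrow> real) \<Rightarrow> real \<Rightarrow> real" where
  "mean_slope v0 P = (v0 P - v0 (- P)) / (2 * P)"

definition u_init :: "(real \<Rightarrow> real) \<Rightarrow> real \<Rightarrow> real \<Rightarrow> real" where
  "u_init v0 P = periodize P (\<lambda>x. v0 x - mean_slope v0 P * x)"

definition log_modulus :: "real \<Rightarrow> real" where
  "log_modulus r = (if r = 0 then 0 else 1 / ln (1 + 1 / r))"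

text \<open>The properties of the associated solution with parameters \<open>P\<close> and \<open>M\<close>; here \<open>C\<close> is the
  constant of the gradient and modulus estimates, and \<open>ux\<close>, \<open>ut\<close> represent the
  distributional derivatives of \<open>u\<close>.\<close>

definition associated_solution ::
  "real \<Rightarrow> (real \<Rightarrow> real) \<Rightarrow> (real \<Rightarrow> real) \<Rightarrow> real \<Rightarrow> real \<Rightarrow> nat \<Rightarrow> (real \<times> real \<Rightarrow> real) \<Rightarrow> bool" where
  "associated_solution T K v0 C P M u \<longleftrightarrow>
     (let L = mean_slope v0 P;
          cell = {-P..P};
          D = cell \<times> {0<..<T};
          \<Phi> = torus_test_functions P T
      in
        (\<forall>x. \<forall>t\<in>{0..<T}. u (x + 2 * P, t) = u (x, t)) \<and>
        continuous_on (UNIV \<times> {0..<T}) u \<and>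
        u \<in> C_LlogL T cell \<and>
        (\<forall>x. u (x, 0) = u_init v0 P x) \<and>
        Linf_norm D u \<le> ennreal (exp (10 * L * T * L1_norm K)) * Linf_norm cell (u_init v0 P) \<and>
        (\<exists>ux ut.
           ux \<in> Linf_LlogL T cell \<and> distr_deriv \<Phi> D (1, 0) u ux \<and>
           ut \<in> Linf_LlogL T cell \<and> distr_deriv \<Phi> D (0, 1) u ut \<and>
           Linf_LlogL_norm T cell ux + Linf_LlogL_norm T cell ut \<le> ennreal C \<and>
           distr_deriv \<Phi> D (0, 1) u
             (\<lambda>(x, t). torus_conv P (sigma K P M) (\<lambda>y. u (y, t)) x * (ux (x, t) + L))) \<and>
        (\<forall>\<gamma>\<ge>0. \<forall>h\<ge>0. \<forall>x. \<forall>t\<in>{0<..<T - h}.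
           \<bar>u (x + \<gamma>, t + h) - u (x, t)\<bar> \<le> 6 * C * (log_modulus \<gamma> + log_modulus h)))"

end

theory Submission
  imports
    Defs
    "HOL-Complex_Analysis.Great_Picard"
    "HOL-Probability.Sinc_Integral"
begin

text \<open>
  The logarithmic modulus of continuity of the \<open>u\<^sub>k\<^sub>,\<^sub>l\<close> is uniform in \<open>k\<close> and \<open>l\<close>, so Ascoli's theorem
  gives both limits, and a diagonal choice \<open>l(n)\<close> makes \<open>w\<^sub>n = u\<^sub>k\<^sub>(\<^sub>n\<^sub>)\<^sub>,\<^sub>l\<^sub>(\<^sub>n\<^sub>)\<close> converge locally uniformly to
  the iterated limit \<open>v\<close>. The \<open>x\<close>-derivatives of \<open>w\<^sub>n\<close> on one period, extended by zero, are bounded in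
  \<open>L\<^sup>\<infinity>(0,T; L log L)\<close>, hence uniformly integrable, hence weakly \<open>L\<^sup>1\<close>-compact. As \<open>\<K>\<close> has mean zero and
  the Fejer kernel is an approximate identity, the velocities \<open>\<sigma> \<star> w\<^sub>n\<close> converge locally uniformly to
  \<open>\<K> \<star> v\<close>, and the product of velocity and derivative passes to the limit.
  Continuity of \<open>v(\<cdot>,t) - v\<^sub>0\<close> in \<open>L log L\<close> follows from the equation: it gives an
  \<open>L\<^sup>1\<close>-Lipschitz bound in time, and on bounded functions the modular is controlled by the \<open>L\<^sup>1\<close>-norm.
\<close>

section \<open>Smooth cut-off functions\<close>

text \<open>The obstacle is the product of velocity and slope. In \<open>L log L\<close>, which is
  not reflexive, bounded slopes need not have a weak limit by boundedness alone, and two weakly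
  convergent factors could not be multiplied. So one factor, the velocity, is made to converge
  uniformly on bounded sets, and weak \<open>L\<^sup>1\<close> convergence of the other suffices.
  The order of the limits reflects the Fejer error at scale \<delta>,
  \<open>4 * B / (m * (1 - cos (pi * \<delta> / P)))\<close>: for fixed \<open>m\<close> it blows up
  as \<open>P\<close> grows. Hence \<open>l(n)\<close> is chosen after \<open>k(n)\<close>, so large
  that this error and the distance to the limit in \<open>l\<close> are both below
  \<open>1 / (n + 1)\<close>. The limits in \<open>l\<close> are used as uniform limits only; no
  equation is derived for them. The line has infinite measure, so weak compactness is obtained for a
  finite weighted measure, and test functions of bounded support undo the weight. The sup bound
  common to all \<open>k\<close> and \<open>l\<close> comes from the initial datum and the modulus
  in time.\<close>

lemma smooth_differentiable: "smooth f \<Longrightarrow> f differentiable (at x)"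
  by (erule smooth.cases) auto

lemma smooth_deriv: "smooth f \<Longrightarrow> smooth (\<lambda>x. frechet_derivative f (at x) e)"
  by (erule smooth.cases) auto

lemma smooth_has_derivative:
  "smooth f \<Longrightarrow> (f has_derivative frechet_derivative f (at x)) (at x)"
  using frechet_derivative_works smooth_differentiable by blast

lemma smooth_continuous_on: "smooth f \<Longrightarrow> continuous_on S f"
  by (meson continuous_at_imp_continuous_on differentiable_imp_continuous_within smooth_differentiable)

text \<open>The coinduction rule with a derivative that the proof exhibits, in place of the selected
  \<open>frechet_derivative\<close>; uniqueness of derivatives identifies the two.\<close>

lemma smooth_coinduct_derivative:
  assumes "X f"
    and "\<And>g. X g \<Longrightarrow> \<exists>g'. (\<forall>x. (g has_derivative g' x) (at x)) \<and>
           (\<forall>e. X (\<lambda>x. g' x e))"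
  shows "smooth f"
  using assms(1)
proof (coinduct rule: smooth.coinduct)
  case (smooth h)
  obtain g' where g': "\<And>x. (h has_derivative g' x) (at x)" "\<And>e. X (\<lambda>x. g' x e)"
    using assms(2)[OF smooth] by blast
  have eq: "frechet_derivative h (at x) = g' x" for x
    using frechet_derivative_at[OF g'(1)] by simp
  show ?case
    using g' eq by (auto intro: differentiableI)
qed

lemma smooth_const: "smooth (\<lambda>x. c)"
  by (rule smooth_coinduct_derivative[where X = "\<lambda>f. \<exists>c. f = (\<lambda>x. c)"])
     (auto intro!: exI[of _ "\<lambda>_ _. 0"])

text \<open>Single products are not invariant under differentiation, since the product rule turns
  one into two. Finite sums of products are, so the coinduction runs over lists of pairs; products
  and sums are then special cases.\<close>

lemma smooth_sum_list_mult:
  assumes "\<And>f g. (f, g) \<in> set fgs \<Longrightarrow> smooth f \<and> smooth g"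
  shows "smooth (\<lambda>x. \<Sum>(f, g)\<leftarrow>fgs. f x * g x)"
proof (rule smooth_coinduct_derivative[where
    X = "\<lambda>h. \<exists>fgs. (\<forall>(f, g)\<in>set fgs. smooth f \<and> smooth g) \<and> h = (\<lambda>x. \<Sum>(f, g)\<leftarrow>fgs. f x * g x)"])
  show "\<exists>fgs'. (\<forall>(f, g)\<in>set fgs'. smooth f \<and> smooth g) \<and>
      (\<lambda>x. \<Sum>(f, g)\<leftarrow>fgs. f x * g x) = (\<lambda>x. \<Sum>(f, g)\<leftarrow>fgs'. f x * g x)"
    using assms by blast
next
  fix h :: "'a \<Rightarrow> real"
  assume "\<exists>fgs. (\<forall>(f, g)\<in>set fgs. smooth f \<and> smooth g) \<and> h = (\<lambda>x. \<Sum>(f, g)\<leftarrow>fgs. f x * g x)"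
  then obtain fgs where fgs: "\<forall>(f, g)\<in>set fgs. smooth f \<and> smooth g"
    and h: "h = (\<lambda>x. \<Sum>(f, g)\<leftarrow>fgs. f x * g x)" by blast
  define D where "D f x = frechet_derivative f (at x)" for f :: "'a \<Rightarrow> real" and x
  define h' where "h' x e = (\<Sum>(f, g)\<leftarrow>fgs. f x * D g x e + D f x e * g x)" for x e
  have "((\<lambda>x. \<Sum>(f, g)\<leftarrow>fgs. f x * g x) has_derivative
      (\<lambda>e. \<Sum>(f, g)\<leftarrow>fgs. f x * D g x e + D f x e * g x)) (at x)" for x
    using fgs
  proof (induction fgs)
    case Nil
    show ?case by simp
  next
    case (Cons fg fgs)
    obtain f g where fg: "fg = (f, g)" by force
    have "(f has_derivative D f x) (at x)" "(g has_derivative D g x) (at x)"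
      using Cons.prems by (auto simp: fg D_def smooth_has_derivative)
    then show ?case
      using Cons by (auto simp: fg intro!: has_derivative_add has_derivative_mult)
  qed
  then have "\<forall>x. (h has_derivative h' x) (at x)"
    unfolding h h'_def by blast
  moreover have "\<exists>fgs'. (\<forall>(f, g)\<in>set fgs'. smooth f \<and> smooth g) \<and>
      (\<lambda>x. h' x e) = (\<lambda>x. \<Sum>(f, g)\<leftarrow>fgs'. f x * g x)" for e
  proof (intro exI conjI)
    let ?L = "concat (map (\<lambda>(f, g). [(f, \<lambda>x. D g x e), (\<lambda>x. D f x e, g)]) fgs)"
    show "\<forall>(f, g)\<in>set ?L. smooth f \<and> smooth g"
      using fgs by (auto simp: D_def intro: smooth_deriv)
    show "(\<lambda>x. h' x e) = (\<lambda>x. \<Sum>(f, g)\<leftarrow>?L. f x * g x)"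
      unfolding h'_def by (induction fgs) (auto simp: fun_eq_iff)
  qed
  ultimately show "\<exists>h'. (\<forall>x. (h has_derivative h' x) (at x)) \<and>
      (\<forall>e. \<exists>fgs. (\<forall>(f, g)\<in>set fgs. smooth f \<and> smooth g) \<and>
        (\<lambda>x. h' x e) = (\<lambda>x. \<Sum>(f, g)\<leftarrow>fgs. f x * g x))"
    by blast
qed

lemma smooth_mult: "smooth f \<Longrightarrow> smooth g \<Longrightarrow> smooth (\<lambda>x. f x * g x)"
  using smooth_sum_list_mult[of "[(f, g)]"] by simp

lemma smooth_add: "smooth f \<Longrightarrow> smooth g \<Longrightarrow> smooth (\<lambda>x. f x + g x)"
proof -
  assume "smooth f" "smooth g"
  then have "smooth (\<lambda>x. \<Sum>(f, g)\<leftarrow>[(f, \<lambda>_. 1), (g, \<lambda>_. 1)]. f x * g x)"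
    by (intro smooth_sum_list_mult) (auto simp: smooth_const)
  then show ?thesis by simp
qed

lemma smooth_diff: "smooth f \<Longrightarrow> smooth g \<Longrightarrow> smooth (\<lambda>x. f x - g x)"
  using smooth_add[of f "\<lambda>x. -1 * g x"] smooth_mult[OF smooth_const[of "-1"], of g] by simp

lemma smooth_real_deriv:
  fixes f :: "real \<Rightarrow> real"
  assumes "smooth f"
  obtains f' where "smooth f'" "\<And>x. (f has_real_derivative f' x) (at x)"
proof
  show "smooth (\<lambda>y. frechet_derivative f (at y) 1)" by (rule smooth_deriv[OF assms])
  fix x
  have "frechet_derivative f (at x) e = frechet_derivative f (at x) 1 * e" for e
    using linear_cmul[OF linear_frechet_derivative[OF smooth_differentiable[OF assms]], of x e 1]
    by simp
  then have "frechet_derivative f (at x) = (*) (frechet_derivative f (at x) 1)"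
    by blast
  then show "(f has_real_derivative frechet_derivative f (at x) 1) (at x)"
    using smooth_has_derivative[OF assms, of x] by (simp add: has_field_derivative_def)
qed

lemma has_derivative_affine:
  fixes f :: "real \<Rightarrow> real" and a :: "'a::euclidean_space"
  assumes "\<And>y. (f has_real_derivative f' y) (at y)"
  shows "((\<lambda>z. f (a \<bullet> z + b)) has_derivative (\<lambda>e. (a \<bullet> e) * f' (a \<bullet> z + b))) (at z)"
proof -
  have "((\<lambda>z. a \<bullet> z + b) has_derivative (\<lambda>e. a \<bullet> e)) (at z)"
    by (auto intro!: derivative_eq_intros)
  moreover have "(f has_derivative (\<lambda>e. e * f' (a \<bullet> z + b))) (at (a \<bullet> z + b))"
    using assms by (simp add: has_field_derivative_def mult_commute_abs)
  ultimately show ?thesis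
    by (rule has_derivative_compose)
qed

text \<open>The constant \<open>c\<close> in the coinduction invariant absorbs the factor
  \<open>a \<bullet> e\<close> that each derivative in direction \<open>e\<close> brings out. With
  \<open>a\<close> a coordinate vector this lifts functions of one variable to the plane.\<close>

lemma smooth_affine:
  fixes f :: "real \<Rightarrow> real" and a :: "'a::euclidean_space"
  assumes "smooth f"
  shows "smooth (\<lambda>z. f (a \<bullet> z + b))"
proof (rule smooth_coinduct_derivative[where
    X = "\<lambda>h. \<exists>f c. smooth f \<and> h = (\<lambda>z. c * f (a \<bullet> z + b))"])
  show "\<exists>g c. smooth g \<and> (\<lambda>z. f (a \<bullet> z + b)) = (\<lambda>z. c * g (a \<bullet> z + b))"
    using assms by (intro exI[of _ f] exI[of _ 1]) simp
next
  fix h assume "\<exists>f c. smooth f \<and> h = (\<lambda>z. c * f (a \<bullet> z + b))"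
  then obtain f :: "real \<Rightarrow> real" and c where f: "smooth f" and h: "h = (\<lambda>z. c * f (a \<bullet> z + b))" by blast
  obtain f' where f': "smooth f'" "\<And>x. (f has_real_derivative f' x) (at x)"
    using smooth_real_deriv[OF f] by blast
  have "(h has_derivative (\<lambda>e. c * ((a \<bullet> e) * f' (a \<bullet> z + b)))) (at z)" for z
    unfolding h by (intro has_derivative_mult_right has_derivative_affine f'(2))
  moreover have "\<exists>f d. smooth f \<and> (\<lambda>z. c * ((a \<bullet> e) * f' (a \<bullet> z + b))) = (\<lambda>z. d * f (a \<bullet> z + b))" for e
    by (rule exI[of _ f'], rule exI[of _ "c * (a \<bullet> e)"]) (simp add: f' mult.assoc)
  ultimately show "\<exists>h'. (\<forall>x. (h has_derivative h' x) (at x)) \<and>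
      (\<forall>e. \<exists>f c. smooth f \<and> (\<lambda>z. h' z e) = (\<lambda>z. c * f (a \<bullet> z + b)))"
    by (intro exI[of _ "\<lambda>z e. c * ((a \<bullet> e) * f' (a \<bullet> z + b))"] conjI allI)
qed

lemma smooth_real_antiderivative:
  fixes f :: "real \<Rightarrow> real"
  assumes "\<And>x. (f has_real_derivative f' x) (at x)" and "smooth f'"
  shows "smooth f"
proof (rule smooth.intros)
  have D: "(f has_derivative (\<lambda>e. f' x * e)) (at x)" for x
    using assms(1) by (simp add: has_field_derivative_def)
  then show "\<forall>x. f differentiable at x" by (auto intro: differentiableI)
  have "frechet_derivative f (at x) = (\<lambda>e. f' x * e)" for x
    using frechet_derivative_at[OF D] by simp
  then show "\<forall>e. smooth (\<lambda>x. frechet_derivative f (at x) e)"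
    using smooth_mult[OF assms(2) smooth_const] by simp
qed

lemma smooth_ident: "smooth (\<lambda>x::real. x)"
  by (rule smooth_real_antiderivative[of _ "\<lambda>_. 1"]) (auto intro: smooth_const)

text \<open>Makes Weierstrass approximants usable as test functions after a cut-off.\<close>

lemma smooth_real_polynomial: "real_polynomial_function p \<Longrightarrow> smooth (p :: real \<Rightarrow> real)"
proof (induction p rule: real_polynomial_function.induct)
  case (linear f)
  then obtain c where "f = (\<lambda>x. x * c)"
    using real_bounded_linear by blast
  then show ?case using smooth_mult[OF smooth_ident smooth_const] by simp
qed (auto intro: smooth_const smooth_mult smooth_add)

text \<open>With \<open>s = 1/x\<close> the functions \<open>p(s) e\<^sup>-\<^sup>s\<close>, \<open>p\<close> a polynomial, are closed under differentiation.\<close>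

definition exp_flat :: "real poly \<Rightarrow> real \<Rightarrow> real" where
  "exp_flat p x = (if x > 0 then poly p (1 / x) * exp (- (1 / x)) else 0)"

lemma poly_exp_tendsto_0: "((\<lambda>s::real. poly p s * exp (- s)) \<longlongrightarrow> 0) at_top"
proof -
  have "((\<lambda>s::real. \<Sum>i\<le>degree p. coeff p i * (s ^ i / exp s)) \<longlongrightarrow> (\<Sum>i\<le>degree p. coeff p i * 0)) at_top"
    by (intro tendsto_sum tendsto_mult tendsto_const tendsto_power_div_exp_0)
  then show ?thesis
    by (simp add: poly_altdef sum_distrib_right exp_minus divide_inverse mult.assoc)
qed

text \<open>With \<open>s = 1 / x\<close> the derivative in \<open>x\<close> is \<open>- s^2\<close>
  times the one in \<open>s\<close>, whence the polynomial \<open>s^2 (p - p')\<close>. At 0 the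
  right difference quotient is again a polynomial in \<open>s\<close> times
  \<open>exp (- s)\<close>, now with polynomial \<open>s p(s)\<close>, and tends to 0.\<close>

lemma exp_flat_deriv:
  "(exp_flat p has_real_derivative exp_flat ([:0, 0, 1:] * (p - pderiv p)) x) (at x)"
proof -
  consider "x > 0" | "x < 0" | "x = 0" by linarith
  then show ?thesis
  proof cases
    case 1
    have "((\<lambda>x. poly p (1 / x) * exp (- (1 / x))) has_real_derivative
        exp_flat ([:0, 0, 1:] * (p - pderiv p)) x) (at x)"
      using 1 by (auto intro!: derivative_eq_intros poly_DERIV[THEN DERIV_chain2]
          simp: exp_flat_def field_simps power2_eq_square)
    moreover have "\<forall>\<^sub>F y in nhds x. exp_flat p y = poly p (1 / y) * exp (- (1 / y))"
      using 1 by (auto simp: eventually_nhds exp_flat_def intro!: exI[of _ "{0<..}"])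
    ultimately show ?thesis by (subst DERIV_cong_ev[OF refl _ refl])
  next
    case 2
    have "((\<lambda>x. 0) has_real_derivative exp_flat ([:0, 0, 1:] * (p - pderiv p)) x) (at x)"
      using 2 by (simp add: exp_flat_def)
    moreover have "\<forall>\<^sub>F y in nhds x. exp_flat p y = 0"
      using 2 by (auto simp: eventually_nhds exp_flat_def intro!: exI[of _ "{..<0}"])
    ultimately show ?thesis by (subst DERIV_cong_ev[OF refl _ refl])
  next
    case 3
    have "((\<lambda>y. exp_flat p y / y) \<longlongrightarrow> 0) (at 0)"
    proof (rule filterlim_split_at)
      have "\<forall>\<^sub>F y::real in at_left 0. exp_flat p y / y = 0"
        by (simp add: eventually_at_filter exp_flat_def)
      then show "((\<lambda>y. exp_flat p y / y) \<longlongrightarrow> 0) (at_left 0)"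
        by (rule tendsto_eventually)
      have "\<forall>\<^sub>F y::real in at_right 0. poly (pCons 0 p) (inverse y) * exp (- (inverse y)) = exp_flat p y / y"
        by (simp add: eventually_at_filter exp_flat_def divide_inverse ac_simps)
      then show "((\<lambda>y. exp_flat p y / y) \<longlongrightarrow> 0) (at_right 0)"
        using filterlim_compose[OF poly_exp_tendsto_0 filterlim_inverse_at_top_right, of "pCons 0 p"]
        by (rule Lim_transform_eventually[rotated])
    qed
    then show ?thesis
      using 3 by (simp add: has_field_derivative_iff exp_flat_def)
  qed
qed

lemma smooth_exp_flat: "smooth (exp_flat p)"
proof (rule smooth_coinduct_derivative[where X = "\<lambda>f. \<exists>p c. f = (\<lambda>x. c * exp_flat p x)"])
  show "\<exists>q c. exp_flat p = (\<lambda>x. c * exp_flat q x)" by (intro exI[of _ p] exI[of _ 1]) simp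
next
  fix f assume "\<exists>p c. f = (\<lambda>x. c * exp_flat p x)"
  then obtain p c where f: "f = (\<lambda>x. c * exp_flat p x)" by blast
  let ?q = "[:0, 0, 1:] * (p - pderiv p)"
  have "(f has_derivative (\<lambda>e. c * (exp_flat ?q x * e))) (at x)" for x
    unfolding f
    by (intro has_derivative_mult_right has_field_derivative_imp_has_derivative exp_flat_deriv)
  moreover have "\<exists>p d. (\<lambda>x. c * (exp_flat ?q x * e)) = (\<lambda>x. d * exp_flat p x)" for e
    by (rule exI[of _ ?q], rule exI[of _ "c * e"]) (simp only: ac_simps)
  ultimately show "\<exists>f'. (\<forall>x. (f has_derivative f' x) (at x)) \<and>
      (\<forall>e. \<exists>p c. (\<lambda>x. f' x e) = (\<lambda>x. c * exp_flat p x))"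
    by (intro exI[of _ "\<lambda>x e. c * (exp_flat ?q x * e)"] conjI allI)
qed

text \<open>\<open>S\<close> is the normalized antiderivative of the bump
  \<open>exp (- 1 / x) * exp (- 1 / (1 - x))\<close> on (0,1). Its derivative is exported because it
  later serves as a mollifier in time.\<close>

lemma smooth_step_exists:
  obtains S S' :: "real \<Rightarrow> real"
  where "smooth S" "smooth S'" "\<And>x. (S has_real_derivative S' x) (at x)" "\<And>x. 0 \<le> S' x"
    "\<And>x. x \<le> 0 \<Longrightarrow> S x = 0" "\<And>x. 1 \<le> x \<Longrightarrow> S x = 1" "\<And>x. 0 \<le> S x" "\<And>x. S x \<le> 1"
proof -
  define b where "b x = exp_flat 1 x * exp_flat 1 (-1 * x + 1)" for x
  have "smooth b"
    unfolding b_def using smooth_affine[of "exp_flat 1" "-1::real" 1]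
    by (intro smooth_mult smooth_exp_flat) (simp add: smooth_exp_flat inner_real_def)
  have b0: "0 \<le> b x" "x \<le> 0 \<Longrightarrow> b x = 0" "1 \<le> x \<Longrightarrow> b x = 0" "0 < x \<Longrightarrow> x < 1 \<Longrightarrow> 0 < b x" for x
    by (auto simp: b_def exp_flat_def)
  have "isCont b x" for x
    using smooth_differentiable[OF \<open>smooth b\<close>] differentiable_imp_continuous_within by blast
  then obtain G where G: "\<And>x. (G has_real_derivative b x) (at x)"
    using einterval_antiderivative[of "-\<infinity>" "\<infinity>" b]
    by (auto simp: has_real_derivative_iff_has_vector_derivative)
  have mono: "G x \<le> G y" if "x \<le> y" for x y
    using that by (rule DERIV_nonneg_imp_nondecreasing) (use G b0(1) in blast)
  have "continuous_on {0..1} G"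
    using G DERIV_continuous_on has_field_derivative_at_within by blast
  \<comment> \<open>Strictness, needed for the normalization, comes from positivity of the bump on
    the open interval.\<close>
  then have pos: "G 0 < G 1"
    using b0(4) G by (intro DERIV_pos_imp_increasing_open[of 0 1 G]) (auto intro!: exI[of _ "b _"])
  have G0: "G x = G 0" if "x \<le> 0" for x
    by (rule antisym[OF mono[OF that]], rule DERIV_nonpos_imp_nonincreasing[OF that])
      (use G b0(2) in force)
  have G1: "G x = G 1" if "1 \<le> x" for x
    by (rule antisym[OF _ mono[OF that]], rule DERIV_nonpos_imp_nonincreasing[OF that])
      (use G b0(3) in force)
  define S where "S x = 1 / (G 1 - G 0) * (G x - G 0)" for x
  define S' where "S' x = 1 / (G 1 - G 0) * b x" for x
  have der: "(S has_real_derivative S' x) (at x)" for x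
    unfolding S_def S'_def by (intro DERIV_cmult) (auto intro!: derivative_eq_intros G)
  have "smooth S'"
    unfolding S'_def by (intro smooth_mult smooth_const \<open>smooth b\<close>)
  show thesis
  proof (rule that)
    show "smooth S" by (rule smooth_real_antiderivative[OF der \<open>smooth S'\<close>])
    show "0 \<le> S' x" for x using pos b0(1) by (simp add: S'_def)
    show "S x = 0" if "x \<le> 0" for x using G0[OF that] by (simp add: S_def)
    show "S x = 1" if "1 \<le> x" for x using G1[OF that] pos by (simp add: S_def)
    show "0 \<le> S x" for x
      using G0[of x] mono[of 0 x] pos by (cases "x \<le> 0") (simp_all add: S_def)
    show "S x \<le> 1" for x
      using G1[of x] mono[of x 1] pos by (cases "1 \<le> x") (simp_all add: S_def)
    show "smooth S'" by fact
    show "(S has_real_derivative S' x) (at x)" for x by (rule der)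
  qed
qed

section \<open>Weak sequential compactness of uniformly integrable families\<close>

text \<open>Finite intersections of a countable base. Countability permits a diagonal extraction
  over the generator, intersection stability the Dynkin argument that follows it.\<close>

lemma countable_Int_stable_generator_borel:
  obtains G :: "'a::second_countable_topology set set"
  where "countable G" "Int_stable G" "UNIV \<in> G" "sets borel = sigma_sets UNIV G"
proof -
  obtain B :: "'a set set" where B: "countable B" "topological_basis B"
    using ex_countable_basis by blast
  define G where "G = (\<lambda>F. \<Inter>F) ` {F. finite F \<and> F \<subseteq> B}"
  have "countable G"
    unfolding G_def using countable_Collect_finite_subset[OF B(1)] by (rule countable_image)
  moreover have "Int_stable G"
  proof (rule Int_stableI)
    fix a b assume "a \<in> G" "b \<in> G"
    then obtain F1 F2 where "a = \<Inter>F1" "b = \<Inter>F2" "finite F1" "finite F2" "F1 \<subseteq> B" "F2 \<subseteq> B"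
      unfolding G_def by blast
    then have "a \<inter> b = \<Inter>(F1 \<union> F2)" "finite (F1 \<union> F2)" "F1 \<union> F2 \<subseteq> B" by auto
    then show "a \<inter> b \<in> G" unfolding G_def by blast
  qed
  \<comment> \<open>The whole space is the intersection of the empty family.\<close>
  moreover have "UNIV \<in> G" unfolding G_def by (rule image_eqI[of _ _ "{}"]) auto
  moreover have "sets borel = sigma_sets UNIV G"
  proof -
    have bor: "sets borel = sigma_sets UNIV B"
      by (subst borel_eq_countable_basis[OF B]) simp
    have "B \<subseteq> G"
    proof
      fix b assume "b \<in> B"
      then show "b \<in> G" unfolding G_def by (intro image_eqI[of _ _ "{b}"]) auto
    qed
    then have "sigma_sets UNIV B \<subseteq> sigma_sets UNIV G" by (rule sigma_sets_mono')
    moreover have "G \<subseteq> sets borel"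
    proof
      fix a assume "a \<in> G"
      then obtain F where F: "a = \<Inter>F" "finite F" "F \<subseteq> B" unfolding G_def by blast
      have "open b" if "b \<in> F" for b
        using that F(3) B(2) topological_basis_open by blast
      then have "open a" unfolding F(1) using F(2) by (intro open_Inter) auto
      then show "a \<in> sets borel" by simp
    qed
    then have "sigma_sets UNIV G \<subseteq> sets borel"
      using sets.sigma_sets_subset[of G borel] by simp
    ultimately show ?thesis using bor by blast
  qed
  ultimately show thesis using that by blast
qed

text \<open>Only the uniform absolute continuity of the integrals. Together with the
  \<open>L\<^sup>1\<close> bound that accompanies it below, and on a finite measure space, this is
  uniform integrability in the usual sense.\<close>

definition uniformly_integrable :: "'a measure \<Rightarrow> (nat \<Rightarrow> 'a \<Rightarrow> real) \<Rightarrow> bool" where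
  "uniformly_integrable M f \<longleftrightarrow> (\<forall>n. integrable M (f n)) \<and>
     (\<forall>\<epsilon>>0. \<exists>\<delta>>0. \<forall>n. \<forall>A\<in>sets M. measure M A < \<delta> \<longrightarrow> (LINT x:A|M. \<bar>f n x\<bar>) < \<epsilon>)"

lemma uniformly_integrable_integrable: "uniformly_integrable M f \<Longrightarrow> integrable M (f n)"
  by (simp add: uniformly_integrable_def)

lemma uniformly_integrable_small:
  assumes "uniformly_integrable M f" "0 < \<epsilon>"
  obtains \<delta> where "0 < \<delta>"
    "\<And>n A. A \<in> sets M \<Longrightarrow> measure M A < \<delta> \<Longrightarrow> (LINT x:A|M. \<bar>f n x\<bar>) < \<epsilon>"
  using assms unfolding uniformly_integrable_def by blast

lemma uniformly_integrable_dominated: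
  assumes "uniformly_integrable M f" "\<And>n. g n \<in> borel_measurable M" "\<And>n x. \<bar>g n x\<bar> \<le> \<bar>f n x\<bar>"
  shows "uniformly_integrable M g"
proof -
  have g: "integrable M (g n)" for n
    using uniformly_integrable_integrable[OF assms(1)] assms(2)
    by (rule Bochner_Integration.integrable_bound) (use assms(3) in auto)
  have le: "(LINT x:A|M. \<bar>g n x\<bar>) \<le> (LINT x:A|M. \<bar>f n x\<bar>)" if "A \<in> sets M" for A n
    unfolding set_lebesgue_integral_def
    using that g[of n] uniformly_integrable_integrable[OF assms(1), of n] assms(3)
    by (intro integral_mono integrable_mult_indicator integrable_abs) (auto simp: indicator_def)
  show ?thesis
    unfolding uniformly_integrable_def
  proof (intro conjI allI impI)
    fix \<epsilon> :: real assume "0 < \<epsilon>"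
    then obtain \<delta> where "0 < \<delta>"
      "\<And>n A. A \<in> sets M \<Longrightarrow> measure M A < \<delta> \<Longrightarrow> (LINT x:A|M. \<bar>f n x\<bar>) < \<epsilon>"
      using uniformly_integrable_small[OF assms(1)] by metis
    then show "\<exists>\<delta>>0. \<forall>n. \<forall>A\<in>sets M. measure M A < \<delta> \<longrightarrow> (LINT x:A|M. \<bar>g n x\<bar>) < \<epsilon>"
      using le le_less_trans by blast
  qed (rule g)
qed

lemma uniformly_integrable_subseq:
  "uniformly_integrable M f \<Longrightarrow> uniformly_integrable M (\<lambda>n. f (r n))"
  unfolding uniformly_integrable_def by metis

text \<open>The sets on which the integrals converge along the subsequence form a Dynkin system.\<close>

lemma uniformly_integrable_convergent_subseq:
  fixes f :: "nat \<Rightarrow> 'a::second_countable_topology \<Rightarrow> real"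
  assumes fin: "finite_measure M" and sets: "sets M = sets borel"
    and ui: "uniformly_integrable M f"
    and bnd: "\<And>n. (LINT x|M. \<bar>f n x\<bar>) \<le> C"
  obtains r :: "nat \<Rightarrow> nat" where "strict_mono r"
    "\<And>A. A \<in> sets M \<Longrightarrow> convergent (\<lambda>n. LINT x:A|M. f (r n) x)"
proof -
  interpret finite_measure M by fact
  have space: "space M = UNIV" using sets sets_eq_imp_space_eq by fastforce
  have int: "integrable M (f n)" for n by (rule uniformly_integrable_integrable[OF ui])
  have sint: "set_integrable M A (f n)" if "A \<in> sets M" for A n
    unfolding set_integrable_def using that int by (rule integrable_mult_indicator)
  obtain G :: "'a set set" where G: "countable G" "Int_stable G" "UNIV \<in> G" "sets borel = sigma_sets UNIV G"
    using countable_Int_stable_generator_borel by blast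
  have abs_le: "\<bar>LINT x:A|M. f n x\<bar> \<le> (LINT x:A|M. \<bar>f n x\<bar>)" if "A \<in> sets M" for A n
    using set_integral_norm_bound[OF sint[OF that], of n] by simp
  have bound: "norm (LINT x:A|M. f n x) \<le> C" if A: "A \<in> G" for A n
  proof -
    have "A \<in> sets M" using A G(4) sets by auto
    then have "norm (LINT x:A|M. f n x) \<le> (LINT x:A|M. \<bar>f n x\<bar>)" using abs_le by simp
    also have "\<dots> \<le> (LINT x|M. \<bar>f n x\<bar>)"
      unfolding set_lebesgue_integral_def
      using int \<open>A \<in> sets M\<close>
      by (intro integral_mono integrable_abs integrable_mult_indicator) (auto simp: indicator_def)
    finally show ?thesis using bnd[of n] by simp
  qed
  \<comment> \<open>The integrals over each generating set are bounded by \<open>C\<close>, and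
    there are countably many such sets, so one diagonal subsequence works for all of them.\<close>
  obtain r :: "nat \<Rightarrow> nat" where r: "strict_mono r"
    and conv: "\<And>A. A \<in> G \<Longrightarrow> \<exists>l. (\<lambda>n. LINT x:A|M. f (r n) x) \<longlonglongrightarrow> l"
    using function_convergent_subsequence[OF G(1), of "\<lambda>n A. LINT x:A|M. f n x" C] bound by metis
  have "convergent (\<lambda>n. LINT x:A|M. f (r n) x)" if "A \<in> sets M" for A
  proof -
    have GP: "G \<subseteq> Pow UNIV" by simp
    have "A \<in> sigma_sets UNIV G" using that sets G(4) by simp
    then show ?thesis
    proof (induct rule: sigma_sets_induct_disjoint[OF G(2) GP, consumes 1, case_names basic empty compl union])
      case (basic A)
      then show ?case using conv unfolding convergent_def by blast
    next
      case empty
      show ?case by (simp add: convergent_const set_lebesgue_integral_def)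
    next
      case (compl A)
      have A: "A \<in> sets M" "UNIV \<in> sets M" using compl G(4) sets by auto
      have "(LINT x:UNIV|M. f (r n) x) = (LINT x:A|M. f (r n) x) + (LINT x:UNIV-A|M. f (r n) x)" for n
        using A by (subst set_integral_Un[symmetric]) (auto intro!: sint simp: Un_absorb1)
      then have "(LINT x:UNIV-A|M. f (r n) x) = (LINT x:UNIV|M. f (r n) x) - (LINT x:A|M. f (r n) x)" for n
        by (simp add: algebra_simps)
      then show ?case
        using convergent_diff[OF _ compl(2)] conv[OF G(3)] by (auto simp: convergent_def)
    next
      case (union A)
      have A: "A i \<in> sets M" for i using union(2) G(4) sets by auto
      \<comment> \<open>\<open>U N\<close> is a finite union, already settled by additivity. The
        remainders \<open>V N\<close> decrease to the empty set, so uniform integrability makes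
        their integrals small for all \<open>n\<close> at once.\<close>
      define U where "U N = (\<Union>i<N. A i)" for N
      define V where "V N = (\<Union>i. A i) - U N" for N
      have UV: "U N \<in> sets M" "V N \<in> sets M" for N using A by (auto simp: U_def V_def)
      have convU: "convergent (\<lambda>n. LINT x:U N|M. f (r n) x)" for N
      proof -
        have "(LINT x:U N|M. f (r n) x) = (\<Sum>i<N. LINT x:A i|M. f (r n) x)" for n
          unfolding U_def using union(1) A
          by (intro set_integral_finite_Union) (auto intro!: sint simp: disjoint_family_on_def)
        then show ?thesis using union(3) by (auto intro: convergent_sum)
      qed
      have "(\<lambda>N. measure M (V N)) \<longlonglongrightarrow> measure M (\<Inter>N. V N)"
      proof (rule finite_Lim_measure_decseq)
        show "range V \<subseteq> sets M" using UV by auto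
        show "decseq V" by (auto simp: decseq_def V_def U_def)
      qed
      moreover have "(\<Inter>N. V N) = {}" by (auto simp: V_def U_def)
      ultimately have V0: "(\<lambda>N. measure M (V N)) \<longlonglongrightarrow> 0" by simp
      have "Cauchy (\<lambda>n. LINT x:(\<Union>i. A i)|M. f (r n) x)"
      proof (rule metric_CauchyI)
        fix e :: real assume "0 < e"
        then obtain \<delta> where \<delta>: "0 < \<delta>"
          "\<And>n A. A \<in> sets M \<Longrightarrow> measure M A < \<delta> \<Longrightarrow> (LINT x:A|M. \<bar>f n x\<bar>) < e / 3"
          using uniformly_integrable_small[OF ui, of "e / 3"] by auto
        obtain N where N: "measure M (V N) < \<delta>"
          using order_tendstoD(2)[OF V0 \<delta>(1)] by (auto simp: eventually_sequentially)
        obtain n0 where n0: "\<And>m n. m \<ge> n0 \<Longrightarrow> n \<ge> n0 \<Longrightarrow>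
            dist (LINT x:U N|M. f (r m) x) (LINT x:U N|M. f (r n) x) < e / 3"
          using convergent_Cauchy[OF convU[of N]] \<open>0 < e\<close> unfolding Cauchy_def by (metis zero_less_divide_iff zero_less_numeral)
        have split: "(LINT x:(\<Union>i. A i)|M. f n x) = (LINT x:U N|M. f n x) + (LINT x:V N|M. f n x)" for n
        proof -
          have eq: "(\<Union>i. A i) = U N \<union> V N" by (auto simp: V_def U_def)
          show ?thesis
            unfolding eq by (rule set_integral_Un) (auto simp: V_def intro!: sint UV[unfolded V_def])
        qed
        have small: "\<bar>LINT x:V N|M. f n x\<bar> < e / 3" for n
          using abs_le[OF UV(2)[of N], of n] \<delta>(2)[OF UV(2) N, of n] by linarith
        show "\<exists>n0. \<forall>m\<ge>n0. \<forall>n\<ge>n0.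
            dist (LINT x:(\<Union>i. A i)|M. f (r m) x) (LINT x:(\<Union>i. A i)|M. f (r n) x) < e"
        proof (intro exI allI impI)
          fix m n assume "n0 \<le> m" "n0 \<le> n"
          then show "dist (LINT x:(\<Union>i. A i)|M. f (r m) x) (LINT x:(\<Union>i. A i)|M. f (r n) x) < e"
            using n0[of m n] small[of "r m"] small[of "r n"] unfolding split dist_real_def by linarith
        qed
      qed
      then show ?case by (simp add: Cauchy_convergent_iff)
    qed
  qed
  then show thesis using that r by blast
qed

text \<open>Sequential Dunford--Pettis theorem for nonnegative functions: the limit set function is
  absolutely continuous, so its Radon--Nikodym density is the weak limit.\<close>

lemma uniformly_integrable_weak_limit_nonneg:
  fixes f :: "nat \<Rightarrow> 'a::second_countable_topology \<Rightarrow> real"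
  assumes fin: "finite_measure M" and sets: "sets M = sets borel"
    and ui: "uniformly_integrable M f" and nonneg: "\<And>n x. 0 \<le> f n x"
    and bnd: "\<And>n. (LINT x|M. \<bar>f n x\<bar>) \<le> C"
  obtains r :: "nat \<Rightarrow> nat" and g where "strict_mono r" "integrable M g" "\<And>x. 0 \<le> g x"
    "\<And>A. A \<in> sets M \<Longrightarrow> (\<lambda>n. LINT x:A|M. f (r n) x) \<longlonglongrightarrow> (LINT x:A|M. g x)"
proof -
  interpret finite_measure M by fact
  have space: "space M = UNIV" using sets sets_eq_imp_space_eq by fastforce
  have int: "integrable M (f n)" for n by (rule uniformly_integrable_integrable[OF ui])
  have sint: "set_integrable M A (f n)" if "A \<in> sets M" for A n
    unfolding set_integrable_def using that int by (rule integrable_mult_indicator)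
  obtain r :: "nat \<Rightarrow> nat" where r: "strict_mono r"
    and conv: "\<And>A. A \<in> sets M \<Longrightarrow> convergent (\<lambda>n. LINT x:A|M. f (r n) x)"
    using uniformly_integrable_convergent_subseq[OF fin sets ui bnd] by blast
  define \<nu> where "\<nu> A = lim (\<lambda>n. LINT x:A|M. f (r n) x)" for A
  have lim: "(\<lambda>n. LINT x:A|M. f (r n) x) \<longlonglongrightarrow> \<nu> A" if "A \<in> sets M" for A
    using conv[OF that] by (simp add: \<nu>_def convergent_LIMSEQ_iff)
  have inonneg: "0 \<le> (LINT x:A|M. f n x)" for A n
    unfolding set_lebesgue_integral_def using nonneg by (intro Bochner_Integration.integral_nonneg) simp
  have \<nu>0: "0 \<le> \<nu> A" if "A \<in> sets M" for A
    using lim[OF that] inonneg by (intro LIMSEQ_le_const) auto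
  have \<nu>_add: "\<nu> (A \<union> B) = \<nu> A + \<nu> B" if "A \<in> sets M" "B \<in> sets M" "A \<inter> B = {}" for A B
  proof (rule LIMSEQ_unique[OF lim])
    show "(\<lambda>n. LINT x:A \<union> B|M. f (r n) x) \<longlonglongrightarrow> \<nu> A + \<nu> B"
      using that by (subst set_integral_Un) (auto intro!: sint tendsto_add lim)
  qed (use that in auto)
  \<comment> \<open>Uniform integrability survives in the limit set function. It is used twice: for
    continuity at the empty set, and for absolute continuity.\<close>
  have \<nu>_small: "\<exists>\<delta>>0. \<forall>A\<in>sets M. measure M A < \<delta> \<longrightarrow> \<nu> A \<le> e" if "e > 0" for e
  proof -
    obtain \<delta> where \<delta>: "0 < \<delta>"
      "\<And>n A. A \<in> sets M \<Longrightarrow> measure M A < \<delta> \<Longrightarrow> (LINT x:A|M. \<bar>f n x\<bar>) < e"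
      using uniformly_integrable_small[OF ui \<open>e > 0\<close>] by metis
    have "\<nu> A \<le> e" if "A \<in> sets M" "measure M A < \<delta>" for A
      using lim[OF that(1)] \<delta>(2)[OF that] nonneg by (intro LIMSEQ_le_const2) (auto intro!: exI[of _ 0] less_imp_le)
    then show ?thesis using \<delta>(1) by blast
  qed
  define N where "N = measure_of UNIV (sets M) (\<lambda>A. ennreal (\<nu> A))"
  have sig: "sigma_algebra UNIV (sets M)"
    using sets.sigma_algebra_axioms[of M] space by simp
  have setsN: "sets N = sets M"
    unfolding N_def by (rule sigma_algebra.sets_measure_of_eq[OF sig])
  have pos: "positive (sets M) (\<lambda>A. ennreal (\<nu> A))"
    unfolding positive_def using \<nu>_add[of "{}" "{}"] by simp
  \<comment> \<open>For a finite additive set function, countable additivity is continuity along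
    sequences decreasing to the empty set.\<close>
  have ca: "countably_additive (sets M) (\<lambda>A. ennreal (\<nu> A))"
  proof (rule ring_of_sets.empty_continuous_imp_countably_additive)
    show "ring_of_sets UNIV (sets M)"
      using sets.ring_of_sets_axioms[of M] space by simp
    show "additive (sets M) (\<lambda>A. ennreal (\<nu> A))"
      unfolding additive_def using \<nu>_add \<nu>0 by (auto simp: ennreal_plus[symmetric] simp del: ennreal_plus)
    fix A :: "nat \<Rightarrow> 'a set" assume A: "range A \<subseteq> sets M" "decseq A" "(\<Inter>i. A i) = {}"
    have "(\<lambda>i. measure M (A i)) \<longlonglongrightarrow> measure M (\<Inter>i. A i)"
      by (rule finite_Lim_measure_decseq[OF A(1,2)])
    then have mA: "(\<lambda>i. measure M (A i)) \<longlonglongrightarrow> 0" using A(3) by simp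
    have "(\<lambda>i. \<nu> (A i)) \<longlonglongrightarrow> 0"
    proof (rule LIMSEQ_I)
      fix e :: real assume "0 < e"
      then obtain \<delta> where \<delta>: "\<delta> > 0" "\<forall>A\<in>sets M. measure M A < \<delta> \<longrightarrow> \<nu> A \<le> e / 2"
        using \<nu>_small[of "e / 2"] by auto
      obtain n0 where "\<And>i. i \<ge> n0 \<Longrightarrow> measure M (A i) < \<delta>"
        using order_tendstoD(2)[OF mA \<delta>(1)] by (auto simp: eventually_sequentially)
      then have "\<nu> (A i) \<le> e / 2" if "i \<ge> n0" for i
        using \<delta>(2) A(1) that by auto
      then have "norm (\<nu> (A i) - 0) < e" if "i \<ge> n0" for i
        using \<nu>0[of "A i"] A(1) that \<open>0 < e\<close> by fastforce
      then show "\<exists>n0. \<forall>i\<ge>n0. norm (\<nu> (A i) - 0) < e" by blast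
    qed
    then show "(\<lambda>i. ennreal (\<nu> (A i))) \<longlonglongrightarrow> 0"
      using tendsto_ennrealI by force
  qed (use pos in auto)
  have em: "emeasure N A = ennreal (\<nu> A)" if "A \<in> sets M" for A
    unfolding N_def using that sets pos ca sig
    by (intro emeasure_measure_of_sigma) auto
  have "absolutely_continuous M N"
    unfolding absolutely_continuous_def
  proof
    fix A assume "A \<in> null_sets M"
    then have A: "A \<in> sets M" "measure M A = 0" by (auto simp: measure_def)
    have "\<nu> A \<le> e" if "e > 0" for e using \<nu>_small[OF that] A by auto
    then have "\<nu> A \<le> 0" by (meson dense_le_bounded field_le_epsilon less_eq_real_def linorder_not_less)
    then show "A \<in> null_sets N" using em[OF A(1)] A(1) setsN by (auto simp: ennreal_neg)
  qed
  then obtain h where h: "h \<in> borel_measurable M" "density M h = N"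
    using Radon_Nikodym setsN by metis
  have hint: "(\<integral>\<^sup>+x\<in>A. h x \<partial>M) = ennreal (\<nu> A)" if "A \<in> sets M" for A
    using emeasure_density[OF h(1) that] em[OF that] h(2) by simp
  have "(\<integral>\<^sup>+x. h x \<partial>M) \<noteq> \<infinity>"
    using hint[of UNIV] sets by simp
  then have hfin: "AE x in M. h x \<noteq> \<infinity>"
    using h(1) nn_integral_PInf_AE by blast
  \<comment> \<open>The density may be infinite on a null set; \<open>enn2real\<close> returns 0
    there.\<close>
  define g where "g x = enn2real (h x)" for x
  have [measurable]: "g \<in> borel_measurable M" using h(1) unfolding g_def by measurable
  have gint: "(\<integral>\<^sup>+x\<in>A. ennreal (g x) \<partial>M) = ennreal (\<nu> A)" if "A \<in> sets M" for A
    unfolding hint[OF that, symmetric]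
    by (rule nn_integral_cong_AE) (use hfin in \<open>auto simp: g_def ennreal_enn2real_if\<close>)
  have g0: "0 \<le> g x" for x by (simp add: g_def)
  have gI: "integrable M g"
    using gint[of UNIV] sets by (intro integrableI_nonneg) (auto simp: g_def)
  have gS: "(LINT x:A|M. g x) = \<nu> A" if "A \<in> sets M" for A
  proof -
    have "(\<integral>\<^sup>+x. ennreal (indicator A x *\<^sub>R g x) \<partial>M) = ennreal (LINT x:A|M. g x)"
      unfolding set_lebesgue_integral_def using g0
      by (intro nn_integral_eq_integral integrable_mult_indicator[OF that gI]) auto
    moreover have "(\<integral>\<^sup>+x. ennreal (indicator A x *\<^sub>R g x) \<partial>M) = (\<integral>\<^sup>+x\<in>A. ennreal (g x) \<partial>M)"
      by (intro nn_integral_cong) (auto simp: indicator_def)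
    ultimately have "ennreal (LINT x:A|M. g x) = (\<integral>\<^sup>+x\<in>A. ennreal (g x) \<partial>M)" by simp
    moreover have "0 \<le> (LINT x:A|M. g x)"
      unfolding set_lebesgue_integral_def by (intro Bochner_Integration.integral_nonneg) (simp add: g_def)
    ultimately show ?thesis using gint[OF that] \<nu>0[OF that] by (simp add: ennreal_inj)
  qed
  show thesis
    using that[OF r gI] lim gS by (auto simp: g_def)
qed

text \<open>The Radon--Nikodym argument needs a positive limit measure. Positive and negative parts
  are dominated by \<open>\<bar>f n\<bar>\<close> and so inherit both hypotheses; a subsequence is
  extracted for each in turn.\<close>

lemma uniformly_integrable_weak_limit:
  fixes f :: "nat \<Rightarrow> 'a::second_countable_topology \<Rightarrow> real"
  assumes fin: "finite_measure M" and sets: "sets M = sets borel"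
    and ui: "uniformly_integrable M f"
    and bnd: "\<And>n. (LINT x|M. \<bar>f n x\<bar>) \<le> C"
  obtains r :: "nat \<Rightarrow> nat" and g where "strict_mono r" "integrable M g"
    "\<And>A. A \<in> sets M \<Longrightarrow> (\<lambda>n. LINT x:A|M. f (r n) x) \<longlonglongrightarrow> (LINT x:A|M. g x)"
proof -
  have int: "integrable M (f n)" for n by (rule uniformly_integrable_integrable[OF ui])
  \<comment> \<open>\<open>s = 1\<close> gives the positive part and \<open>s = -1\<close> the
    negative part. The subsequence \<open>r\<close> is left free since the second extraction starts
    from the first.\<close>
  have part: "uniformly_integrable M (\<lambda>n x. max 0 (s * f (r n) x))"
      "(LINT x|M. \<bar>max 0 (s * f (r n) x)\<bar>) \<le> C" if "s \<in> {1, -1}" for s :: real and r n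
  proof -
    have le: "\<bar>max 0 (s * f n x)\<bar> \<le> \<bar>f n x\<bar>" for n x using that by auto
    show "uniformly_integrable M (\<lambda>n x. max 0 (s * f (r n) x))"
      using le int by (intro uniformly_integrable_dominated[OF uniformly_integrable_subseq[OF ui, of r]]) auto
    have "(LINT x|M. \<bar>max 0 (s * f (r n) x)\<bar>) \<le> (LINT x|M. \<bar>f (r n) x\<bar>)"
      using le int by (intro integral_mono integrable_abs) auto
    then show "(LINT x|M. \<bar>max 0 (s * f (r n) x)\<bar>) \<le> C" using bnd[of "r n"] by simp
  qed
  note p1 = part[of 1 "\<lambda>n. n", OF insertI1]
  obtain r1 :: "nat \<Rightarrow> nat" and g1 where g1: "strict_mono r1" "integrable M g1"
    "\<And>A. A \<in> sets M \<Longrightarrow> (\<lambda>n. LINT x:A|M. max 0 (1 * f (r1 n) x)) \<longlonglongrightarrow> (LINT x:A|M. g1 x)"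
    by (rule uniformly_integrable_weak_limit_nonneg[OF fin sets p1(1) _ p1(2)]) auto
  note p2 = part[of "-1" r1, OF insertI2[OF singletonI]]
  obtain r2 :: "nat \<Rightarrow> nat" and g2 where g2: "strict_mono r2" "integrable M g2"
    "\<And>A. A \<in> sets M \<Longrightarrow> (\<lambda>n. LINT x:A|M. max 0 (- 1 * f (r1 (r2 n)) x)) \<longlonglongrightarrow> (LINT x:A|M. g2 x)"
    by (rule uniformly_integrable_weak_limit_nonneg[OF fin sets p2(1) _ p2(2)]) auto
  show thesis
  proof (rule that[of "r1 \<circ> r2" "\<lambda>x. g1 x - g2 x"])
    show "strict_mono (r1 \<circ> r2)" using g1(1) g2(1) by (rule strict_mono_o)
    show "integrable M (\<lambda>x. g1 x - g2 x)" using g1(2) g2(2) by simp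
    fix A assume A: "A \<in> sets M"
    have eq: "(LINT x:A|M. f ((r1 \<circ> r2) n) x) =
        (LINT x:A|M. max 0 (1 * f (r1 (r2 n)) x)) - (LINT x:A|M. max 0 (- 1 * f (r1 (r2 n)) x))" for n
    proof -
      let ?f = "f (r1 (r2 n))"
      have "set_integrable M A (\<lambda>x. max 0 (s * ?f x))" for s :: real
        unfolding set_integrable_def
        by (intro integrable_mult_indicator[OF A] integrable_max) (auto simp: int)
      then have "(LINT x:A|M. max 0 (1 * ?f x)) - (LINT x:A|M. max 0 (- 1 * ?f x))
          = (LINT x:A|M. max 0 (1 * ?f x) - max 0 (- 1 * ?f x))"
        by (simp only: set_integral_diff(2))
      also have "(\<lambda>x. max 0 (1 * ?f x) - max 0 (- 1 * ?f x)) = ?f" by (auto simp: max_def)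
      finally show ?thesis by simp
    qed
    have "(\<lambda>n. LINT x:A|M. max 0 (1 * f (r1 (r2 n)) x)) \<longlonglongrightarrow> (LINT x:A|M. g1 x)"
      using LIMSEQ_subseq_LIMSEQ[OF g1(3)[OF A] g2(1)] by (simp add: o_def)
    then have "(\<lambda>n. LINT x:A|M. f ((r1 \<circ> r2) n) x) \<longlonglongrightarrow> (LINT x:A|M. g1 x) - (LINT x:A|M. g2 x)"
      unfolding eq using g2(3)[OF A] by (rule tendsto_diff)
    also have "(LINT x:A|M. g1 x) - (LINT x:A|M. g2 x) = (LINT x:A|M. g1 x - g2 x)"
      by (rule set_integral_diff(2)[symmetric])
         (simp_all only: set_integrable_def integrable_mult_indicator[OF A] g1(2) g2(2))
    finally show "(\<lambda>n. LINT x:A|M. f ((r1 \<circ> r2) n) x) \<longlonglongrightarrow> (LINT x:A|M. g1 x - g2 x)" .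
  qed
qed

section \<open>The modular and the norm of \<open>L log L\<close>\<close>

definition \<Phi> :: "real \<Rightarrow> real" where
  "\<Phi> s = \<bar>s\<bar> * ln (exp 1 + \<bar>s\<bar>)"

text \<open>\<open>\<Phi>\<close> has a kink at 0, with one-sided derivatives -1 and 1. As
  \<open>sgn 0 = 0\<close>, the value chosen there is the subgradient 0, and a subgradient is all
  that the tangent inequality asks for.\<close>

definition \<Phi>' :: "real \<Rightarrow> real" where
  "\<Phi>' s = sgn s * (ln (exp 1 + \<bar>s\<bar>) + \<bar>s\<bar> / (exp 1 + \<bar>s\<bar>))"

lemma measurable_\<Phi>[measurable]: "\<Phi> \<in> borel_measurable borel"
  unfolding \<Phi>_def by measurable

lemma measurable_\<Phi>'[measurable]: "\<Phi>' \<in> borel_measurable borel"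
  unfolding \<Phi>'_def sgn_real_def by measurable

lemma exp1_plus_abs_ge: "1 \<le> ln (exp 1 + \<bar>s\<bar>)" for s :: real
  by (subst ln_ge_iff) (auto intro: add_pos_nonneg)

lemma exp1_plus_abs_ge': "0 \<le> ln (exp 1 + \<bar>s\<bar>)" for s :: real
  using exp1_plus_abs_ge[of s] by linarith

text \<open>The shift by \<open>exp 1\<close> keeps the logarithm at least 1. So the modular
  controls the \<open>L\<^sup>1\<close> norm with constant 1.\<close>

lemma abs_le_\<Phi>: "\<bar>s\<bar> \<le> \<Phi> s"
  unfolding \<Phi>_def using mult_left_mono[OF exp1_plus_abs_ge[of s], of "\<bar>s\<bar>"] by simp

lemma \<Phi>_nonneg: "0 \<le> \<Phi> s"
  using abs_le_\<Phi>[of s] by simp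

lemma \<Phi>_mono: "\<bar>r\<bar> \<le> \<bar>s\<bar> \<Longrightarrow> \<Phi> r \<le> \<Phi> s"
  unfolding \<Phi>_def using exp1_plus_abs_ge[of r]
  by (intro mult_mono ln_mono) (auto intro: add_pos_nonneg)

text \<open>On a set where \<open>g\<close> is bounded this makes \<open>\<Phi>' (g / c)\<close> a
  bounded function, hence admissible as a weak test.\<close>

lemma \<Phi>'_bound: "\<bar>s\<bar> \<le> N \<Longrightarrow> \<bar>\<Phi>' s\<bar> \<le> ln (exp 1 + N) + 1"
proof -
  assume s: "\<bar>s\<bar> \<le> N"
  have pos: "0 < exp 1 + \<bar>s\<bar>" by (auto intro: add_pos_nonneg)
  have "\<bar>\<Phi>' s\<bar> \<le> 1 * \<bar>ln (exp 1 + \<bar>s\<bar>) + \<bar>s\<bar> / (exp 1 + \<bar>s\<bar>)\<bar>"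
    unfolding \<Phi>'_def abs_mult by (intro mult_right_mono) (auto simp: sgn_real_def)
  also have "\<dots> = ln (exp 1 + \<bar>s\<bar>) + \<bar>s\<bar> / (exp 1 + \<bar>s\<bar>)"
    using exp1_plus_abs_ge'[of s] pos by (subst abs_of_nonneg) (auto intro!: add_nonneg_nonneg divide_nonneg_nonneg)
  also have "\<dots> \<le> ln (exp 1 + N) + 1"
    using s pos by (intro add_mono ln_mono) (auto simp: divide_le_eq)
  finally show ?thesis .
qed

text \<open>Convexity. On the half-line, \<open>ln x \<le> x - 1\<close> at
  \<open>x = (e + \<alpha>) / (e + \<beta>)\<close> leaves the nonnegative remainder
  \<open>e (\<beta> - \<alpha>)^2 / ((e + \<alpha>) (e + \<beta>))\<close>. For general signs,
  \<open>sgn a * (b - a) \<le> \<bar>b\<bar> - \<bar>a\<bar>\<close> reduces to this case because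
  the slope \<open>d\<close> is nonnegative.\<close>

lemma \<Phi>_tangent: "\<Phi> a + \<Phi>' a * (b - a) \<le> \<Phi> b"
proof -
  define e where "e = exp (1::real)"
  have e: "e > 0" by (simp add: e_def)
  have nonneg: "\<beta> * ln (e + \<beta>) \<ge> \<alpha> * ln (e + \<alpha>) + (ln (e + \<alpha>) + \<alpha> / (e + \<alpha>)) * (\<beta> - \<alpha>)"
    if "0 \<le> \<alpha>" "0 \<le> \<beta>" for \<alpha> \<beta> :: real
  proof -
    have pos: "0 < e + \<alpha>" "0 < e + \<beta>" using that e by auto
    have "ln ((e + \<alpha>) / (e + \<beta>)) \<le> (e + \<alpha>) / (e + \<beta>) - 1"
      using pos by (intro ln_le_minus_one) auto
    then have "ln (e + \<beta>) - ln (e + \<alpha>) \<ge> (\<beta> - \<alpha>) / (e + \<beta>)"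
      using pos by (simp add: ln_div field_simps)
    then have "\<beta> * (ln (e + \<beta>) - ln (e + \<alpha>)) \<ge> \<beta> * ((\<beta> - \<alpha>) / (e + \<beta>))"
      using that by (intro mult_left_mono) auto
    moreover have "\<beta> * ((\<beta> - \<alpha>) / (e + \<beta>)) - \<alpha> / (e + \<alpha>) * (\<beta> - \<alpha>) = e * (\<beta> - \<alpha>)\<^sup>2 / ((e + \<alpha>) * (e + \<beta>))"
      using pos by (simp add: field_simps power2_eq_square)
    moreover have "0 \<le> e * (\<beta> - \<alpha>)\<^sup>2 / ((e + \<alpha>) * (e + \<beta>))"
      using pos e by simp
    ultimately show ?thesis by (simp add: algebra_simps)
  qed
  define d where "d = ln (e + \<bar>a\<bar>) + \<bar>a\<bar> / (e + \<bar>a\<bar>)"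
  have "d \<ge> 0"
    using exp1_plus_abs_ge[of a] e unfolding d_def e_def[symmetric]
    by (intro add_nonneg_nonneg divide_nonneg_nonneg) linarith+
  have "sgn a * (b - a) \<le> \<bar>b\<bar> - \<bar>a\<bar>"
    by (auto simp: sgn_real_def)
  then have "d * (sgn a * (b - a)) \<le> d * (\<bar>b\<bar> - \<bar>a\<bar>)"
    using \<open>d \<ge> 0\<close> by (rule mult_left_mono)
  then show ?thesis
    using nonneg[of "\<bar>a\<bar>" "\<bar>b\<bar>"]
    unfolding \<Phi>_def \<Phi>'_def e_def[symmetric] d_def[symmetric] by (simp add: ac_simps)
qed

lemma LlogL_norm_eq:
  "LlogL_norm A g = (INF \<mu>\<in>{\<mu>. 0 < \<mu> \<and> (\<integral>\<^sup>+x\<in>A. ennreal (\<Phi> (g x / \<mu>)) \<partial>lborel) \<le> 1}. ennreal \<mu>)"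
proof -
  have "\<bar>g x\<bar> / \<mu> * ln (exp 1 + \<bar>g x\<bar> / \<mu>) = \<Phi> (g x / \<mu>)" if "0 < \<mu>" for x \<mu>
    using that by (simp add: \<Phi>_def)
  then have "{\<mu>::real. 0 < \<mu> \<and>
        (\<integral>\<^sup>+x\<in>A. ennreal (\<bar>g x\<bar> / \<mu> * ln (exp 1 + \<bar>g x\<bar> / \<mu>)) \<partial>lborel) \<le> 1}
     = {\<mu>. 0 < \<mu> \<and> (\<integral>\<^sup>+x\<in>A. ennreal (\<Phi> (g x / \<mu>)) \<partial>lborel) \<le> 1}"
    by (intro Collect_cong conj_cong refl) simp
  then show ?thesis unfolding LlogL_norm_def by simp
qed

lemma LlogL_modular_antimono:
  assumes "0 < \<mu>" "\<mu> \<le> \<mu>'"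
  shows "(\<integral>\<^sup>+x\<in>A. ennreal (\<Phi> (g x / \<mu>')) \<partial>lborel) \<le> (\<integral>\<^sup>+x\<in>A. ennreal (\<Phi> (g x / \<mu>)) \<partial>lborel)"
  using assms
  by (intro nn_integral_mono mult_right_mono ennreal_leI \<Phi>_mono)
     (auto simp: abs_divide intro!: divide_left_mono mult_pos_pos)

lemma LlogL_norm_less_iff:
  "LlogL_norm A g < a \<longleftrightarrow>
     (\<exists>\<mu>. 0 < \<mu> \<and> ennreal \<mu> < a \<and> (\<integral>\<^sup>+x\<in>A. ennreal (\<Phi> (g x / \<mu>)) \<partial>lborel) \<le> 1)"
  unfolding LlogL_norm_eq INF_less_iff by auto

lemma LlogL_norm_leI:
  "0 < \<mu> \<Longrightarrow> (\<integral>\<^sup>+x\<in>A. ennreal (\<Phi> (g x / \<mu>)) \<partial>lborel) \<le> 1 \<Longrightarrow> LlogL_norm A g \<le> ennreal \<mu>"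
  unfolding LlogL_norm_eq by (rule INF_lower) simp

text \<open>A strict inequality provides an admissible scale below \<mu>, and the modular decreases
  in the scale. No attainment of the infimum has to be discussed.\<close>

lemma LlogL_norm_less_imp_modular:
  assumes "LlogL_norm A g < ennreal \<mu>"
  shows "(\<integral>\<^sup>+x\<in>A. ennreal (\<Phi> (g x / \<mu>)) \<partial>lborel) \<le> 1"
proof -
  obtain m where "0 < m" "ennreal m < ennreal \<mu>" "(\<integral>\<^sup>+x\<in>A. ennreal (\<Phi> (g x / m)) \<partial>lborel) \<le> 1"
    using assms unfolding LlogL_norm_less_iff by blast
  then show ?thesis
    by (intro order.trans[OF LlogL_modular_antimono[of m \<mu> g A]]) (auto simp: ennreal_less_iff)
qed

text \<open>Countably many scales decide the inequality, which is what makes the norm measurable in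
  a parameter.\<close>

lemma LlogL_norm_less_iff_rational:
  "LlogL_norm A g < a \<longleftrightarrow>
     (\<exists>q::rat. 0 < q \<and> ennreal (of_rat q) < a \<and> (\<integral>\<^sup>+x\<in>A. ennreal (\<Phi> (g x / of_rat q)) \<partial>lborel) \<le> 1)"
proof
  assume "LlogL_norm A g < a"
  then obtain \<mu> where \<mu>: "0 < \<mu>" "ennreal \<mu> < a" "(\<integral>\<^sup>+x\<in>A. ennreal (\<Phi> (g x / \<mu>)) \<partial>lborel) \<le> 1"
    unfolding LlogL_norm_less_iff by blast
  \<comment> \<open>The strict inequality in \<open>ennreal\<close> leaves a real gap above \<mu>,
    and a rational fits into it.\<close>
  obtain \<mu>' where \<mu>': "\<mu> < \<mu>'" "ennreal \<mu>' < a"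
  proof -
    obtain c where c: "ennreal \<mu> < c" "c < a" using \<mu>(2) dense by blast
    then have "c \<noteq> top" by auto
    then obtain r where "c = ennreal r" "0 \<le> r" by (cases c) auto
    then show thesis using c \<mu>(1) that[of r] by (auto simp: ennreal_less_iff)
  qed
  obtain q where q: "\<mu> < of_rat q" "of_rat q < \<mu>'"
    using of_rat_dense[OF \<mu>'(1)] by blast
  have "0 < (of_rat q :: real)" using q(1) \<mu>(1) by linarith
  then have "0 < q" by simp
  moreover have "ennreal (of_rat q) < a"
    using q(2) \<mu>'(2) by (meson ennreal_leI less_imp_le order.strict_trans1)
  moreover have "(\<integral>\<^sup>+x\<in>A. ennreal (\<Phi> (g x / of_rat q)) \<partial>lborel) \<le> 1"
    using LlogL_modular_antimono[of \<mu> "of_rat q" g A] q(1) \<mu>(1,3) by (meson less_imp_le order.trans)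
  ultimately show "\<exists>q::rat. 0 < q \<and> ennreal (of_rat q) < a \<and> (\<integral>\<^sup>+x\<in>A. ennreal (\<Phi> (g x / of_rat q)) \<partial>lborel) \<le> 1"
    by blast
next
  assume "\<exists>q::rat. 0 < q \<and> ennreal (of_rat q) < a \<and> (\<integral>\<^sup>+x\<in>A. ennreal (\<Phi> (g x / of_rat q)) \<partial>lborel) \<le> 1"
  then obtain q :: rat where "0 < q" "ennreal (of_rat q) < a"
    "(\<integral>\<^sup>+x\<in>A. ennreal (\<Phi> (g x / of_rat q)) \<partial>lborel) \<le> 1" by blast
  then show "LlogL_norm A g < a"
    unfolding LlogL_norm_less_iff by (intro exI[of _ "of_rat q"]) simp
qed

text \<open>The essential supremum in time is bounded through \<open>esssup_I\<close>, which asks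
  for measurability of the norm as a function of \<open>t\<close>.\<close>

lemma measurable_LlogL_norm:
  fixes w :: "real \<times> real \<Rightarrow> real"
  assumes [measurable]: "w \<in> borel_measurable borel" "A \<in> sets borel"
  shows "(\<lambda>t. LlogL_norm A (\<lambda>x. w (x, t))) \<in> borel_measurable borel"
proof (rule borel_measurableI_less)
  fix a :: ennreal
  have [measurable]: "(\<lambda>t. \<integral>\<^sup>+x\<in>A. ennreal (\<Phi> (w (x, t) / c)) \<partial>lborel) \<in> borel_measurable borel" for c
  proof -
    have "w \<in> borel_measurable (borel \<Otimes>\<^sub>M borel)" by (simp add: borel_prod)
    then have "(\<lambda>(t, x). ennreal (\<Phi> (w (x, t) / c)) * indicator A x) \<in> borel_measurable (borel \<Otimes>\<^sub>M lborel)"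
      by measurable
    then show ?thesis
      using lborel.borel_measurable_nn_integral by blast
  qed
  have "{t \<in> space borel. LlogL_norm A (\<lambda>x. w (x, t)) < a} =
    (\<Union>q\<in>{q::rat. 0 < q \<and> ennreal (of_rat q) < a}.
       {t \<in> space borel. (\<integral>\<^sup>+x\<in>A. ennreal (\<Phi> (w (x, t) / of_rat q)) \<partial>lborel) \<le> 1})"
    by (auto simp: LlogL_norm_less_iff_rational)
  also have "\<dots> \<in> sets borel"
    by (intro sets.countable_UN'') auto
  finally show "{t \<in> space borel. LlogL_norm A (\<lambda>x. w (x, t)) < a} \<in> sets borel" .
qed

section \<open>Ascoli compactness without compactness of the domain\<close>

text \<open>The intended domain, a half-open slab, is neither closed nor bounded. Convergence on a
  countable dense \<open>D\<close> is carried to a bounded \<open>A\<close> by a finite net of the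
  compact closure of \<open>A\<close>; its centres are taken from \<open>D \<subseteq> S\<close>,
  where the equicontinuity is available.\<close>

lemma uniformly_equicontinuous_subseq:
  fixes f :: "nat \<Rightarrow> 'a::euclidean_space \<Rightarrow> real"
  assumes bnd: "\<And>n x. x \<in> S \<Longrightarrow> \<bar>f n x\<bar> \<le> B"
    and equi: "\<And>e. 0 < e \<Longrightarrow> \<exists>d>0. \<forall>n. \<forall>x\<in>S. \<forall>y\<in>S. dist x y < d \<longrightarrow> \<bar>f n x - f n y\<bar> < e"
  obtains k :: "nat \<Rightarrow> nat" and g where "strict_mono k"
    "\<And>A. A \<subseteq> S \<Longrightarrow> bounded A \<Longrightarrow> uniform_limit A (\<lambda>n. f (k n)) g sequentially"
proof -
  obtain D where D: "countable D" "D \<subseteq> S" "S \<subseteq> closure D"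
    using separable by blast
  obtain k :: "nat \<Rightarrow> nat" where k: "strict_mono k"
    and conv: "\<And>x. x \<in> D \<Longrightarrow> \<exists>l. (\<lambda>n. f (k n) x) \<longlonglongrightarrow> l"
    using function_convergent_subsequence[OF D(1), of f B] bnd D(2) by (metis real_norm_def subsetD)
  have Cauchy: "\<exists>N. \<forall>m n x. N \<le> m \<and> N \<le> n \<and> x \<in> A \<longrightarrow> dist (f (k m) x) (f (k n) x) < e"
    if A: "A \<subseteq> S" "bounded A" and "0 < e" for A e
  proof -
    obtain d where d: "0 < d" "\<And>n x y. x \<in> S \<Longrightarrow> y \<in> S \<Longrightarrow> dist x y < d \<Longrightarrow> \<bar>f n x - f n y\<bar> < e / 3"
      using equi[of "e / 3"] \<open>0 < e\<close> by auto
    have "closure A \<subseteq> closure D"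
      using A(1) D(3) by (meson closure_minimal closed_closure subset_trans)
    then have "closure A \<subseteq> (\<Union>c\<in>D. ball c d)"
      using d(1) by (force simp: closure_approachable)
    moreover have "compact (closure A)" using A(2) by simp
    ultimately obtain F where F: "F \<subseteq> D" "finite F" "closure A \<subseteq> (\<Union>c\<in>F. ball c d)"
      using compactE_image[of "closure A" D "\<lambda>c. ball c d"] by auto
    have "\<exists>N. \<forall>m n. N \<le> m \<and> N \<le> n \<longrightarrow> dist (f (k m) c) (f (k n) c) < e / 3" if "c \<in> F" for c
    proof -
      have "Cauchy (\<lambda>n. f (k n) c)"
        using conv[of c] that F(1) by (auto simp: convergent_eq_Cauchy)
      then show ?thesis unfolding Cauchy_def using \<open>0 < e\<close>
        by (metis zero_less_divide_iff zero_less_numeral)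
    qed
    then obtain N where N: "\<And>c m n. c \<in> F \<Longrightarrow> N c \<le> m \<Longrightarrow> N c \<le> n \<Longrightarrow> dist (f (k m) c) (f (k n) c) < e / 3"
      by metis
    show ?thesis
    proof (intro exI allI impI)
      fix m n x assume mnx: "Max (N ` F) \<le> m \<and> Max (N ` F) \<le> n \<and> x \<in> A"
      then obtain c where c: "c \<in> F" "dist c x < d"
        using F(3) closure_subset[of A] by (auto simp: subset_iff)
      have "N c \<le> Max (N ` F)" using c(1) F(2) by simp
      then have dc: "dist (f (k m) c) (f (k n) c) < e / 3"
        using mnx by (intro N[OF c(1)]) auto
      have "\<bar>f i c - f i x\<bar> < e / 3" for i
        using c mnx A(1) F(1) D(2) by (intro d(2)) auto
      from this[of "k m"] this[of "k n"] dc show "dist (f (k m) x) (f (k n) x) < e"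
        unfolding dist_real_def by linarith
    qed
  qed
  define g where "g x = lim (\<lambda>n. f (k n) x)" for x
  have g: "(\<lambda>n. f (k n) x) \<longlonglongrightarrow> g x" if "x \<in> S" for x
  proof -
    have "Cauchy (\<lambda>n. f (k n) x)"
      unfolding Cauchy_def
    proof (intro allI impI)
      fix e :: real assume "0 < e"
      then have "\<exists>N. \<forall>m n. N \<le> m \<and> N \<le> n \<longrightarrow> dist (f (k m) x) (f (k n) x) < e"
        using Cauchy[of "{x}" e] that by simp
      then show "\<exists>N. \<forall>m\<ge>N. \<forall>n\<ge>N. dist (f (k m) x) (f (k n) x) < e" by blast
    qed
    then show ?thesis by (simp add: g_def Cauchy_convergent_iff convergent_LIMSEQ_iff)
  qed
  show thesis
  proof (rule that[OF k])
    fix A assume A: "A \<subseteq> S" "bounded A"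
    have "\<forall>e>0. \<exists>N. \<forall>n x. N \<le> n \<and> x \<in> A \<longrightarrow> dist (f (k n) x) (g x) < e"
    proof (rule uniformly_cauchy_imp_uniformly_convergent)
      show "\<forall>x. x \<in> A \<longrightarrow> (\<forall>e>0. \<exists>N. \<forall>n. N \<le> n \<longrightarrow> dist (f (k n) x) (g x) < e)"
        using g A(1) unfolding lim_sequentially by blast
    qed (use Cauchy[OF A] in blast)
    then show "uniform_limit A (\<lambda>n. f (k n)) g sequentially"
      unfolding uniform_limit_sequentially_iff by meson
  qed
qed

section \<open>The Fejer kernel and the regularized convolution\<close>

lemma sum_cos_symmetric:
  "(\<Sum>q\<in>{- int m..int m}. cos (of_int q * \<alpha>)) = 1 + 2 * (\<Sum>i<m. cos ((real i + 1) * \<alpha>))"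
proof (induction m)
  case 0
  show ?case by simp
next
  case (Suc m)
  have "{- int (Suc m)..int (Suc m)} = insert (int (Suc m)) (insert (- int (Suc m)) {- int m..int m})"
    by auto
  moreover have "cos (- (\<alpha> + real m * \<alpha>)) = cos (\<alpha> + real m * \<alpha>)" by (rule cos_minus)
  ultimately show ?case
    using Suc by (simp add: algebra_simps del: cos_minus)
qed

lemma cmod_add_sq: "(cmod (z + w))\<^sup>2 = (cmod z)\<^sup>2 + (cmod w)\<^sup>2 + 2 * Re (w * cnj z)"
  by (simp add: cmod_power2) (simp add: power2_eq_square algebra_simps)

text \<open>Adding \<open>cis (m \<alpha>)\<close> to the exponential sum raises its squared modulus
  by \<open>1 + 2 \<Sum> cos ((m - i) \<alpha>)\<close>. After reversal of the index this is the
  inner cosine sum for \<open>j = m\<close>. The square form gives both the sign and the decay of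
  the kernel.\<close>

lemma sum_sum_cos_eq_cmod_sq:
  "(\<Sum>j<m. \<Sum>q\<in>{- int j..int j}. cos (of_int q * \<alpha>)) = (cmod (\<Sum>j<m. cis (real j * \<alpha>)))\<^sup>2"
proof (induction m)
  case 0
  show ?case by simp
next
  case (Suc m)
  let ?D = "\<Sum>j<m. cis (real j * \<alpha>)"
  have "(cmod (?D + cis (real m * \<alpha>)))\<^sup>2 = (cmod ?D)\<^sup>2 + 1 + 2 * Re (cis (real m * \<alpha>) * cnj ?D)"
    unfolding cmod_add_sq by simp
  also have "Re (cis (real m * \<alpha>) * cnj ?D) = (\<Sum>i<m. cos ((real m - real i) * \<alpha>))"
    by (simp only: cnj_sum cis_cnj sum_distrib_left cis_mult Re_sum cis.sel) (simp add: algebra_simps)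
  also have "\<dots> = (\<Sum>i<m. cos ((real i + 1) * \<alpha>))"
    by (subst sum.nat_diff_reindex[symmetric]) (auto intro!: sum.cong simp: of_nat_diff)
  finally show ?case
    using Suc by (simp add: sum_cos_symmetric)
qed

lemma Re_real_mult: "Re (complex_of_real a * z) = a * Re z"
  by simp

lemma fejer_eq_cos:
  "fejer P m x = 1 / real m * (\<Sum>j<m. \<Sum>q\<in>{- int j..int j}. cos (of_int q * (pi * x / P)))"
proof -
  have "exp (\<i> * of_real (pi * of_int q * x / P)) = cis (of_int q * (pi * x / P))" for q :: int
    by (simp add: cis_conv_exp algebra_simps)
  moreover have "1 / complex_of_nat m = complex_of_real (1 / real m)" by simp
  ultimately show ?thesis
    unfolding fejer_def by (simp only: Re_real_mult Re_sum cis.sel)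
qed

lemma fejer_eq_cmod:
  "fejer P m x = 1 / real m * (cmod (\<Sum>j<m. cis (real j * (pi * x / P))))\<^sup>2"
  unfolding fejer_eq_cos sum_sum_cos_eq_cmod_sq ..

lemma fejer_nonneg: "0 \<le> fejer P m x"
  unfolding fejer_eq_cmod by simp

text \<open>Multiplied by \<open>cis \<alpha> - 1\<close> the exponential sum telescopes to a number
  of modulus at most 2, and \<open>\<bar>cis \<alpha> - 1\<bar>^2 = 2 (1 - cos \<alpha>)\<close>.
  The product form stays valid at the periods, where a quotient would not make sense.\<close>

lemma fejer_le: "fejer P m x * (1 - cos (pi * x / P)) \<le> 2 / real m"
proof -
  define \<alpha> where "\<alpha> = pi * x / P"
  let ?D = "\<Sum>j<m. cis (real j * \<alpha>)"
  have "?D * (cis \<alpha> - 1) = cis (real m * \<alpha>) - 1"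
    by (induction m) (auto simp: cis_mult algebra_simps distrib_right)
  then have "cmod ?D * cmod (cis \<alpha> - 1) = cmod (cis (real m * \<alpha>) - 1)"
    by (metis norm_mult)
  also have "\<dots> \<le> 2"
    using norm_triangle_ineq4[of "cis (real m * \<alpha>)" 1] by simp
  finally have "(cmod ?D * cmod (cis \<alpha> - 1))\<^sup>2 \<le> 2\<^sup>2"
    by (intro power_mono) auto
  moreover have "(cmod (cis \<alpha> - 1))\<^sup>2 = 2 * (1 - cos \<alpha>)"
    by (simp add: cmod_power2 sin_squared_eq) (simp add: power2_eq_square algebra_simps)
  ultimately have "(cmod ?D)\<^sup>2 * (1 - cos \<alpha>) \<le> 2"
    by (simp add: power_mult_distrib right_diff_distrib)
  then show ?thesis
    unfolding fejer_eq_cmod \<alpha>_def[symmetric] by (simp add: divide_right_mono)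
qed

lemma continuous_fejer: "continuous_on A (fejer P m)"
  unfolding fejer_eq_cos divide_inverse
  by (intro continuous_on_const continuous_on_mult continuous_on_sum continuous_on_cos continuous_on_id)

lemma measurable_fejer[measurable]: "fejer P m \<in> borel_measurable borel"
  using continuous_fejer by (rule borel_measurable_continuous_onI)

text \<open>The sign \<open>s\<close> serves two uses: \<open>X - y\<close> in a convolution, and
  the kernel itself, with \<open>X = 0\<close> and \<open>s = -1\<close>.\<close>

lemma integral_cos_cell:
  fixes q :: int
  assumes "P > 0" and that: "s = 1 \<or> s = (-1::real)"
  shows "(LINT y:{-P..P}|lborel. cos (of_int q * (pi * (X - s * y) / P))) = (if q = 0 then 2 * P else 0)"
proof (cases "q = 0")
  case True
  then show ?thesis using assms by (simp add: set_lebesgue_integral_def)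
next
  case False
  define F where "F y = - (s * P / (of_int q * pi)) * sin (of_int q * (pi * (X - s * y) / P))" for y
  have ss: "s * s = 1" using that by auto
  have "(F has_real_derivative s * s * cos (of_int q * (pi * (X - s * y) / P))) (at y)" for y
    unfolding F_def using False assms(1)
    by (auto intro!: derivative_eq_intros simp: field_simps)
  then have "(F has_real_derivative cos (of_int q * (pi * (X - s * y) / P))) (at y)" for y
    by (simp only: ss mult_1_left)
  then have "(LINT y:{-P..P}|lborel. cos (of_int q * (pi * (X - s * y) / P))) = F P - F (- P)"
    unfolding set_lebesgue_integral_def using assms
    by (intro integral_FTC_Icc)
       (auto simp: has_real_derivative_iff_has_vector_derivative[symmetric]
         intro: has_field_derivative_at_within intro!: continuous_intros)
  moreover have "sin (of_int q * (pi * (X - s * P) / P)) = sin (of_int q * (pi * (X - s * (- P)) / P))"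
  proof -
    have eq: "of_int q * (pi * (X - s * (\<epsilon> * P)) / P) = of_int q * pi * X / P - \<epsilon> * s * (pi * of_int q)" for \<epsilon>
      using assms by (simp add: field_simps)
    have "sin (pi * of_int q) = 0" "sin (- (pi * of_int q)) = 0" by (simp_all add: sin_npi_int)
    then show ?thesis
      using eq[of 1] eq[of "-1"] that by (auto simp: sin_diff sin_add)
  qed
  ultimately show ?thesis using False by (simp add: F_def)
qed

lemma integral_fejer_cell:
  assumes "P > 0" "m > 0" "s = 1 \<or> s = (-1::real)"
  shows "(LINT y:{-P..P}|lborel. fejer P m (X - s * y)) = 2 * P"
proof -
  have int: "set_integrable lborel {-P..P} (\<lambda>y. cos (of_int q * (pi * (X - s * y) / P)))" for q :: int
    using assms(1) by (intro borel_integrable_atLeastAtMost') (auto intro!: continuous_intros)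
  have "(LINT y:{-P..P}|lborel. fejer P m (X - s * y)) =
      1 / real m * (\<Sum>j<m. \<Sum>q\<in>{- int j..int j}. LINT y:{-P..P}|lborel. cos (of_int q * (pi * (X - s * y) / P)))"
  proof -
    have "(LINT y:{-P..P}|lborel. fejer P m (X - s * y)) = (LINT y|lborel. 1 / real m *
        (\<Sum>j<m. \<Sum>q\<in>{- int j..int j}. indicator {-P..P} y *\<^sub>R cos (of_int q * (pi * (X - s * y) / P))))"
      unfolding set_lebesgue_integral_def fejer_eq_cos
    proof (intro Bochner_Integration.integral_cong refl)
      fix y
      let ?c = "\<lambda>q. cos (of_int q * (pi * (X - s * y) / P))"
      show "indicator {-P..P} y *\<^sub>R (1 / real m * (\<Sum>j<m. \<Sum>q\<in>{- int j..int j}. ?c q)) =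
          1 / real m * (\<Sum>j<m. \<Sum>q\<in>{- int j..int j}. indicator {-P..P} y *\<^sub>R ?c q)"
        by (cases "y \<in> {-P..P}") simp_all
    qed
    then show ?thesis
      by (simp only: integral_mult_right_zero Bochner_Integration.integral_sum
          Bochner_Integration.integrable_sum int[unfolded set_integrable_def] set_lebesgue_integral_def)
  qed
  also have "\<dots> = 1 / real m * (\<Sum>j<m. 2 * P)"
    by (simp only: integral_cos_cell[OF assms(1,3)]) simp
  finally show ?thesis using assms(2) by simp
qed

lemma periodic_add_int:
  fixes u :: "real \<Rightarrow> 'b"
  assumes per: "\<And>x. u (x + 2 * P) = u x"
  shows "u (x + 2 * P * of_int j) = u x"
proof -
  have n: "u (x + 2 * P * real n) = u x" for x n
  proof (induction n)
    case (Suc n)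
    then show ?case using per[of "x + 2 * P * real n"] by (simp add: algebra_simps)
  qed simp
  show ?thesis
  proof (cases "0 \<le> j")
    case True
    then show ?thesis using n[of x "nat j"] by simp
  next
    case False
    then show ?thesis using n[of "x + 2 * P * of_int j" "nat (- j)"] by simp
  qed
qed

text \<open>If \<open>X - y\<close> is within \<delta> of a multiple of the period, a shift by that
  multiple brings the continuity of \<open>u\<close> to bear. Otherwise \<open>fejer_le\<close>
  bounds the kernel by \<open>2 / (m (1 - cos (pi \<delta> / P)))\<close> and the difference of
  values of \<open>u\<close> is at most \<open>2 B\<close>. The first part is weighted with the
  kernel, of mass \<open>2 P\<close>; the second is a constant over a cell of length
  \<open>2 P\<close>.\<close>

lemma fejer_approximation:
  fixes u :: "real \<Rightarrow> real"
  assumes P: "P > 0" and m: "m > 0" and \<delta>: "0 < \<delta>" "\<delta> \<le> P"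
    and cont: "continuous_on UNIV u" and per: "\<And>x. u (x + 2 * P) = u x"
    and B: "\<And>x. \<bar>u x\<bar> \<le> B"
    and \<omega>: "\<And>x y. \<bar>x - y\<bar> \<le> \<delta> \<Longrightarrow> \<bar>u x - u y\<bar> \<le> \<omega>"
  shows "\<bar>1 / (2 * P) * torus_conv P (fejer P m) u X - u X\<bar> \<le> \<omega> + 4 * B / (real m * (1 - cos (pi * \<delta> / P)))"
proof -
  define R where "R = 4 * B / (real m * (1 - cos (pi * \<delta> / P)))"
  have "B \<ge> 0" using B[of 0] by simp
  have "cos (pi * \<delta> / P) < cos 0"
    using P \<delta> by (intro cos_monotone_0_pi) (auto simp: field_simps)
  then have c: "1 - cos (pi * \<delta> / P) > 0" by simp
  have "\<omega> \<ge> 0" using \<omega>[of 0 0] \<delta> by simp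
  have "R \<ge> 0" using c \<open>B \<ge> 0\<close> by (simp add: R_def)
  have pt: "\<bar>fejer P m (X - y) * (u y - u X)\<bar> \<le> fejer P m (X - y) * \<omega> + R" for y
  proof -
    \<comment> \<open>Rounding picks the representative \<open>r\<close> of \<open>X - y\<close>
      nearest to 0. Then \<open>\<bar>r\<bar> \<le> P\<close>, so the angle stays in the range on
      which the cosine decreases.\<close>
    define j where "j = round ((X - y) / (2 * P))"
    define r where "r = X - y - 2 * P * of_int j"
    have "\<bar>(X - y) / (2 * P) - of_int j\<bar> \<le> 1 / 2"
      unfolding j_def using of_int_round_abs_le[of "(X - y) / (2 * P)"] by (simp add: abs_minus_commute)
    moreover have "r = 2 * P * ((X - y) / (2 * P) - of_int j)"
      using P by (simp add: r_def field_simps)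
    ultimately have rP: "\<bar>r\<bar> \<le> P"
      using P by (simp add: abs_mult)
    show ?thesis
    proof (cases "\<bar>r\<bar> \<le> \<delta>")
      case True
      have "u y - u X = u (y + 2 * P * of_int j) - u X"
        using periodic_add_int[of u P, OF per] by simp
      also have "\<bar>\<dots>\<bar> \<le> \<omega>"
        using True by (intro \<omega>) (simp add: r_def abs_minus_commute algebra_simps)
      finally have "fejer P m (X - y) * \<bar>u y - u X\<bar> \<le> fejer P m (X - y) * \<omega>"
        by (intro mult_left_mono fejer_nonneg)
      then show ?thesis using \<open>R \<ge> 0\<close> by (simp add: abs_mult fejer_nonneg)
    next
      case False
      have "cos (pi * (X - y) / P) = cos (pi * r / P + of_int j * (2 * pi))"
        using P by (simp add: r_def field_simps)
      also have "\<dots> = cos (pi * r / P)"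
        using periodic_add_int[of cos pi "pi * r / P" j, OF cos_periodic] by (simp add: algebra_simps)
      also have "\<dots> = cos (pi * \<bar>r\<bar> / P)"
        by (cases "r \<ge> 0") auto
      also have "\<dots> \<le> cos (pi * \<delta> / P)"
        using False rP \<delta> P by (intro cos_monotone_0_pi_le) (auto simp: divide_simps mult_le_cancel_left)
      finally have cc: "1 - cos (pi * \<delta> / P) \<le> 1 - cos (pi * (X - y) / P)" by simp
      have "fejer P m (X - y) * (1 - cos (pi * \<delta> / P)) \<le> fejer P m (X - y) * (1 - cos (pi * (X - y) / P))"
        using cc by (intro mult_left_mono fejer_nonneg)
      also have "\<dots> \<le> 2 / real m" by (rule fejer_le)
      finally have F: "fejer P m (X - y) \<le> 2 / (real m * (1 - cos (pi * \<delta> / P)))"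
        using c m by (simp add: field_simps)
      have "\<bar>fejer P m (X - y) * (u y - u X)\<bar> = fejer P m (X - y) * \<bar>u y - u X\<bar>"
        by (simp add: abs_mult fejer_nonneg)
      also have "\<dots> \<le> 2 / (real m * (1 - cos (pi * \<delta> / P))) * (2 * B)"
        using F B[of y] B[of X] fejer_nonneg c by (intro mult_mono) auto
      also have "\<dots> = R" by (simp add: R_def)
      finally show ?thesis
        using mult_nonneg_nonneg[OF fejer_nonneg \<open>\<omega> \<ge> 0\<close>, of P m "X - y"] by linarith
    qed
  qed
  have cF: "continuous_on {-P..P} (\<lambda>y. fejer P m (X - y))"
    by (rule continuous_on_compose2[OF continuous_fejer[of UNIV]]) (auto intro!: continuous_intros)
  have cu: "continuous_on {-P..P} u" using cont continuous_on_subset by blast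
  have i1: "set_integrable lborel {-P..P} (\<lambda>y. fejer P m (X - y) * (u y - u X))"
    by (intro borel_integrable_atLeastAtMost' continuous_intros cF cu)
  have i2: "set_integrable lborel {-P..P} (\<lambda>y. fejer P m (X - y) * u y)"
    by (intro borel_integrable_atLeastAtMost' continuous_intros cF cu)
  have i3: "set_integrable lborel {-P..P} (\<lambda>y. fejer P m (X - y) * c)" for c
    by (intro borel_integrable_atLeastAtMost' continuous_intros cF)
  have i4: "set_integrable lborel {-P..P} (\<lambda>y. fejer P m (X - y) * \<omega> + R)"
    by (intro borel_integrable_atLeastAtMost' continuous_intros cF)
  have i5: "set_integrable lborel {-P..P} (\<lambda>y. R)"
    by (intro borel_integrable_atLeastAtMost' continuous_intros)
  have I: "(LINT y:{-P..P}|lborel. fejer P m (X - y)) = 2 * P"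
    using integral_fejer_cell[OF P m, of 1 X] by simp
  have "(LINT y:{-P..P}|lborel. fejer P m (X - y) * (u y - u X))
      = torus_conv P (fejer P m) u X - 2 * P * u X"
    unfolding torus_conv_def right_diff_distrib using i2 i3[of "u X"] I
    by (subst set_integral_diff) auto
  moreover have "\<bar>LINT y:{-P..P}|lborel. fejer P m (X - y) * (u y - u X)\<bar>
      \<le> (LINT y:{-P..P}|lborel. \<bar>fejer P m (X - y) * (u y - u X)\<bar>)"
    using set_integral_norm_bound[OF i1] by simp
  moreover have "\<dots> \<le> (LINT y:{-P..P}|lborel. fejer P m (X - y) * \<omega> + R)"
    using pt i1 i4 by (intro set_integral_mono) (auto intro: set_integrable_abs)
  moreover have "\<dots> = 2 * P * \<omega> + 2 * P * R"
    using i3[of \<omega>] i5 I P by (subst set_integral_add) (auto simp: set_lebesgue_integral_def)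
  ultimately have "\<bar>torus_conv P (fejer P m) u X - 2 * P * u X\<bar> \<le> 2 * P * (\<omega> + R)"
    by (simp add: algebra_simps)
  then have "\<bar>2 * P * (1 / (2 * P) * torus_conv P (fejer P m) u X - u X)\<bar> \<le> 2 * P * (\<omega> + R)"
    using P by (simp add: algebra_simps)
  then show ?thesis
    unfolding abs_mult R_def[symmetric] using P by simp
qed

lemma integrable_mult_bounded:
  fixes f g :: "'a \<Rightarrow> real"
  assumes f: "integrable M f" and g: "g \<in> borel_measurable M" and B: "\<And>x. \<bar>g x\<bar> \<le> B"
  shows "integrable M (\<lambda>x. f x * g x)"
proof (rule Bochner_Integration.integrable_bound[OF integrable_mult_left[OF f, of B]])
  show "(\<lambda>x. f x * g x) \<in> borel_measurable M" using f g by measurable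
  have "\<bar>f x * g x\<bar> \<le> \<bar>f x * B\<bar>" for x
    unfolding abs_mult using B[of x] by (intro mult_left_mono) auto
  then show "AE x in M. norm (f x * g x) \<le> norm (f x * B)" by simp
qed

lemma integrable_mult_product:
  fixes f g :: "real \<Rightarrow> real"
  assumes f: "integrable lborel f" and g: "integrable lborel g"
    and H: "(\<lambda>(y, z). H y z) \<in> borel_measurable (lborel \<Otimes>\<^sub>M lborel)" and B: "\<And>y z. \<bar>H y z\<bar> \<le> B"
  shows "integrable (lborel \<Otimes>\<^sub>M lborel) (\<lambda>(y, z). H y z * (f y * g z))"
proof -
  have [measurable]: "f \<in> borel_measurable borel" "g \<in> borel_measurable borel" using f g by auto
  have fg: "integrable (lborel \<Otimes>\<^sub>M lborel) (\<lambda>(y, z). f y * g z)"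
    using f g by (intro lborel_pair.Fubini_integrable) (auto simp: abs_mult)
  have "integrable (lborel \<Otimes>\<^sub>M lborel) (\<lambda>p. B * (case p of (y, z) \<Rightarrow> f y * g z))"
    using fg by (rule integrable_mult_right)
  then show ?thesis
  proof (rule Bochner_Integration.integrable_bound)
    show "(\<lambda>(y, z). H y z * (f y * g z)) \<in> borel_measurable (lborel \<Otimes>\<^sub>M lborel)"
      using H unfolding split_beta by measurable
    have "\<bar>H y z * (f y * g z)\<bar> \<le> \<bar>B * (f y * g z)\<bar>" for y z
      unfolding abs_mult[of "H y z"] abs_mult[of B]
      using B[of y z] by (intro mult_right_mono) auto
    then show "AE p in lborel \<Otimes>\<^sub>M lborel. norm (case p of (y, z) \<Rightarrow> H y z * (f y * g z))
        \<le> norm (B * (case p of (y, z) \<Rightarrow> f y * g z))"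
      by (intro AE_I2) (auto split: prod.split)
  qed
qed

text \<open>Fubini moves the Fejer kernel from the interaction kernel to \<open>u\<close>:
  convolving with \<open>sigma\<close> is convolving the Fejer mean of \<open>u\<close> with
  \<open>kernel_reg\<close>. Replacing the mean by \<open>u\<close> costs \<epsilon> times the
  \<open>L\<^sup>1\<close> norm of \<open>kernel_reg\<close> on the cell, at most
  \<open>L1_norm K + 4 * \<kappa> \<le> 5 * L1_norm K\<close>. Dropping the Fejer correction costs
  its mass \<open>2 * \<kappa> / P * (2 * P)\<close> times \<open>B\<close>.\<close>

lemma torus_conv_sigma_approx:
  fixes u K :: "real \<Rightarrow> real"
  assumes P: "P > 0" and M: "M > 0" and K: "integrable lborel K"
    and cont: "continuous_on UNIV u" and B: "\<And>x. \<bar>u x\<bar> \<le> B"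
    and S: "\<And>X. \<bar>1 / (2 * P) * torus_conv P (fejer P M) u X - u X\<bar> \<le> \<epsilon>"
  defines "\<kappa> \<equiv> (LINT y:{y. \<bar>y\<bar> \<ge> P}|lborel. \<bar>K y\<bar>)"
  shows "\<bar>torus_conv P (sigma K P M) u x - (LINT z:{-P..P}|lborel. K z * u (x - z))\<bar>
    \<le> 5 * L1_norm K * \<epsilon> + 4 * \<kappa> * B"
proof -
  define S' where "S' X = 1 / (2 * P) * torus_conv P (fejer P M) u X" for X
  define F2 where "F2 = fejer P (2 * M)"
  define kk where "kk z = indicator {-P..P} z *\<^sub>R (K z - 2 * \<kappa> / P * F2 z)" for z
  define uu where "uu y = indicator {-P..P} y *\<^sub>R u y" for y
  have [measurable]: "K \<in> borel_measurable borel" using K by simp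
  have [measurable]: "u \<in> borel_measurable borel" using cont by (rule borel_measurable_continuous_onI)
  have "B \<ge> 0" using B[of 0] by simp
  have "\<epsilon> \<ge> 0" using S[of 0] by simp
  have "\<kappa> \<ge> 0" unfolding \<kappa>_def set_lebesgue_integral_def by (intro Bochner_Integration.integral_nonneg) simp
  have "\<kappa> \<le> L1_norm K"
    unfolding \<kappa>_def set_lebesgue_integral_def L1_norm_def using K
    by (intro integral_mono integrable_mult_indicator integrable_abs) (auto simp: indicator_def)
  have contF: "continuous_on A F2" for A unfolding F2_def by (rule continuous_fejer)
  have F2: "set_integrable lborel {-P..P} F2"
    by (intro borel_integrable_atLeastAtMost' contF)
  have Kc: "set_integrable lborel {-P..P} K"
    unfolding set_integrable_def using K by (intro integrable_mult_indicator) auto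
  have kk: "integrable lborel kk"
    using set_integral_diff(1)[OF Kc set_integrable_mult_right[of "2 * \<kappa> / P", OF F2]]
    unfolding kk_def set_integrable_def by simp
  then have [measurable]: "kk \<in> borel_measurable borel" by simp
  have uu: "integrable lborel uu"
    using borel_integrable_atLeastAtMost'[of "-P" P u] cont continuous_on_subset
    unfolding uu_def set_integrable_def by blast
  have sig: "sigma K P M X = 1 / (2 * P) * (LINT z|lborel. fejer P M (X - z) * kk z)" for X
  proof -
    have "(LINT z|lborel. indicator {-P..P} z *\<^sub>R (fejer P M (X - z) * kernel_reg K P M z))
        = (LINT z|lborel. fejer P M (X - z) * kk z)"
    \<comment> \<open>At \<open>z = P\<close> the floor is 1 and \<open>periodize\<close> returns
      \<open>K (- P)\<close>. This single point is discarded.\<close>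
    proof (rule integral_discrete_difference[of "{P}"])
      fix z assume "z \<notin> {P}"
      show "indicator {-P..P} z *\<^sub>R (fejer P M (X - z) * kernel_reg K P M z) = fejer P M (X - z) * kk z"
      proof (cases "z \<in> {-P..P}")
        case True
        then have "\<lfloor>(z + P) / (2 * P)\<rfloor> = 0"
          using \<open>z \<notin> {P}\<close> P by (simp add: floor_eq_iff)
        then show ?thesis
          by (simp add: kernel_reg_def periodize_def kk_def F2_def \<kappa>_def[symmetric])
      qed (simp add: kk_def)
    qed auto
    then show ?thesis
      unfolding sigma_def torus_conv_def set_lebesgue_integral_def by simp
  qed
  \<comment> \<open>Any finite bound will do; it only justifies Fubini and does not enter the
    estimate.\<close>
  obtain FB where FB: "\<And>y z. \<bar>fejer P M (x - y - z)\<bar> \<le> FB"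
  proof -
    have "\<bar>fejer P M X\<bar> \<le> 1 / real M * (\<Sum>j<M. 1)\<^sup>2" for X
    proof -
      have "cmod (\<Sum>j<M. cis (real j * (pi * X / P))) \<le> (\<Sum>j<M. 1)"
        by (rule sum_norm_le) simp
      then show ?thesis
        unfolding fejer_eq_cmod by (simp add: divide_right_mono power_mono)
    qed
    then show thesis using that by blast
  qed
  have int: "integrable (lborel \<Otimes>\<^sub>M lborel) (\<lambda>(y, z). fejer P M (x - y - z) * (uu y * kk z))"
    by (rule integrable_mult_product[OF uu kk _ FB]) measurable
  have sw: "kk z * S' (x - z) = 1 / (2 * P) * (LINT y|lborel. fejer P M (x - y - z) * (uu y * kk z))" for z
  proof -
    have "(LINT y|lborel. fejer P M (x - y - z) * (uu y * kk z)) = (LINT y|lborel. kk z * (indicator {-P..P} y *\<^sub>R (fejer P M (x - z - y) * u y)))"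
      by (intro Bochner_Integration.integral_cong refl) (simp add: uu_def diff_diff_add add.commute)
    also have "\<dots> = kk z * torus_conv P (fejer P M) u (x - z)"
      unfolding torus_conv_def set_lebesgue_integral_def by (rule integral_mult_right_zero)
    finally show ?thesis by (simp add: S'_def)
  qed
  have "torus_conv P (sigma K P M) u x = (LINT y|lborel. 1 / (2 * P) * (LINT z|lborel. fejer P M (x - y - z) * (uu y * kk z)))"
    unfolding torus_conv_def set_lebesgue_integral_def sig
  proof (intro Bochner_Integration.integral_cong refl)
    fix y
    have "(LINT z|lborel. fejer P M (x - y - z) * (uu y * kk z)) = (LINT z|lborel. uu y * (fejer P M (x - y - z) * kk z))"
      by (simp only: ac_simps)
    then show "indicator {-P..P} y *\<^sub>R (1 / (2 * P) * (LINT z|lborel. fejer P M (x - y - z) * kk z) * u y)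
        = 1 / (2 * P) * (LINT z|lborel. fejer P M (x - y - z) * (uu y * kk z))"
      by (simp add: uu_def)
  qed
  also have "\<dots> = 1 / (2 * P) * (LINT y|lborel. LINT z|lborel. fejer P M (x - y - z) * (uu y * kk z))"
    by (rule integral_mult_right_zero)
  \<comment> \<open>With the order exchanged, the inner integral in \<open>y\<close> is the Fejer
    mean of \<open>u\<close> at \<open>x - z\<close>.\<close>
  also have "(LINT y|lborel. LINT z|lborel. fejer P M (x - y - z) * (uu y * kk z))
      = (LINT z|lborel. LINT y|lborel. fejer P M (x - y - z) * (uu y * kk z))"
    using lborel_pair.Fubini_integral[OF int] by simp
  also have "1 / (2 * P) * \<dots> = (LINT z|lborel. kk z * S' (x - z))"
    unfolding sw by (rule integral_mult_right_zero[symmetric])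
  finally have conv: "torus_conv P (sigma K P M) u x = (LINT z|lborel. kk z * S' (x - z))" .
  have S'_meas[measurable]: "S' \<in> borel_measurable borel"
    unfolding S'_def torus_conv_def set_lebesgue_integral_def by measurable
  have S': "\<bar>S' X - u X\<bar> \<le> \<epsilon>" for X using S unfolding S'_def .
  have S'B: "\<bar>S' X\<bar> \<le> B + \<epsilon>" for X using S'[of X] B[of X] by linarith
  have i1: "integrable lborel (\<lambda>z. kk z * S' (x - z))"
    by (rule integrable_mult_bounded[OF kk _ S'B]) measurable
  have i2: "integrable lborel (\<lambda>z. kk z * u (x - z))"
    by (rule integrable_mult_bounded[OF kk _ B]) measurable
  have c2: "continuous_on {-P..P} (\<lambda>z. u (x - z))"
    by (rule continuous_on_compose2[OF cont]) (auto intro!: continuous_intros)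
  have iF2: "set_integrable lborel {-P..P} (\<lambda>z. F2 z * u (x - z))"
    by (intro borel_integrable_atLeastAtMost' continuous_intros contF c2)
  have iF2B: "set_integrable lborel {-P..P} (\<lambda>z. F2 z * B)"
    by (intro borel_integrable_atLeastAtMost' continuous_intros contF)
  have iK: "set_integrable lborel {-P..P} (\<lambda>z. K z * u (x - z))"
    using integrable_mult_bounded[OF Kc[unfolded set_integrable_def], of "\<lambda>z. u (x - z)" B] B
    unfolding set_integrable_def by (simp add: mult.assoc)
  have I2: "(LINT z:{-P..P}|lborel. F2 z) = 2 * P"
    using integral_fejer_cell[of P "2 * M" "-1" 0] P M by (simp add: F2_def)
  have F2pos: "0 \<le> F2 z" for z unfolding F2_def by (rule fejer_nonneg)
  have kku: "(LINT z|lborel. kk z * u (x - z)) = (LINT z:{-P..P}|lborel. K z * u (x - z))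
      - 2 * \<kappa> / P * (LINT z:{-P..P}|lborel. F2 z * u (x - z))"
  proof -
    have "(LINT z|lborel. kk z * u (x - z)) = (LINT z:{-P..P}|lborel. K z * u (x - z) - 2 * \<kappa> / P * (F2 z * u (x - z)))"
      unfolding set_lebesgue_integral_def kk_def
      by (intro Bochner_Integration.integral_cong refl) (simp add: algebra_simps)
    also have "\<dots> = (LINT z:{-P..P}|lborel. K z * u (x - z)) - (LINT z:{-P..P}|lborel. 2 * \<kappa> / P * (F2 z * u (x - z)))"
      by (intro set_integral_diff iK set_integrable_mult_right iF2)
    finally show ?thesis by (simp only: set_integral_mult_right)
  qed
  have F2u: "\<bar>LINT z:{-P..P}|lborel. F2 z * u (x - z)\<bar> \<le> 2 * P * B"
  proof -
    have "\<bar>LINT z:{-P..P}|lborel. F2 z * u (x - z)\<bar> \<le> (LINT z:{-P..P}|lborel. \<bar>F2 z * u (x - z)\<bar>)"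
      using set_integral_norm_bound[OF iF2] by simp
    also have "\<dots> \<le> (LINT z:{-P..P}|lborel. F2 z * B)"
      using F2pos B by (intro set_integral_mono set_integrable_abs iF2 iF2B) (auto simp: abs_mult intro!: mult_left_mono)
    also have "\<dots> = 2 * P * B" using I2 by simp
    finally show ?thesis .
  qed
  have kkn: "(LINT z|lborel. \<bar>kk z\<bar>) \<le> 5 * L1_norm K"
  proof -
    have iF: "integrable lborel (\<lambda>z. indicator {-P..P} z *\<^sub>R F2 z)" using F2 unfolding set_integrable_def .
    have "(LINT z|lborel. \<bar>kk z\<bar>) \<le> (LINT z|lborel. \<bar>K z\<bar> + 2 * \<kappa> / P * (indicator {-P..P} z *\<^sub>R F2 z))"
    proof (rule integral_mono)
      fix z
      have "0 \<le> 2 * \<kappa> / P * F2 z"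
        using \<open>\<kappa> \<ge> 0\<close> P F2pos[of z] by simp
      then have "\<bar>K z - 2 * \<kappa> / P * F2 z\<bar> \<le> \<bar>K z\<bar> + 2 * \<kappa> / P * F2 z" by linarith
      then show "\<bar>kk z\<bar> \<le> \<bar>K z\<bar> + 2 * \<kappa> / P * (indicator {-P..P} z *\<^sub>R F2 z)"
        by (cases "z \<in> {-P..P}") (simp_all add: kk_def)
    qed (use K kk iF in auto)
    also have "\<dots> = L1_norm K + 2 * \<kappa> / P * (LINT z:{-P..P}|lborel. F2 z)"
      unfolding L1_norm_def set_lebesgue_integral_def using K iF
      by (subst Bochner_Integration.integral_add) auto
    also have "\<dots> = L1_norm K + 4 * \<kappa>" using I2 P by simp
    finally show ?thesis using \<open>\<kappa> \<le> L1_norm K\<close> by simp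
  qed
  have "\<bar>(LINT z|lborel. kk z * S' (x - z)) - (LINT z|lborel. kk z * u (x - z))\<bar>
      = \<bar>LINT z|lborel. kk z * S' (x - z) - kk z * u (x - z)\<bar>"
    by (subst Bochner_Integration.integral_diff[OF i1 i2]) simp
  also have "\<dots> \<le> (LINT z|lborel. \<bar>kk z * S' (x - z) - kk z * u (x - z)\<bar>)"
    by (rule integral_abs_bound)
  also have "\<dots> \<le> (LINT z|lborel. \<bar>kk z\<bar> * \<epsilon>)"
    using kk i1 i2 S'
    by (intro integral_mono integrable_abs Bochner_Integration.integrable_diff integrable_mult_left)
       (auto simp: right_diff_distrib[symmetric] abs_mult intro!: mult_left_mono)
  also have "\<dots> \<le> 5 * L1_norm K * \<epsilon>"
    using kkn \<open>\<epsilon> \<ge> 0\<close> by (simp add: mult_right_mono)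
  finally have a: "\<bar>(LINT z|lborel. kk z * S' (x - z)) - (LINT z|lborel. kk z * u (x - z))\<bar> \<le> 5 * L1_norm K * \<epsilon>" .
  have "\<bar>2 * \<kappa> / P * (LINT z:{-P..P}|lborel. F2 z * u (x - z))\<bar> \<le> 2 * \<kappa> / P * (2 * P * B)"
    unfolding abs_mult using F2u \<open>\<kappa> \<ge> 0\<close> P by (intro mult_mono) auto
  also have "\<dots> = 4 * \<kappa> * B" using P by simp
  finally show ?thesis using a kku unfolding conv by linarith
qed

section \<open>From the torus to the line\<close>

lemma log_modulus_nonneg: "0 \<le> r \<Longrightarrow> 0 \<le> log_modulus r"
  by (simp add: log_modulus_def)

lemma log_modulus_mono:
  assumes "0 \<le> r" "r \<le> s"
  shows "log_modulus r \<le> log_modulus s"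
proof (cases "r = 0")
  case True
  then show ?thesis using assms log_modulus_nonneg[of s] by (simp add: log_modulus_def)
next
  case False
  then have "0 < r" "0 < s" using assms by auto
  moreover have "ln (1 + 1 / s) \<le> ln (1 + 1 / r)"
    using \<open>0 < r\<close> \<open>0 < s\<close> assms by (intro ln_mono) (auto simp: frac_le add_pos_pos)
  moreover have "0 < ln (1 + 1 / s)" using \<open>0 < s\<close> by (intro ln_gt_zero) simp
  ultimately have "1 / ln (1 + 1 / r) \<le> 1 / ln (1 + 1 / s)" by (intro divide_left_mono) auto
  then show ?thesis using \<open>0 < r\<close> \<open>0 < s\<close> by (simp add: log_modulus_def)
qed

lemma log_modulus_small:
  assumes "0 < e"
  obtains d where "0 < d" "\<And>r. 0 \<le> r \<Longrightarrow> r \<le> d \<Longrightarrow> log_modulus r < e"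
\<comment> \<open>The radius solves \<open>1 / ln (1 / r) = e\<close>; the summand 1 inside the
  logarithm makes the inequality strict.\<close>
proof (rule that[of "1 / exp (1 / e)"])
  fix r :: real assume r: "0 \<le> r" "r \<le> 1 / exp (1 / e)"
  show "log_modulus r < e"
  proof (cases "r = 0")
    case False
    then have "0 < r" using r by simp
    then have "exp (1 / e) \<le> 1 / r" using r by (simp add: field_simps)
    then have "ln (exp (1 / e)) < ln (1 + 1 / r)"
      using \<open>0 < r\<close> by (subst ln_less_cancel_iff) (auto intro: add_pos_pos)
    then have "1 / e < ln (1 + 1 / r)" by simp
    then have "1 / ln (1 + 1 / r) < e"
      using \<open>0 < e\<close> less_trans[of 0 "1 / e" "ln (1 + 1 / r)"]
      by (simp add: pos_divide_less_eq mult.commute)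
    then show ?thesis using False by (simp add: log_modulus_def)
  qed (use assms in \<open>simp add: log_modulus_def\<close>)
qed simp

lemma frechet_derivative_support:
  assumes "closed C" "\<forall>z. f z \<noteq> 0 \<longrightarrow> z \<in> C" "frechet_derivative f (at z) e \<noteq> 0"
  shows "z \<in> C"
proof (rule ccontr)
  assume "z \<notin> C"
  have "((\<lambda>_. 0) has_derivative (\<lambda>_. 0)) (at z)" by simp
  then have "(f has_derivative (\<lambda>_. 0)) (at z)"
    by (rule has_derivative_transform_within_open[of _ _ _ _ "- C"])
      (use assms(1,2) \<open>z \<notin> C\<close> in auto)
  then have "frechet_derivative f (at z) = (\<lambda>_. 0)"
    using frechet_derivative_at by metis
  then show False using assms(3) by simp
qed

section \<open>Periodization of test functions on the line\<close>

lemma cell_reduction: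
  assumes "P > 0"
  shows "- P \<le> x - 2 * P * of_int \<lfloor>(x + P) / (2 * P)\<rfloor>" "x - 2 * P * of_int \<lfloor>(x + P) / (2 * P)\<rfloor> < P"
proof -
  define i where "i = \<lfloor>(x + P) / (2 * P)\<rfloor>"
  have "of_int i \<le> (x + P) / (2 * P)" "(x + P) / (2 * P) < of_int i + 1"
    unfolding i_def by linarith+
  then show "- P \<le> x - 2 * P * of_int \<lfloor>(x + P) / (2 * P)\<rfloor>" "x - 2 * P * of_int \<lfloor>(x + P) / (2 * P)\<rfloor> < P"
    unfolding i_def[symmetric] using assms by (auto simp: field_simps)
qed

text \<open>Periodization in the space variable alone. It turns a test function of the line with
  support in \<open>\<bar>x\<bar> \<le> R < P\<close> into one of the torus.\<close>

definition periodize_fst :: "real \<Rightarrow> (real \<times> real \<Rightarrow> real) \<Rightarrow> real \<times> real \<Rightarrow> real" where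
  "periodize_fst P \<phi> z = periodize P (\<lambda>x. \<phi> (x, snd z)) (fst z)"

text \<open>The floor inside \<open>periodize\<close> changes at the cell boundaries. Around cell
  \<open>j\<close> the shift may nevertheless be kept fixed on an interval that reaches
  \<open>P - R\<close> beyond the cell on both sides: where the true shift differs, both arguments
  lie outside \<open>[-R,R]\<close> and both sides vanish.\<close>

lemma periodize_fst_eq:
  assumes P: "P > 0" and supp: "\<forall>x t. \<phi> (x, t) \<noteq> 0 \<longrightarrow> \<bar>x\<bar> \<le> R" and "R < P"
    and x: "\<bar>x - 2 * P * of_int j\<bar> < 2 * P - R"
  shows "periodize_fst P \<phi> (x, t) = \<phi> (x - 2 * P * of_int j, t)"
proof -
  define i where "i = \<lfloor>(x + P) / (2 * P)\<rfloor>"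
  have i: "-P \<le> x - 2 * P * of_int i" "x - 2 * P * of_int i < P"
    using cell_reduction[OF P, of x] by (auto simp: i_def)
  have eq: "periodize_fst P \<phi> (x, t) = \<phi> (x - 2 * P * of_int i, t)"
    by (simp add: periodize_fst_def periodize_def i_def)
  show ?thesis
  proof (cases "i = j")
    case False
    define r where "r = x - 2 * P * of_int i"
    have split: "x - 2 * P * of_int j = r + 2 * P * of_int (i - j)"
      by (simp add: r_def algebra_simps)
    have ge: "2 * P \<le> \<bar>2 * P * of_int (i - j)\<bar>"
    proof -
      have "1 \<le> \<bar>of_int (i - j) :: real\<bar>" using False by linarith
      then show ?thesis using P by (simp add: abs_mult)
    qed
    have ri: "\<bar>r\<bar> \<le> P" using i by (auto simp: r_def)
    have "R < \<bar>r\<bar>" "R < \<bar>x - 2 * P * of_int j\<bar>"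
      using ge ri x \<open>R < P\<close> unfolding split by linarith+
    then have "\<phi> (r, t) = 0" "\<phi> (x - 2 * P * of_int j, t) = 0" using supp by fastforce+
    then show ?thesis using eq by (simp add: r_def)
  qed (use eq in simp)
qed

lemma periodize_fst_cell:
  assumes P: "P > 0" and supp: "\<forall>x t. \<phi> (x, t) \<noteq> 0 \<longrightarrow> \<bar>x\<bar> \<le> R" and "R < P" and "\<bar>x\<bar> \<le> P"
  shows "periodize_fst P \<phi> (x, t) = \<phi> (x, t)"
proof -
  have "\<bar>x - 2 * P * of_int 0\<bar> < 2 * P - R" using assms(3,4) by simp
  from periodize_fst_eq[where \<phi> = \<phi>, OF P supp \<open>R < P\<close> this] show ?thesis by simp
qed

lemma periodize_fst_periodic:
  "P > 0 \<Longrightarrow> periodize_fst P \<phi> (x + 2 * P, t) = periodize_fst P \<phi> (x, t)"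
proof -
  assume P: "P > 0"
  have "(x + 2 * P + P) / (2 * P) = (x + P) / (2 * P) + 1"
    using P by (simp add: field_simps)
  then have "\<lfloor>(x + 2 * P + P) / (2 * P)\<rfloor> = \<lfloor>(x + P) / (2 * P)\<rfloor> + 1" by simp
  then show ?thesis
    using P by (simp add: periodize_fst_def periodize_def algebra_simps)
qed

text \<open>With the shift frozen, the periodization is a translate of \<phi> on the open set
  \<open>S\<close>, which contains \<open>z\<close> even if \<open>z\<close> lies on the boundary of
  its cell.\<close>

lemma has_derivative_periodize_fst:
  assumes P: "P > 0" and sm: "smooth \<phi>" and supp: "\<forall>x t. \<phi> (x, t) \<noteq> 0 \<longrightarrow> \<bar>x\<bar> \<le> R" and "R < P"
  shows "(periodize_fst P \<phi> has_derivative
    (\<lambda>e. periodize_fst P (\<lambda>w. frechet_derivative \<phi> (at w) e) z)) (at z)"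
proof -
  obtain x t where z: "z = (x, t)" by (cases z)
  define j where "j = \<lfloor>(x + P) / (2 * P)\<rfloor>"
  have j: "-P \<le> x - 2 * P * of_int j" "x - 2 * P * of_int j < P"
    using cell_reduction[OF P, of x] by (auto simp: j_def)
  define S where "S = {z :: real \<times> real. \<bar>fst z - 2 * P * of_int j\<bar> < 2 * P - R}"
  have "open S"
    unfolding S_def by (intro open_Collect_less continuous_intros)
  moreover have "z \<in> S" using j \<open>R < P\<close> by (auto simp: S_def z)
  moreover have "((\<lambda>w. \<phi> (w - (2 * P * of_int j, 0))) has_derivative
      frechet_derivative \<phi> (at (z - (2 * P * of_int j, 0)))) (at z)"
  proof (rule has_derivative_compose[of "\<lambda>w. w - (2 * P * of_int j, 0)" "\<lambda>e. e"])
    show "((\<lambda>w. w - (2 * P * of_int j, 0)) has_derivative (\<lambda>e. e)) (at z)"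
      by (auto intro!: derivative_eq_intros)
  qed (rule smooth_has_derivative[OF sm])
  moreover have "\<phi> (w - (2 * P * of_int j, 0)) = periodize_fst P \<phi> w" if "w \<in> S" for w
  proof -
    obtain y s where w: "w = (y, s)" by (cases w)
    have "\<bar>y - 2 * P * of_int j\<bar> < 2 * P - R" using that by (simp add: S_def w)
    from periodize_fst_eq[where \<phi> = \<phi>, OF P supp \<open>R < P\<close> this, of s] show ?thesis by (simp add: w)
  qed
  ultimately have "(periodize_fst P \<phi> has_derivative
      frechet_derivative \<phi> (at (z - (2 * P * of_int j, 0)))) (at z)"
    using has_derivative_transform_within_open by blast
  moreover have "frechet_derivative \<phi> (at (z - (2 * P * of_int j, 0)))
      = (\<lambda>e. periodize_fst P (\<lambda>w. frechet_derivative \<phi> (at w) e) z)"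
    by (simp add: periodize_fst_def periodize_def z j_def)
  ultimately show ?thesis by simp
qed

text \<open>Differentiation commutes with the periodization and keeps the bound \<open>R\<close> on
  the support, so these periodizations form an invariant class.\<close>

lemma smooth_periodize_fst:
  assumes P: "P > 0" and sm: "smooth \<phi>" and supp: "\<forall>x t. \<phi> (x, t) \<noteq> 0 \<longrightarrow> \<bar>x\<bar> \<le> R" and "R < P"
  shows "smooth (periodize_fst P \<phi>)"
proof (rule smooth_coinduct_derivative[where
    X = "\<lambda>f. \<exists>\<phi>. smooth \<phi> \<and> (\<forall>x t. \<phi> (x, t) \<noteq> 0 \<longrightarrow> \<bar>x\<bar> \<le> R) \<and> f = periodize_fst P \<phi>"])
  show "\<exists>\<psi>. smooth \<psi> \<and> (\<forall>x t. \<psi> (x, t) \<noteq> 0 \<longrightarrow> \<bar>x\<bar> \<le> R) \<and> periodize_fst P \<phi> = periodize_fst P \<psi>"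
    using sm supp by blast
next
  fix f assume "\<exists>\<phi>. smooth \<phi> \<and> (\<forall>x t. \<phi> (x, t) \<noteq> 0 \<longrightarrow> \<bar>x\<bar> \<le> R) \<and> f = periodize_fst P \<phi>"
  then obtain \<phi> where \<phi>: "smooth \<phi>" "\<forall>x t. \<phi> (x, t) \<noteq> 0 \<longrightarrow> \<bar>x\<bar> \<le> R" "f = periodize_fst P \<phi>"
    by blast
  have cl: "closed {z :: real \<times> real. \<bar>fst z\<bar> \<le> R}"
    by (intro closed_Collect_le continuous_intros)
  have "\<bar>x\<bar> \<le> R" if "frechet_derivative \<phi> (at (x, t)) e \<noteq> 0" for x t e
  proof -
    have "(x, t) \<in> {z :: real \<times> real. \<bar>fst z\<bar> \<le> R}"
      using that \<phi>(2) by (intro frechet_derivative_support[OF cl, of \<phi>]) auto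
    then show ?thesis by simp
  qed
  then have "\<exists>\<psi>. smooth \<psi> \<and> (\<forall>x t. \<psi> (x, t) \<noteq> 0 \<longrightarrow> \<bar>x\<bar> \<le> R) \<and>
      (\<lambda>z. periodize_fst P (\<lambda>w. frechet_derivative \<phi> (at w) e) z) = periodize_fst P \<psi>" for e
    using smooth_deriv[OF \<phi>(1)] by blast
  moreover have "(f has_derivative (\<lambda>e. periodize_fst P (\<lambda>w. frechet_derivative \<phi> (at w) e) z)) (at z)" for z
    unfolding \<phi>(3) by (rule has_derivative_periodize_fst[OF P \<phi>(1,2) \<open>R < P\<close>])
  ultimately show "\<exists>f'. (\<forall>z. (f has_derivative f' z) (at z)) \<and>
      (\<forall>e. \<exists>\<phi>. smooth \<phi> \<and> (\<forall>x t. \<phi> (x, t) \<noteq> 0 \<longrightarrow> \<bar>x\<bar> \<le> R) \<and> (\<lambda>z. f' z e) = periodize_fst P \<phi>)"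
    by (intro exI[of _ "\<lambda>z e. periodize_fst P (\<lambda>w. frechet_derivative \<phi> (at w) e) z"] conjI allI)
qed

lemma test_function_time_support:
  fixes \<phi> :: "real \<times> real \<Rightarrow> real"
  assumes "\<phi> \<in> test_functions (UNIV \<times> {0<..<T})" "T > 0"
  obtains a b where "0 < a" "a < b" "b < T" "\<And>x t. \<phi> (x, t) \<noteq> 0 \<Longrightarrow> a \<le> t \<and> t \<le> b"
proof -
  obtain C where C: "compact C" "C \<subseteq> UNIV \<times> {0<..<T}" "\<And>z. \<phi> z \<noteq> 0 \<Longrightarrow> z \<in> C"
    using assms unfolding test_functions_def by blast
  have c: "compact (snd ` C)" using C(1) by (intro compact_continuous_image continuous_intros)
  show thesis
  proof (cases "C = {}")
    case True
    then have "\<phi> z = 0" for z using C(3) by blast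
    then show thesis using that[of "T / 3" "T / 2"] assms(2) by auto
  next
    case False
    obtain m where m: "m \<in> snd ` C" "\<And>t. t \<in> snd ` C \<Longrightarrow> m \<le> t"
      using compact_attains_inf[OF c] False by blast
    obtain n where n: "n \<in> snd ` C" "\<And>t. t \<in> snd ` C \<Longrightarrow> t \<le> n"
      using compact_attains_sup[OF c] False by blast
    have mn: "0 < m" "n < T" "m \<le> n" using m n C(2) by auto
    have "m \<le> t \<and> t \<le> n" if "\<phi> (x, t) \<noteq> 0" for x t
      using m(2)[of t] n(2)[of t] C(3)[OF that] by force
    \<comment> \<open>Moving the extreme times halfway towards 0 and \<open>T\<close> makes
      \<open>a < b\<close> strict even if the support lies in one time slice.\<close>
    then show thesis using that[of "m / 2" "(n + T) / 2"] mn by force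
  qed
qed

lemma periodize_fst_torus_test_function:
  assumes P: "P > 0" and "T > 0" and \<phi>: "\<phi> \<in> test_functions (UNIV \<times> {0<..<T})"
    and supp: "\<forall>x t. \<phi> (x, t) \<noteq> 0 \<longrightarrow> \<bar>x\<bar> \<le> R" and "R < P"
  shows "periodize_fst P \<phi> \<in> torus_test_functions P T"
    and "\<bar>x\<bar> \<le> P \<Longrightarrow> periodize_fst P \<phi> (x, t) = \<phi> (x, t)"
    and "\<bar>x\<bar> \<le> P \<Longrightarrow> frechet_derivative (periodize_fst P \<phi>) (at (x, t)) e = frechet_derivative \<phi> (at (x, t)) e"
proof -
  have sm: "smooth \<phi>" using \<phi> by (simp add: test_functions_def)
  obtain a b where ab: "0 < a" "a < b" "b < T" "\<And>x t. \<phi> (x, t) \<noteq> 0 \<Longrightarrow> a \<le> t \<and> t \<le> b"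
    using test_function_time_support[OF \<phi> \<open>T > 0\<close>] by metis
  have "\<forall>x t. periodize_fst P \<phi> (x, t) \<noteq> 0 \<longrightarrow> a \<le> t \<and> t \<le> b"
    using ab(4) by (auto simp: periodize_fst_def periodize_def)
  then show "periodize_fst P \<phi> \<in> torus_test_functions P T"
    unfolding torus_test_functions_def
    using smooth_periodize_fst[OF P sm supp \<open>R < P\<close>] periodize_fst_periodic[OF P] ab(1,3) by blast
  show "\<bar>x\<bar> \<le> P \<Longrightarrow> periodize_fst P \<phi> (x, t) = \<phi> (x, t)"
    by (rule periodize_fst_cell[where \<phi> = \<phi>, OF P supp \<open>R < P\<close>])
  have cl: "closed {z :: real \<times> real. \<bar>fst z\<bar> \<le> R}"
    by (intro closed_Collect_le continuous_intros)
  have dsupp: "\<forall>x t. frechet_derivative \<phi> (at (x, t)) e \<noteq> 0 \<longrightarrow> \<bar>x\<bar> \<le> R"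
  proof (intro allI impI)
    fix x t assume "frechet_derivative \<phi> (at (x, t)) e \<noteq> 0"
    then have "(x, t) \<in> {z :: real \<times> real. \<bar>fst z\<bar> \<le> R}"
      using supp by (intro frechet_derivative_support[OF cl, of \<phi>]) auto
    then show "\<bar>x\<bar> \<le> R" by simp
  qed
  assume x: "\<bar>x\<bar> \<le> P"
  have "frechet_derivative (periodize_fst P \<phi>) (at (x, t)) e
      = periodize_fst P (\<lambda>w. frechet_derivative \<phi> (at w) e) (x, t)"
    using frechet_derivative_at[OF has_derivative_periodize_fst[OF P sm supp \<open>R < P\<close>, of "(x, t)"]]
    by metis
  also have "\<dots> = frechet_derivative \<phi> (at (x, t)) e"
    by (rule periodize_fst_cell[where \<phi> = "\<lambda>w. frechet_derivative \<phi> (at w) e", OF P dsupp \<open>R < P\<close> x])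
  finally show "frechet_derivative (periodize_fst P \<phi>) (at (x, t)) e = frechet_derivative \<phi> (at (x, t)) e" .
qed

text \<open>The periodization of \<phi> is the test function used on the torus. On the cell it
  agrees with \<phi> together with its derivatives, and off the cell \<phi> vanishes, so both
  integrals may be read on the whole plane.\<close>

lemma distr_deriv_torus_imp_line:
  assumes P: "P > 0" and "T > 0"
    and d: "distr_deriv (torus_test_functions P T) ({-P..P} \<times> {0<..<T}) e u g"
    and \<phi>: "\<phi> \<in> test_functions (UNIV \<times> {0<..<T})"
    and supp: "\<forall>x t. \<phi> (x, t) \<noteq> 0 \<longrightarrow> \<bar>x\<bar> \<le> R" and "R < P"
  shows "integrable lborel (\<lambda>z. g z * \<phi> z)"
    and "(LINT z|lborel. u z * frechet_derivative \<phi> (at z) e) = - (LINT z|lborel. g z * \<phi> z)"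
proof -
  let ?D = "{-P..P} \<times> {0<..<T}"
  note per = periodize_fst_torus_test_function[OF P \<open>T > 0\<close> \<phi> supp \<open>R < P\<close>]
  obtain C where C: "compact C" "C \<subseteq> UNIV \<times> {0<..<T}" "\<And>z. \<phi> z \<noteq> 0 \<Longrightarrow> z \<in> C"
    using \<phi> unfolding test_functions_def by blast
  have cl: "closed (C \<inter> {z. \<bar>fst z\<bar> \<le> R})"
    using C(1) by (intro closed_Int compact_imp_closed closed_Collect_le continuous_intros)
  have s1: "\<forall>z. \<phi> z \<noteq> 0 \<longrightarrow> z \<in> C \<inter> {z. \<bar>fst z\<bar> \<le> R}"
    using C(3) supp by auto
  have inD: "C \<inter> {z. \<bar>fst z\<bar> \<le> R} \<subseteq> ?D"
    using C(2) \<open>R < P\<close> by force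
  have a: "indicator ?D z *\<^sub>R (g z * periodize_fst P \<phi> z) = g z * \<phi> z" for z
  proof (cases "z \<in> ?D")
    case True
    then show ?thesis using per(2)[of "fst z" "snd z"] by (auto simp: abs_le_iff)
  next
    case False
    then have "\<phi> z = 0" using s1 inD by blast
    then show ?thesis using False by simp
  qed
  have b: "indicator ?D z *\<^sub>R (u z * frechet_derivative (periodize_fst P \<phi>) (at z) e)
      = u z * frechet_derivative \<phi> (at z) e" for z
  proof (cases "z \<in> ?D")
    case True
    then show ?thesis
      using per(3)[where x = "fst z" and t = "snd z" and e = e] by (simp add: abs_le_iff mem_Times_iff)
  next
    case False
    then have "frechet_derivative \<phi> (at z) e = 0"
      using frechet_derivative_support[OF cl s1] inD by blast
    then show ?thesis using False by simp
  qed
  show "integrable lborel (\<lambda>z. g z * \<phi> z)"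
    "(LINT z|lborel. u z * frechet_derivative \<phi> (at z) e) = - (LINT z|lborel. g z * \<phi> z)"
    using d[unfolded distr_deriv_def, rule_format, OF per(1)]
    unfolding set_integrable_def set_lebesgue_integral_def a b by auto
qed

section \<open>Consequences for the associated solutions\<close>

lemma distr_deriv_cong:
  assumes "\<And>z. z \<in> D \<Longrightarrow> g z = g' z" "distr_deriv F D e f g"
  shows "distr_deriv F D e f g'"
proof -
  have eq: "indicator D z *\<^sub>R (g z * \<phi> z) = indicator D z *\<^sub>R (g' z * \<phi> z)" for z and \<phi> :: "'a \<Rightarrow> real"
    using assms(1)[of z] by (cases "z \<in> D") auto
  then show ?thesis
    using assms(2) unfolding distr_deriv_def set_integrable_def set_lebesgue_integral_def by (simp only: eq)
qed

text \<open>\<open>f\<close> is the slope on one cell, extended by zero; test functions with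
  \<open>R < P\<close> cannot see the extension. The scale \<open>max C 0 + 1\<close> is positive
  and strictly above the norm of the slope, which turns the norm bound into a modular bound.\<close>

lemma associated_solution_line:
  assumes "associated_solution T K v0 C P M u" and P: "P > 0" and T: "T > 0"
  obtains f where "f \<in> borel_measurable borel"
    "\<And>z. z \<notin> {-P..P} \<times> {0<..<T} \<Longrightarrow> f z = 0"
    "AE t in lborel. t \<in> {0<..<T} \<longrightarrow> (\<integral>\<^sup>+x. ennreal (\<Phi> (f (x, t) / (max C 0 + 1))) \<partial>lborel) \<le> 1"
    "\<And>\<phi> R. \<phi> \<in> test_functions (UNIV \<times> {0<..<T}) \<Longrightarrow> \<forall>x t. \<phi> (x, t) \<noteq> 0 \<longrightarrow> \<bar>x\<bar> \<le> R \<Longrightarrow> R < P \<Longrightarrow>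
       integrable lborel (\<lambda>z. f z * \<phi> z) \<and>
       (LINT z|lborel. u z * frechet_derivative \<phi> (at z) (1, 0)) = - (LINT z|lborel. f z * \<phi> z)"
    "\<And>\<phi> R. \<phi> \<in> test_functions (UNIV \<times> {0<..<T}) \<Longrightarrow> \<forall>x t. \<phi> (x, t) \<noteq> 0 \<longrightarrow> \<bar>x\<bar> \<le> R \<Longrightarrow> R < P \<Longrightarrow>
       integrable lborel (\<lambda>z. torus_conv P (sigma K P M) (\<lambda>y. u (y, snd z)) (fst z) * (f z + mean_slope v0 P) * \<phi> z) \<and>
       (LINT z|lborel. u z * frechet_derivative \<phi> (at z) (0, 1)) =
         - (LINT z|lborel. torus_conv P (sigma K P M) (\<lambda>y. u (y, snd z)) (fst z) * (f z + mean_slope v0 P) * \<phi> z)"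
proof -
  let ?D = "{-P..P} \<times> {0<..<T}"
  let ?L = "mean_slope v0 P"
  let ?c = "\<lambda>z. torus_conv P (sigma K P M) (\<lambda>y. u (y, snd z)) (fst z)"
  obtain ux ut where ux: "ux \<in> Linf_LlogL T {-P..P}"
    "distr_deriv (torus_test_functions P T) ?D (1, 0) u ux"
    "Linf_LlogL_norm T {-P..P} ux + Linf_LlogL_norm T {-P..P} ut \<le> ennreal C"
    "distr_deriv (torus_test_functions P T) ?D (0, 1) u
       (\<lambda>(x, t). torus_conv P (sigma K P M) (\<lambda>y. u (y, t)) x * (ux (x, t) + ?L))"
    using assms(1) unfolding associated_solution_def Let_def by blast
  define f where "f z = indicator ?D z * ux z" for z
  have f_meas: "f \<in> borel_measurable borel"
    using ux(1) unfolding f_def Linf_LlogL_def set_borel_measurable_def by simp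
  have f0: "f z = 0" if "z \<notin> ?D" for z using that by (simp add: f_def)
  have mod: "AE t in lborel. t \<in> {0<..<T} \<longrightarrow> (\<integral>\<^sup>+x. ennreal (\<Phi> (f (x, t) / (max C 0 + 1))) \<partial>lborel) \<le> 1"
  proof -
    have "AE t in restrict_space lborel {0<..<T}. LlogL_norm {-P..P} (\<lambda>x. ux (x, t)) \<le> Linf_LlogL_norm T {-P..P} ux"
      unfolding Linf_LlogL_norm_def by (rule esssup_AE)
    then have "AE t in lborel. t \<in> {0<..<T} \<longrightarrow> LlogL_norm {-P..P} (\<lambda>x. ux (x, t)) \<le> Linf_LlogL_norm T {-P..P} ux"
      by (subst (asm) AE_restrict_space_iff) auto
    then show ?thesis
    proof (rule AE_mp, intro AE_I2 impI)
      fix t assume t: "t \<in> {0<..<T} \<longrightarrow> LlogL_norm {-P..P} (\<lambda>x. ux (x, t)) \<le> Linf_LlogL_norm T {-P..P} ux"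
        "t \<in> {0<..<T}"
      have "LlogL_norm {-P..P} (\<lambda>x. ux (x, t)) \<le> Linf_LlogL_norm T {-P..P} ux" using t by blast
      also have "\<dots> \<le> ennreal C"
        by (rule order.trans[OF _ ux(3)]) (simp add: add_increasing2)
      also have "\<dots> < ennreal (max C 0 + 1)"
        by (cases "0 \<le> C") (auto simp: ennreal_less_iff ennreal_neg)
      finally have "(\<integral>\<^sup>+x\<in>{-P..P}. ennreal (\<Phi> (ux (x, t) / (max C 0 + 1))) \<partial>lborel) \<le> 1"
        by (rule LlogL_norm_less_imp_modular)
      moreover have "(\<integral>\<^sup>+x\<in>{-P..P}. ennreal (\<Phi> (ux (x, t) / (max C 0 + 1))) \<partial>lborel)
          = (\<integral>\<^sup>+x. ennreal (\<Phi> (f (x, t) / (max C 0 + 1))) \<partial>lborel)"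
        by (intro nn_integral_cong) (use t(2) in \<open>auto simp: f_def indicator_def \<Phi>_def\<close>)
      ultimately show "(\<integral>\<^sup>+x. ennreal (\<Phi> (f (x, t) / (max C 0 + 1))) \<partial>lborel) \<le> 1" by simp
    qed
  qed
  have fD: "ux z = f z" if "z \<in> ?D" for z using that by (simp add: f_def)
  have d1: "distr_deriv (torus_test_functions P T) ?D (1, 0) u f"
    by (rule distr_deriv_cong[OF fD ux(2)])
  have d2: "distr_deriv (torus_test_functions P T) ?D (0, 1) u (\<lambda>z. ?c z * (f z + ?L))"
    by (rule distr_deriv_cong[OF _ ux(4)]) (simp add: fD case_prod_beta)
  show thesis
  proof (rule that[OF f_meas f0 mod])
    fix \<phi> :: "real \<times> real \<Rightarrow> real" and R
    assume \<phi>: "\<phi> \<in> test_functions (UNIV \<times> {0<..<T})" "\<forall>x t. \<phi> (x, t) \<noteq> 0 \<longrightarrow> \<bar>x\<bar> \<le> R" "R < P"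
    show "integrable lborel (\<lambda>z. f z * \<phi> z) \<and>
       (LINT z|lborel. u z * frechet_derivative \<phi> (at z) (1, 0)) = - (LINT z|lborel. f z * \<phi> z)"
      using distr_deriv_torus_imp_line[OF P T d1 \<phi>] by blast
    show "integrable lborel (\<lambda>z. ?c z * (f z + ?L) * \<phi> z) \<and>
       (LINT z|lborel. u z * frechet_derivative \<phi> (at z) (0, 1)) = - (LINT z|lborel. ?c z * (f z + ?L) * \<phi> z)"
      using distr_deriv_torus_imp_line[OF P T d2 \<phi>] by blast
  qed
qed

text \<open>The given estimate starts at positive times and moves forward in both variables.
  Shifting time by \<epsilon> and letting \<epsilon> tend to 0 adds the initial time, by continuity
  of \<open>u\<close> there. A step in space followed by a step in time, each in either direction,
  then covers all pairs of points.\<close>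

lemma associated_solution_modulus:
  assumes "associated_solution T K v0 C P M u" and "s \<in> {0..<T}" "t \<in> {0..<T}"
  shows "\<bar>u (x, s) - u (y, t)\<bar> \<le> 6 * max C 0 * (log_modulus \<bar>x - y\<bar> + log_modulus \<bar>s - t\<bar>)"
proof -
  have cont: "continuous_on (UNIV \<times> {0..<T}) u"
    and mod: "\<And>\<gamma> h x t. 0 \<le> \<gamma> \<Longrightarrow> 0 \<le> h \<Longrightarrow> t \<in> {0<..<T - h} \<Longrightarrow>
       \<bar>u (x + \<gamma>, t + h) - u (x, t)\<bar> \<le> 6 * C * (log_modulus \<gamma> + log_modulus h)"
    using assms(1) unfolding associated_solution_def Let_def by blast+
  have lim: "((\<lambda>\<epsilon>. u (x, t + \<epsilon>)) \<longlongrightarrow> u (x, t)) (at_right 0)" if "t \<in> {0..<T}" for x t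
  proof -
    have "((\<lambda>\<epsilon>. (x, t + \<epsilon>)) \<longlongrightarrow> (x, t + 0)) (at_right 0)"
      by (intro tendsto_intros)
    moreover have "\<forall>\<^sub>F \<epsilon> in at_right 0. (x, t + \<epsilon>) \<in> UNIV \<times> {0..<T}"
    proof -
      have "\<forall>\<^sub>F \<epsilon> in at_right 0. \<epsilon> \<in> {0<..<T - t}"
        using that by (intro eventually_at_right_real) simp
      then show ?thesis by (rule eventually_mono) (use that in auto)
    qed
    ultimately show ?thesis
      using continuous_on_tendsto_compose[OF cont, of "\<lambda>\<epsilon>. (x, t + \<epsilon>)" "(x, t)"] that by simp
  qed
  have mod0: "\<bar>u (x + \<gamma>, t + h) - u (x, t)\<bar> \<le> 6 * max C 0 * (log_modulus \<gamma> + log_modulus h)"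
    if "0 \<le> \<gamma>" "0 \<le> h" "0 \<le> t" "t + h < T" for \<gamma> h x t
  proof (rule tendsto_upperbound)
    show "((\<lambda>\<epsilon>. \<bar>u (x + \<gamma>, t + h + \<epsilon>) - u (x, t + \<epsilon>)\<bar>) \<longlongrightarrow> \<bar>u (x + \<gamma>, t + h) - u (x, t)\<bar>) (at_right 0)"
      using that by (intro tendsto_intros lim) auto
    have "\<forall>\<^sub>F \<epsilon> in at_right 0. \<epsilon> \<in> {0<..<T - h - t}"
      using that by (intro eventually_at_right_real) simp
    then show "\<forall>\<^sub>F \<epsilon> in at_right 0. \<bar>u (x + \<gamma>, t + h + \<epsilon>) - u (x, t + \<epsilon>)\<bar>
        \<le> 6 * max C 0 * (log_modulus \<gamma> + log_modulus h)"
    proof (rule eventually_mono)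
      fix \<epsilon> assume "\<epsilon> \<in> {0<..<T - h - t}"
      then have "\<bar>u (x + \<gamma>, t + \<epsilon> + h) - u (x, t + \<epsilon>)\<bar> \<le> 6 * C * (log_modulus \<gamma> + log_modulus h)"
        using that by (intro mod) auto
      also have "\<dots> \<le> 6 * max C 0 * (log_modulus \<gamma> + log_modulus h)"
        using that by (intro mult_right_mono add_nonneg_nonneg log_modulus_nonneg) auto
      finally show "\<bar>u (x + \<gamma>, t + h + \<epsilon>) - u (x, t + \<epsilon>)\<bar>
        \<le> 6 * max C 0 * (log_modulus \<gamma> + log_modulus h)" by (simp add: ac_simps)
    qed
  qed simp
  have l0: "log_modulus 0 = 0" by (simp add: log_modulus_def)
  have space: "\<bar>u (x, t) - u (y, t)\<bar> \<le> 6 * max C 0 * log_modulus \<bar>x - y\<bar>" if "t \<in> {0..<T}" for x y t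
    using mod0[of "x - y" 0 t y] mod0[of "y - x" 0 t x] that l0
    by (cases "x \<le> y") (auto simp: abs_minus_commute)
  have time: "\<bar>u (x, s) - u (x, t)\<bar> \<le> 6 * max C 0 * log_modulus \<bar>s - t\<bar>" if "s \<in> {0..<T}" "t \<in> {0..<T}" for x s t
    using mod0[of 0 "s - t" t x] mod0[of 0 "t - s" s x] that l0
    by (cases "s \<le> t") (auto simp: abs_minus_commute)
  show ?thesis
    using space[OF assms(2), of x y] time[OF assms(2,3), of y] unfolding distrib_left by linarith
qed

text \<open>The exceptional null set contains no interval, so every \<open>x\<close> has points
  obeying the bound on both sides, and monotonicity transfers it to \<open>x\<close>.\<close>

lemma mono_essentially_bounded:
  fixes v :: "real \<Rightarrow> real"
  assumes "mono v" "Linf_norm UNIV v < \<infinity>"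
  obtains B where "0 \<le> B" "\<And>x. \<bar>v x\<bar> \<le> B"
proof -
  obtain B where B: "Linf_norm UNIV v = ennreal B" "0 \<le> B"
    using assms(2) by (cases "Linf_norm UNIV v") auto
  have "AE x in restrict_space lborel UNIV. ennreal \<bar>v x\<bar> \<le> Linf_norm UNIV v"
    unfolding Linf_norm_def by (rule esssup_AE)
  then have ae: "AE x in lborel. \<bar>v x\<bar> \<le> B"
    using B by (subst (asm) AE_restrict_space_iff) auto
  have ex: "\<exists>x\<in>{a<..<b}. \<bar>v x\<bar> \<le> B" if "a < b" for a b
  proof (rule ccontr)
    assume "\<not> (\<exists>x\<in>{a<..<b}. \<bar>v x\<bar> \<le> B)"
    then have "AE x in lborel. x \<notin> {a<..<b}" using ae by (auto elim: eventually_mono)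
    then have "emeasure lborel {a<..<b} = 0"
      by (subst (asm) AE_iff_measurable[of "{a<..<b}"]) auto
    then show False using that by simp
  qed
  have "\<bar>v x\<bar> \<le> B" for x
  proof -
    obtain y z where "y \<in> {x<..<x + 1}" "\<bar>v y\<bar> \<le> B" "z \<in> {x - 1<..<x}" "\<bar>v z\<bar> \<le> B"
      using ex[of x "x + 1"] ex[of "x - 1" x] by auto
    then show ?thesis
      using monoD[OF assms(1), of x y] monoD[OF assms(1), of z x] by auto
  qed
  then show thesis using that B(2) by blast
qed

lemma mean_slope_bound:
  assumes "\<And>x. \<bar>v0 x\<bar> \<le> B" "P > 0"
  shows "\<bar>mean_slope v0 P\<bar> \<le> B / P"
proof -
  have "\<bar>v0 P - v0 (- P)\<bar> \<le> 2 * B" using assms(1)[of P] assms(1)[of "- P"] by linarith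
  then show ?thesis using assms(2) by (simp add: mean_slope_def abs_div field_simps)
qed

text \<open>On the cell the subtracted linear part is at most \<open>B / P * P = B\<close>, so the
  bound does not depend on the period.\<close>

lemma u_init_bound:
  assumes "\<And>x. \<bar>v0 x\<bar> \<le> B" "P > 0"
  shows "\<bar>u_init v0 P x\<bar> \<le> 2 * B"
proof -
  define y where "y = x - 2 * P * of_int \<lfloor>(x + P) / (2 * P)\<rfloor>"
  have "\<bar>y\<bar> \<le> P"
    using cell_reduction[OF assms(2), of x] unfolding y_def by (simp add: abs_le_iff)
  then have "\<bar>mean_slope v0 P * y\<bar> \<le> B / P * P"
    unfolding abs_mult using mean_slope_bound[where ?v0.0 = v0, OF assms] assms(2) by (intro mult_mono) auto
  then have "\<bar>mean_slope v0 P * y\<bar> \<le> B" using assms(2) by simp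
  then show ?thesis
    using assms(1)[of y] unfolding u_init_def periodize_def y_def[symmetric] by linarith
qed

lemma u_init_cell: "\<bar>x\<bar> < P \<Longrightarrow> u_init v0 P x = v0 x - mean_slope v0 P * x"
proof -
  assume "\<bar>x\<bar> < P"
  then have "\<lfloor>(x + P) / (2 * P)\<rfloor> = 0" by (auto simp: floor_eq_iff field_simps)
  then show ?thesis by (simp add: u_init_def periodize_def)
qed

text \<open>The modulus in time over the whole interval is added to the bound of the datum. The
  result depends neither on \<open>P\<close> nor on \<open>M\<close>, as compactness in both indices
  requires.\<close>

lemma associated_solution_bound:
  assumes "associated_solution T K v0 C P M u" and P: "P > 0" and t: "t \<in> {0..<T}"
    and B: "\<And>x. \<bar>v0 x\<bar> \<le> B"
  shows "\<bar>u (x, t)\<bar> \<le> 2 * B + 6 * max C 0 * log_modulus T"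
proof -
  have "\<bar>u (x, t) - u (x, 0)\<bar> \<le> 6 * max C 0 * (log_modulus \<bar>x - x\<bar> + log_modulus \<bar>t - 0\<bar>)"
    using t by (intro associated_solution_modulus[OF assms(1)]) auto
  also have "\<dots> \<le> 6 * max C 0 * log_modulus T"
    using t log_modulus_mono[of t T] by (intro mult_left_mono) (auto simp: log_modulus_def)
  finally have "\<bar>u (x, t) - u (x, 0)\<bar> \<le> 6 * max C 0 * log_modulus T" .
  moreover have "u (x, 0) = u_init v0 P x"
    using assms(1) unfolding associated_solution_def Let_def by blast
  ultimately show ?thesis using u_init_bound[where ?v0.0 = v0, OF B P, of x] by linarith
qed

section \<open>Weak compactness under a modular bound\<close>

lemma integral_abs_diff_le:
  fixes f g :: "'a \<Rightarrow> real"
  assumes "integrable M f" "integrable M g" "integrable M h" "\<And>x. \<bar>f x - g x\<bar> \<le> h x"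
  shows "\<bar>(LINT x|M. f x) - (LINT x|M. g x)\<bar> \<le> (LINT x|M. h x)"
proof -
  have "\<bar>(LINT x|M. f x) - (LINT x|M. g x)\<bar> = \<bar>LINT x|M. f x - g x\<bar>"
    by (subst Bochner_Integration.integral_diff[OF assms(1,2)]) simp
  also have "\<dots> \<le> (LINT x|M. \<bar>f x - g x\<bar>)" by (rule integral_abs_bound)
  also have "\<dots> \<le> (LINT x|M. h x)"
    using assms by (intro integral_mono integrable_abs Bochner_Integration.integrable_diff) auto
  finally show ?thesis .
qed

text \<open>\<open>H\<close> is replaced by \<open>Hm\<close>, its rounding down to multiples of
  \<open>1 / m\<close>. As \<open>H\<close> is bounded, \<open>Hm\<close> takes finitely many
  values, and convergence on its level sets suffices. The error is at most \<open>1 / m\<close>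
  times the common \<open>L\<^sup>1\<close> bound \<open>D\<close>.\<close>

lemma weak_convergence_bounded_measurable:
  fixes f :: "nat \<Rightarrow> 'a \<Rightarrow> real"
  assumes f: "\<And>n. integrable M (f n)" and g: "integrable M g"
    and bnd: "\<And>n. (LINT x|M. \<bar>f n x\<bar>) \<le> C"
    and conv: "\<And>A. A \<in> sets M \<Longrightarrow> (\<lambda>n. LINT x:A|M. f n x) \<longlonglongrightarrow> (LINT x:A|M. g x)"
    and H[measurable]: "H \<in> borel_measurable M" and B: "\<And>x. \<bar>H x\<bar> \<le> B"
  shows "(\<lambda>n. LINT x|M. f n x * H x) \<longlonglongrightarrow> (LINT x|M. g x * H x)"
proof (rule LIMSEQ_I)
  fix e :: real assume "0 < e"
  define D where "D = max C (LINT x|M. \<bar>g x\<bar>)"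
  have "0 \<le> (LINT x|M. \<bar>g x\<bar>)" by (intro Bochner_Integration.integral_nonneg) simp
  then have D: "0 \<le> D" "C \<le> D" "(LINT x|M. \<bar>g x\<bar>) \<le> D" by (auto simp: D_def le_max_iff_disj)
  obtain m :: nat where m: "m > 0" "D / real m < e / 3"
  proof -
    obtain m :: nat where "3 * D / e < real m" using reals_Archimedean2 by blast
    moreover have "0 \<le> 3 * D / e" using D(1) \<open>0 < e\<close> by simp
    ultimately have m0: "0 < real m" and "3 * D < real m * e"
      using \<open>0 < e\<close> by (linarith, simp add: pos_divide_less_eq)
    then have "D < e / 3 * real m" by (simp add: mult.commute)
    then have "D / real m < e / 3" using m0 by (simp only: pos_divide_less_eq)
    then show thesis using that m0 by simp
  qed
  define Hm where "Hm x = of_int \<lfloor>real m * H x\<rfloor> / real m" for x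
  define N where "N = \<lceil>real m * B\<rceil> + 1"
  define A where "A j = {x \<in> space M. \<lfloor>real m * H x\<rfloor> = j}" for j
  have [measurable]: "A j \<in> sets M" for j unfolding A_def by measurable
  have [measurable]: "Hm \<in> borel_measurable M" unfolding Hm_def by measurable
  have Hdiff: "\<bar>H x - Hm x\<bar> \<le> 1 / real m" for x
  proof -
    have "\<bar>real m * H x - of_int \<lfloor>real m * H x\<rfloor>\<bar> \<le> 1" by linarith
    moreover have "H x - Hm x = (real m * H x - of_int \<lfloor>real m * H x\<rfloor>) / real m"
      using m(1) by (simp add: Hm_def field_simps)
    ultimately show ?thesis using m(1) by (simp add: abs_div divide_right_mono)
  qed
  have HmB: "\<bar>Hm x\<bar> \<le> B + 1 / real m" for x using Hdiff[of x] B[of x] by linarith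
  have rep: "f' x * Hm x = (\<Sum>j\<in>{-N..N}. (of_int j / real m) * (indicator (A j) x *\<^sub>R f' x))"
    if "x \<in> space M" for f' :: "'a \<Rightarrow> real" and x
  proof -
    define j where "j = \<lfloor>real m * H x\<rfloor>"
    have "\<bar>real m * H x\<bar> \<le> real m * B"
      using B[of x] by (simp add: abs_mult mult_left_mono)
    then have "j \<in> {-N..N}" unfolding j_def N_def by (auto, linarith+)
    have "(\<Sum>i\<in>{-N..N}. (of_int i / real m) * (indicator (A i) x *\<^sub>R f' x))
        = (\<Sum>i\<in>{-N..N}. if i = j then (of_int j / real m) * f' x else 0)"
      using that by (intro sum.cong refl) (auto simp: A_def j_def)
    also have "\<dots> = (of_int j / real m) * f' x"
      using \<open>j \<in> {-N..N}\<close> by (subst sum.delta) auto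
    finally show ?thesis by (simp add: Hm_def j_def)
  qed
  have ind: "integrable M (\<lambda>x. indicator (A j) x *\<^sub>R f' x)" if "integrable M f'" for j and f' :: "'a \<Rightarrow> real"
    using that by (intro integrable_mult_indicator) auto
  have int: "(LINT x|M. f' x * Hm x) = (\<Sum>j\<in>{-N..N}. (of_int j / real m) * (LINT x:A j|M. f' x))"
    if "integrable M f'" for f' :: "'a \<Rightarrow> real"
  proof -
    have "(LINT x|M. f' x * Hm x) = (LINT x|M. (\<Sum>j\<in>{-N..N}. (of_int j / real m) * (indicator (A j) x *\<^sub>R f' x)))"
      using rep by (intro Bochner_Integration.integral_cong) auto
    also have "\<dots> = (\<Sum>j\<in>{-N..N}. LINT x|M. (of_int j / real m) * (indicator (A j) x *\<^sub>R f' x))"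
      by (intro Bochner_Integration.integral_sum integrable_mult_right ind that)
    also have "\<dots> = (\<Sum>j\<in>{-N..N}. (of_int j / real m) * (LINT x:A j|M. f' x))"
      unfolding set_lebesgue_integral_def by (simp only: integral_mult_right_zero)
    finally show ?thesis .
  qed
  have limHm: "(\<lambda>n. LINT x|M. f n x * Hm x) \<longlonglongrightarrow> (LINT x|M. g x * Hm x)"
    unfolding int[OF f] int[OF g] by (intro tendsto_sum tendsto_mult tendsto_const conv) simp
  obtain n0 where n0: "\<And>n. n \<ge> n0 \<Longrightarrow> \<bar>(LINT x|M. f n x * Hm x) - (LINT x|M. g x * Hm x)\<bar> < e / 3"
    using LIMSEQ_D[OF limHm, of "e / 3"] \<open>0 < e\<close> unfolding real_norm_def by auto
  have close: "\<bar>(LINT x|M. f' x * H x) - (LINT x|M. f' x * Hm x)\<bar> < e / 3"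
    if f': "integrable M f'" "(LINT x|M. \<bar>f' x\<bar>) \<le> D" for f' :: "'a \<Rightarrow> real"
  proof -
    have "\<bar>(LINT x|M. f' x * H x) - (LINT x|M. f' x * Hm x)\<bar> \<le> (LINT x|M. \<bar>f' x\<bar> * (1 / real m))"
    proof (rule integral_abs_diff_le)
      show "integrable M (\<lambda>x. f' x * H x)" by (rule integrable_mult_bounded[OF f'(1) H B])
      show "integrable M (\<lambda>x. f' x * Hm x)" by (rule integrable_mult_bounded[OF f'(1) _ HmB]) measurable
      show "integrable M (\<lambda>x. \<bar>f' x\<bar> * (1 / real m))" using f'(1) by (intro integrable_mult_left integrable_abs)
      show "\<bar>f' x * H x - f' x * Hm x\<bar> \<le> \<bar>f' x\<bar> * (1 / real m)" for x
        unfolding right_diff_distrib[symmetric] abs_mult by (intro mult_left_mono Hdiff) simp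
    qed
    also have "\<dots> = (LINT x|M. \<bar>f' x\<bar>) / real m" by simp
    also have "\<dots> \<le> D / real m" using f'(2) by (intro divide_right_mono) auto
    finally show ?thesis using m(2) by linarith
  qed
  show "\<exists>n0. \<forall>n\<ge>n0. norm ((LINT x|M. f n x * H x) - (LINT x|M. g x * H x)) < e"
  proof (intro exI allI impI)
    fix n assume "n0 \<le> n"
    have "(LINT x|M. \<bar>f n x\<bar>) \<le> D" using bnd[of n] D(2) by simp
    from close[OF f this] close[OF g D(3)] n0[OF \<open>n0 \<le> n\<close>]
    show "norm ((LINT x|M. f n x * H x) - (LINT x|M. g x * H x)) < e"
      unfolding real_norm_def by linarith
  qed
qed

section \<open>Modular bounds on a time slab\<close>

lemma borel_measurable_fst_plane[measurable]: "(fst :: real \<times> real \<Rightarrow> real) \<in> borel_measurable borel"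
  by (intro borel_measurable_continuous_onI continuous_intros)

lemma borel_measurable_snd_plane[measurable]: "(snd :: real \<times> real \<Rightarrow> real) \<in> borel_measurable borel"
  by (intro borel_measurable_continuous_onI continuous_intros)

lemma nn_integral_plane:
  fixes k :: "real \<times> real \<Rightarrow> ennreal"
  assumes "k \<in> borel_measurable borel"
  shows "(\<integral>\<^sup>+z. k z \<partial>lborel) = (\<integral>\<^sup>+t. \<integral>\<^sup>+x. k (x, t) \<partial>lborel \<partial>lborel)"
proof -
  have "k \<in> borel_measurable (lborel \<Otimes>\<^sub>M lborel)" using assms by (simp add: lborel_prod)
  then show ?thesis by (subst lborel_pair.nn_integral_snd) (simp_all add: lborel_prod)
qed

text \<open>The bound by \<open>c\<close> in \<open>L\<^sup>\<infinity>(0,T; L log L)\<close>,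
  written with the modular. In this form it can be integrated over time and passed to a weak limit
  by convexity, which the infimum defining the norm does not allow directly.\<close>

definition modular_le_1 :: "real \<Rightarrow> real \<Rightarrow> (real \<times> real \<Rightarrow> real) \<Rightarrow> bool" where
  "modular_le_1 T c f \<longleftrightarrow> f \<in> borel_measurable borel \<and> (\<forall>x t. t \<notin> {0<..<T} \<longrightarrow> f (x, t) = 0) \<and>
     (AE t in lborel. t \<in> {0<..<T} \<longrightarrow> (\<integral>\<^sup>+x. ennreal (\<Phi> (f (x, t) / c)) \<partial>lborel) \<le> 1)"

lemma modular_le_1_measurable: "modular_le_1 T c f \<Longrightarrow> f \<in> borel_measurable borel"
  by (simp add: modular_le_1_def)

lemma modular_le_1_slab:
  assumes f: "modular_le_1 T c f" and J: "J \<in> sets borel" "J \<subseteq> {0<..<T}"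
  shows "(\<integral>\<^sup>+z. ennreal (\<Phi> (f z / c)) * indicator (UNIV \<times> J) z \<partial>lborel) \<le> emeasure lborel J"
proof -
  have [measurable]: "f \<in> borel_measurable borel" using f by (rule modular_le_1_measurable)
  have [measurable]: "UNIV \<times> J \<in> sets (borel :: (real \<times> real) measure)"
    using J(1) by (simp add: borel_prod[symmetric])
  have meas: "(\<lambda>x. ennreal (\<Phi> (f (x, t) / c))) \<in> borel_measurable lborel" for t
  proof -
    have "f \<in> borel_measurable (borel \<Otimes>\<^sub>M borel)" using \<open>f \<in> borel_measurable borel\<close> by (simp add: borel_prod)
    then show ?thesis by measurable
  qed
  have "(\<integral>\<^sup>+z. ennreal (\<Phi> (f z / c)) * indicator (UNIV \<times> J) z \<partial>lborel)
      = (\<integral>\<^sup>+t. \<integral>\<^sup>+x. ennreal (\<Phi> (f (x, t) / c)) * indicator (UNIV \<times> J) (x, t) \<partial>lborel \<partial>lborel)"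
    by (rule nn_integral_plane) measurable
  also have "\<dots> = (\<integral>\<^sup>+t. (\<integral>\<^sup>+x. ennreal (\<Phi> (f (x, t) / c)) \<partial>lborel) * indicator J t \<partial>lborel)"
    by (intro nn_integral_cong) (simp add: indicator_times nn_integral_multc[OF meas])
  also have "\<dots> \<le> (\<integral>\<^sup>+t. indicator J t \<partial>lborel)"
  proof (rule nn_integral_mono_AE)
    have "AE t in lborel. t \<in> {0<..<T} \<longrightarrow> (\<integral>\<^sup>+x. ennreal (\<Phi> (f (x, t) / c)) \<partial>lborel) \<le> 1"
      using f by (simp add: modular_le_1_def)
    then show "AE t in lborel. (\<integral>\<^sup>+x. ennreal (\<Phi> (f (x, t) / c)) \<partial>lborel) * indicator J t \<le> indicator J t"
      by (rule AE_mp) (use J(2) in \<open>auto simp: indicator_def intro!: AE_I2\<close>)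
  qed
  also have "\<dots> = emeasure lborel J" using J(1) by simp
  finally show ?thesis .
qed

lemma modular_le_1_integrable:
  assumes f: "modular_le_1 T c f" and "0 < c" "0 < T"
  shows "integrable lborel (\<lambda>z. \<Phi> (f z / c))" "(LINT z|lborel. \<Phi> (f z / c)) \<le> T"
    "integrable lborel f" "(LINT z|lborel. \<bar>f z\<bar>) \<le> c * T"
proof -
  have [measurable]: "f \<in> borel_measurable borel" using f by (rule modular_le_1_measurable)
  have "(\<integral>\<^sup>+z. ennreal (\<Phi> (f z / c)) \<partial>lborel) = (\<integral>\<^sup>+z. ennreal (\<Phi> (f z / c)) * indicator (UNIV \<times> {0<..<T}) z \<partial>lborel)"
  proof (rule nn_integral_cong)
    fix z :: "real \<times> real"
    have "f z = 0" if "z \<notin> UNIV \<times> {0<..<T}"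
      using f that unfolding modular_le_1_def by (cases z) auto
    then show "ennreal (\<Phi> (f z / c)) = ennreal (\<Phi> (f z / c)) * indicator (UNIV \<times> {0<..<T}) z"
      by (cases "z \<in> UNIV \<times> {0<..<T}") (simp_all add: \<Phi>_def)
  qed
  also have "\<dots> \<le> emeasure lborel {0<..<T}"
    by (rule modular_le_1_slab[OF f]) auto
  also have "\<dots> = ennreal T" using \<open>0 < T\<close> by simp
  finally have le: "(\<integral>\<^sup>+z. ennreal (\<Phi> (f z / c)) \<partial>lborel) \<le> ennreal T" .
  show I: "integrable lborel (\<lambda>z. \<Phi> (f z / c))"
    using le by (intro integrableI_bounded) (auto simp: \<Phi>_nonneg intro: le_less_trans)
  have "ennreal (LINT z|lborel. \<Phi> (f z / c)) \<le> ennreal T"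
    using le I by (subst nn_integral_eq_integral[symmetric]) (auto simp: \<Phi>_nonneg)
  then show L: "(LINT z|lborel. \<Phi> (f z / c)) \<le> T" using \<open>0 < T\<close> by simp
  have pt: "\<bar>f z\<bar> \<le> c * \<Phi> (f z / c)" for z
    using mult_left_mono[OF abs_le_\<Phi>[of "f z / c"], of c] \<open>0 < c\<close> by simp
  show fi: "integrable lborel f"
    by (rule Bochner_Integration.integrable_bound[OF integrable_mult_right[OF I, of c]])
      (use pt in \<open>auto intro!: AE_I2 order_trans[OF pt abs_ge_self]\<close>)
  have "(LINT z|lborel. \<bar>f z\<bar>) \<le> (LINT z|lborel. c * \<Phi> (f z / c))"
    using fi I pt by (intro integral_mono integrable_abs integrable_mult_right) auto
  also have "\<dots> \<le> c * T" using L \<open>0 < c\<close> by simp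
  finally show "(LINT z|lborel. \<bar>f z\<bar>) \<le> c * T" .
qed

lemma integrable_indicator_bounded:
  fixes k :: "'a \<Rightarrow> real"
  assumes [measurable]: "k \<in> borel_measurable M" "E \<in> sets M"
    and "emeasure M E < \<infinity>" and "\<And>x. x \<in> E \<Longrightarrow> \<bar>k x\<bar> \<le> B"
  shows "integrable M (\<lambda>x. indicator E x * k x)"
proof (rule Bochner_Integration.integrable_bound[of M "\<lambda>x. B * indicator E x"])
  show "integrable M (\<lambda>x. B * indicator E x :: real)" using assms(3) by simp
  have "norm (indicator E x * k x) \<le> norm (B * indicator E x)" for x
    using assms(4)[of x] by (cases "x \<in> E") auto
  then show "AE x in M. norm (indicator E x * k x) \<le> norm (B * indicator E x)" by simp
qed measurable

text \<open>Makes the slab, of infinite Lebesgue measure, a finite measure space. Its reciprocal is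
  bounded where \<open>\<bar>x\<bar> \<le> R\<close> inside the slab, so test functions of bounded
  support can absorb it.\<close>

definition slab_weight :: "real \<Rightarrow> real \<times> real \<Rightarrow> real" where
  "slab_weight T z = indicator {0<..<T} (snd z) * inverse (1 + (fst z)\<^sup>2)"

lemma measurable_slab_weight[measurable]: "slab_weight T \<in> borel_measurable borel"
  unfolding slab_weight_def by measurable

lemma slab_weight_bounds: "0 \<le> slab_weight T z" "slab_weight T z \<le> 1"
  by (auto simp: slab_weight_def indicator_def inverse_le_1_iff)

lemma finite_measure_slab_weight: "finite_measure (density lborel (\<lambda>z. ennreal (slab_weight T z)))"
proof (rule finite_measureI)
  have "integrable lborel (\<lambda>x::real. inverse (1 + x\<^sup>2))"
    using integrable_inverse_1_plus_square by (simp add: set_integrable_def)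
  then have fin: "nn_integral lborel (\<lambda>x::real. ennreal (inverse (1 + x\<^sup>2))) < \<infinity>"
    by (simp add: integrable_iff_bounded)
  have "emeasure (density lborel (\<lambda>z. ennreal (slab_weight T z))) UNIV = (\<integral>\<^sup>+z. ennreal (slab_weight T z) \<partial>lborel)"
    by (subst emeasure_density) auto
  also have "\<dots> = (\<integral>\<^sup>+t. \<integral>\<^sup>+x. ennreal (slab_weight T (x, t)) \<partial>lborel \<partial>lborel)"
    by (rule nn_integral_plane) measurable
  also have "\<dots> = (\<integral>\<^sup>+t. (\<integral>\<^sup>+x. ennreal (inverse (1 + x\<^sup>2)) \<partial>lborel) * indicator {0<..<T} t \<partial>lborel)"
    by (intro nn_integral_cong) (auto simp: slab_weight_def indicator_def)
  also have "\<dots> = nn_integral lborel (\<lambda>x::real. ennreal (inverse (1 + x\<^sup>2))) * emeasure lborel {0<..<T}"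
    by (subst nn_integral_cmult) auto
  also have "\<dots> < \<infinity>" using fin by (cases "0 \<le> T") (auto simp: ennreal_mult_less_top)
  finally show "emeasure (density lborel (\<lambda>z. ennreal (slab_weight T z))) (space (density lborel (\<lambda>z. ennreal (slab_weight T z)))) \<noteq> \<infinity>"
    by simp
qed

lemma density_slab_weight:
  fixes f :: "real \<times> real \<Rightarrow> real"
  assumes [measurable]: "f \<in> borel_measurable borel"
  shows "(LINT z|density lborel (\<lambda>z. ennreal (slab_weight T z)). f z) = (LINT z|lborel. slab_weight T z * f z)"
    and "integrable (density lborel (\<lambda>z. ennreal (slab_weight T z))) f \<longleftrightarrow> integrable lborel (\<lambda>z. slab_weight T z * f z)"
  using slab_weight_bounds(1) by (simp_all add: integral_density integrable_density)

text \<open>Superlinear growth of the modular gives the uniform integrability (de la Vallee Poussin).\<close>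

lemma modular_le_1_uniformly_integrable:
  assumes f: "\<And>n. modular_le_1 T c (f n)" and "0 < c" "0 < T"
  shows "uniformly_integrable (density lborel (\<lambda>z. ennreal (slab_weight T z))) f"
    and "(LINT z|density lborel (\<lambda>z. ennreal (slab_weight T z)). \<bar>f n z\<bar>) \<le> c * T"
proof -
  let ?M = "density lborel (\<lambda>z. ennreal (slab_weight T z))"
  have [measurable]: "f n \<in> borel_measurable borel" for n using f by (rule modular_le_1_measurable)
  interpret finite_measure ?M by (rule finite_measure_slab_weight)
  note I = modular_le_1_integrable[OF f \<open>0 < c\<close> \<open>0 < T\<close>]
  have intw: "integrable ?M k" "(LINT z|?M. k z) \<le> (LINT z|lborel. k z)"
    if "integrable lborel k" "\<And>z. 0 \<le> k z" for k :: "real \<times> real \<Rightarrow> real"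
  proof -
    have [measurable]: "k \<in> borel_measurable borel" using that(1) by simp
    have i: "integrable lborel (\<lambda>z. k z * slab_weight T z)"
      using slab_weight_bounds by (intro integrable_mult_bounded[OF that(1), of _ 1]) (auto simp: abs_le_iff intro: order_trans)
    then show "integrable ?M k" by (subst density_slab_weight(2)) (simp_all add: mult.commute)
    have "(LINT z|lborel. slab_weight T z * k z) \<le> (LINT z|lborel. k z)"
      using i that slab_weight_bounds by (intro integral_mono) (auto simp: mult.commute intro!: mult_left_le)
    then show "(LINT z|?M. k z) \<le> (LINT z|lborel. k z)" by (simp add: density_slab_weight)
  qed
  have fi: "integrable ?M (f n)" for n
    using intw(1)[OF integrable_abs[OF I(3)[of n]]] by (simp add: integrable_abs_iff)
  show "(LINT z|?M. \<bar>f n z\<bar>) \<le> c * T"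
    using intw(2)[OF integrable_abs[OF I(3)[of n]]] I(4)[of n] by simp
  show "uniformly_integrable ?M f"
    unfolding uniformly_integrable_def
  proof (intro conjI allI impI fi)
    fix e :: real assume "0 < e"
    \<comment> \<open>Above the level \<open>N\<close> the logarithm exceeds
      \<open>2 * c * T / e\<close>. There \<open>\<bar>f n\<bar>\<close> is at most
      \<open>c / l\<close> times the modular density, which integrates to at most
      \<open>c / l * T < e / 2\<close>.\<close>
    define N where "N = exp (2 * c * T / e + 1)"
    have N: "0 < N" "2 * c * T / e < ln (exp 1 + N)"
    proof -
      have "2 * c * T / e + 1 = ln N" by (simp add: N_def)
      also have "\<dots> \<le> ln (exp 1 + N)" by (rule ln_mono) (auto simp: N_def)
      finally show "2 * c * T / e < ln (exp 1 + N)" by simp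
    qed (simp add: N_def)
    have pos: "0 < 2 * c * T / e" using \<open>0 < c\<close> \<open>0 < T\<close> \<open>0 < e\<close> by simp
    define l where "l = ln (exp 1 + N)"
    have l0: "0 < l" using less_trans[OF pos N(2)] by (simp add: l_def)
    have "2 * c * T < l * e" using N(2) \<open>0 < e\<close> by (simp add: l_def pos_divide_less_eq)
    then have "c * T < e / 2 * l" by (simp add: mult.commute)
    then have "c * T / l < e / 2" using l0 by (simp only: pos_divide_less_eq)
    then have l: "0 < l" "c / l * T < e / 2" using l0 by simp_all
    have pt: "\<bar>f n z\<bar> \<le> N * c + c / l * \<Phi> (f n z / c)" for n z
    proof (cases "\<bar>f n z / c\<bar> \<le> N")
      case True
      then have "\<bar>f n z\<bar> \<le> N * c" using \<open>0 < c\<close> by (simp add: abs_div field_simps)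
      moreover have "0 \<le> c / l * \<Phi> (f n z / c)" using \<open>0 < c\<close> l(1) \<Phi>_nonneg by simp
      ultimately show ?thesis by linarith
    next
      case False
      have "l \<le> ln (exp 1 + \<bar>f n z / c\<bar>)"
        unfolding l_def using False N(1) by (intro ln_mono) (auto intro: add_pos_pos)
      then have "\<bar>f n z / c\<bar> * l \<le> \<Phi> (f n z / c)"
        unfolding \<Phi>_def by (intro mult_left_mono) auto
      then have "c / l * (\<bar>f n z / c\<bar> * l) \<le> c / l * \<Phi> (f n z / c)"
        using \<open>0 < c\<close> l(1) by (intro mult_left_mono) auto
      moreover have "c / l * (\<bar>f n z / c\<bar> * l) = \<bar>f n z\<bar>" using \<open>0 < c\<close> l(1) by (simp add: abs_div)
      ultimately show ?thesis using N(1) \<open>0 < c\<close> by (simp add: add_increasing)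
    qed
    \<comment> \<open>The part of \<open>\<bar>f n\<bar>\<close> up to \<open>N * c\<close>
      contributes less than \<open>\<delta> * (N * c) = e / 2\<close>.\<close>
    define \<delta> where "\<delta> = e / (2 * N * c)"
    show "\<exists>\<delta>>0. \<forall>n. \<forall>A\<in>sets ?M. measure ?M A < \<delta> \<longrightarrow> (LINT z:A|?M. \<bar>f n z\<bar>) < e"
    proof (intro exI[of _ \<delta>] conjI allI ballI impI)
      show "0 < \<delta>" using \<open>0 < e\<close> \<open>0 < c\<close> N(1) by (simp add: \<delta>_def)
      fix n A assume A: "A \<in> sets ?M" "measure ?M A < \<delta>"
      have \<Phi>i: "integrable ?M (\<lambda>z. \<Phi> (f n z / c))" "(LINT z|?M. \<Phi> (f n z / c)) \<le> T"
        using intw[OF I(1)[of n] \<Phi>_nonneg] I(2)[of n] by auto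
      have ind: "integrable ?M (\<lambda>z. indicator A z * (N * c))"
        using A(1) by (intro integrable_mult_left integrable_real_indicator) (auto simp: emeasure_eq_measure)
      have "(LINT z:A|?M. \<bar>f n z\<bar>) \<le> (LINT z|?M. indicator A z * (N * c) + c / l * \<Phi> (f n z / c))"
        unfolding set_lebesgue_integral_def
      proof (rule integral_mono)
        show "integrable ?M (\<lambda>z. indicator A z *\<^sub>R \<bar>f n z\<bar>)"
          using A(1) fi by (intro integrable_mult_indicator integrable_abs)
        show "integrable ?M (\<lambda>z. indicator A z * (N * c) + c / l * \<Phi> (f n z / c))"
          using ind \<Phi>i(1) by (intro Bochner_Integration.integrable_add integrable_mult_right)
        show "indicator A z *\<^sub>R \<bar>f n z\<bar> \<le> indicator A z * (N * c) + c / l * \<Phi> (f n z / c)" for z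
          using pt[of n z] \<Phi>_nonneg[of "f n z / c"] \<open>0 < c\<close> l(1) by (cases "z \<in> A") auto
      qed
      also have "\<dots> = measure ?M A * (N * c) + c / l * (LINT z|?M. \<Phi> (f n z / c))"
        using A(1) ind \<Phi>i(1) by (subst Bochner_Integration.integral_add) (auto intro!: integrable_mult_right)
      also have "\<dots> \<le> measure ?M A * (N * c) + c / l * T"
        using \<Phi>i(2) \<open>0 < c\<close> l(1) by (intro add_left_mono mult_left_mono) auto
      also have "\<dots> < \<delta> * (N * c) + e / 2"
        using A(2) N(1) \<open>0 < c\<close> l(2) by (intro add_strict_mono mult_strict_right_mono) auto
      also have "\<dots> = e" using N(1) \<open>0 < c\<close> by (simp add: \<delta>_def)
      finally show "(LINT z:A|?M. \<bar>f n z\<bar>) < e" .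
    qed
  qed
qed

text \<open>Lower semicontinuity: integrate the tangent inequality \<open>\<Phi>(f\<^sub>n/c) \<ge> \<Phi>(g/c) + \<Phi>'(g/c)(f\<^sub>n - g)/c\<close>
  over sets on which \<open>g\<close> is bounded, so that the linear term is an admissible test.\<close>

lemma modular_le_1_weak_limit:
  assumes f: "\<And>n. modular_le_1 T c (f n)" and "0 < c" "0 < T"
    and g[measurable]: "g \<in> borel_measurable borel" and g0: "\<And>x t. t \<notin> {0<..<T} \<Longrightarrow> g (x, t) = 0"
    and conv: "\<And>h B R. h \<in> borel_measurable borel \<Longrightarrow> (\<And>z. \<bar>h z\<bar> \<le> B) \<Longrightarrow>
      \<forall>x t. h (x, t) \<noteq> 0 \<longrightarrow> \<bar>x\<bar> \<le> R \<Longrightarrow>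
      (\<lambda>n. LINT z|lborel. f n z * h z) \<longlonglongrightarrow> (LINT z|lborel. g z * h z)"
  shows "modular_le_1 T c g"
proof -
  have [measurable]: "f n \<in> borel_measurable borel" for n using f by (rule modular_le_1_measurable)
  have slab: "(\<integral>\<^sup>+z. ennreal (\<Phi> (g z / c)) * indicator (UNIV \<times> J) z \<partial>lborel) \<le> emeasure lborel J"
    if J: "J \<in> sets borel" "J \<subseteq> {0<..<T}" for J
  proof -
    \<comment> \<open>Two cut-offs: \<open>\<bar>x\<bar> \<le> N\<close> gives the weak test bounded
      support, \<open>\<bar>g\<bar> \<le> N\<close> makes it bounded. The sets exhaust the slab over
      \<open>J\<close>.\<close>
    define E where "E N = {z. \<bar>fst z\<bar> \<le> real N \<and> \<bar>g z\<bar> \<le> real N \<and> snd z \<in> J}" for N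
    have [measurable]: "J \<in> sets borel" by fact
    have EJ[measurable]: "UNIV \<times> J \<in> sets (borel :: (real \<times> real) measure)"
      using J(1) by (simp add: borel_prod[symmetric])
    have E_eq: "E N = {z. \<bar>fst z\<bar> \<le> real N \<and> \<bar>g z\<bar> \<le> real N} \<inter> (UNIV \<times> J)" for N
      by (auto simp: E_def)
    have E[measurable]: "E N \<in> sets borel" for N
      unfolding E_eq by (intro sets.Int EJ) measurable
    have Efin: "emeasure lborel (E N) < \<infinity>" for N
    proof -
      have "emeasure lborel (E N) \<le> emeasure lborel (cbox (- real N, 0) (real N, T))"
      proof (rule emeasure_mono)
        show "E N \<subseteq> cbox (- real N, 0) (real N, T)"
          using J(2) by (force simp: E_def cbox_Pair_eq abs_le_iff)
      qed simp
      also have "\<dots> < \<infinity>" by (simp add: emeasure_lborel_cbox_eq)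
      finally show ?thesis .
    qed
    have Jm: "emeasure lborel J = ennreal (measure lborel J)"
    proof -
      have "emeasure lborel J \<le> emeasure lborel {0<..<T}" using J by (intro emeasure_mono) auto
      also have "\<dots> < \<infinity>" using \<open>0 < T\<close> by simp
      finally show ?thesis by (simp add: emeasure_eq_ennreal_measure)
    qed
    have part: "(\<integral>\<^sup>+z. ennreal (\<Phi> (g z / c)) * indicator (E N) z \<partial>lborel) \<le> emeasure lborel J" for N
    proof -
      \<comment> \<open>The coefficient of \<open>f n - g\<close> in the tangent inequality at
        \<open>g / c\<close>, restricted to \<open>E N\<close>.\<close>
      define h where "h z = indicator (E N) z * (\<Phi>' (g z / c) / c)" for z
      define B where "B = (ln (exp 1 + real N / c) + 1) / c"
      have gN: "\<bar>g z / c\<bar> \<le> real N / c" if "z \<in> E N" for z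
        using that \<open>0 < c\<close> by (auto simp: E_def abs_div divide_right_mono)
      have hB: "\<bar>h z\<bar> \<le> B" for z
      proof (cases "z \<in> E N")
        case True
        then show ?thesis
          using \<Phi>'_bound[OF gN[OF True]] \<open>0 < c\<close> by (simp add: h_def B_def abs_div divide_right_mono)
      next
        case False
        have "0 \<le> \<bar>\<Phi>' 0\<bar>" by simp
        also have "\<dots> \<le> ln (exp 1 + real N / c) + 1" using \<open>0 < c\<close> by (intro \<Phi>'_bound) simp
        finally show ?thesis using False \<open>0 < c\<close> by (simp add: h_def B_def)
      qed
      have [measurable]: "h \<in> borel_measurable borel" unfolding h_def by measurable
      have lim: "(\<lambda>n. LINT z|lborel. f n z * h z) \<longlonglongrightarrow> (LINT z|lborel. g z * h z)"
        by (rule conv[of h B "real N"]) (use hB in \<open>auto simp: h_def E_def indicator_def split: if_splits\<close>)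
      have i\<Phi>: "integrable lborel (\<lambda>z. indicator (E N) z * \<Phi> (g z / c))"
        by (rule integrable_indicator_bounded[where B = "\<Phi> (real N / c)"])
          (use Efin gN \<open>0 < c\<close> in \<open>auto simp: \<Phi>_nonneg intro!: \<Phi>_mono\<close>)
      have ig: "integrable lborel (\<lambda>z. g z * h z)"
      proof -
        have "integrable lborel (\<lambda>z. (indicator (E N) z * g z) * h z)"
          by (intro integrable_mult_bounded[OF _ _ hB] integrable_indicator_bounded[where B = "real N"])
            (use Efin in \<open>auto simp: E_def\<close>)
        then show ?thesis
          by (rule Bochner_Integration.integrable_cong[OF refl, THEN iffD1, rotated]) (auto simp: h_def indicator_def)
      qed
      have ifn: "integrable lborel (\<lambda>z. f n z * h z)" for n
        by (rule integrable_mult_bounded[OF modular_le_1_integrable(3)[OF f \<open>0 < c\<close> \<open>0 < T\<close>] _ hB]) simp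
      have le: "(LINT z|lborel. indicator (E N) z * \<Phi> (g z / c)) + ((LINT z|lborel. f n z * h z) - (LINT z|lborel. g z * h z))
          \<le> measure lborel J" for n
      proof -
        have isl: "integrable lborel (\<lambda>z. \<Phi> (f n z / c) * indicator (UNIV \<times> J) z)"
          by (rule integrable_mult_bounded[OF modular_le_1_integrable(1)[OF f \<open>0 < c\<close> \<open>0 < T\<close>], of _ 1])
            (auto simp: indicator_def)
        have "(LINT z|lborel. indicator (E N) z * \<Phi> (g z / c)) + ((LINT z|lborel. f n z * h z) - (LINT z|lborel. g z * h z))
            = (LINT z|lborel. indicator (E N) z * \<Phi> (g z / c) + (f n z * h z - g z * h z))"
          using i\<Phi> ig ifn by simp
        also have "\<dots> \<le> (LINT z|lborel. \<Phi> (f n z / c) * indicator (UNIV \<times> J) z)"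
        proof (rule integral_mono)
          show "integrable lborel (\<lambda>z. indicator (E N) z * \<Phi> (g z / c) + (f n z * h z - g z * h z))"
            using i\<Phi> ig ifn by simp
          fix z
          have "\<Phi> (g z / c) + \<Phi>' (g z / c) * (f n z / c - g z / c) \<le> \<Phi> (f n z / c)" by (rule \<Phi>_tangent)
          moreover have "\<Phi>' (g z / c) * (f n z / c - g z / c) = f n z * (\<Phi>' (g z / c) / c) - g z * (\<Phi>' (g z / c) / c)"
            by (simp add: diff_divide_distrib[symmetric] algebra_simps)
          ultimately show "indicator (E N) z * \<Phi> (g z / c) + (f n z * h z - g z * h z) \<le> \<Phi> (f n z / c) * indicator (UNIV \<times> J) z"
            by (cases "z \<in> E N") (auto simp: h_def E_def \<Phi>_nonneg mem_Times_iff)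
        qed (rule isl)
        also have "\<dots> \<le> measure lborel J"
        proof -
          have "ennreal (LINT z|lborel. \<Phi> (f n z / c) * indicator (UNIV \<times> J) z)
              = (\<integral>\<^sup>+z. ennreal (\<Phi> (f n z / c) * indicator (UNIV \<times> J) z) \<partial>lborel)"
            using isl by (intro nn_integral_eq_integral[symmetric]) (auto simp: \<Phi>_nonneg)
          also have "\<dots> = (\<integral>\<^sup>+z. ennreal (\<Phi> (f n z / c)) * indicator (UNIV \<times> J) z \<partial>lborel)"
            by (intro nn_integral_cong) (auto simp: indicator_def)
          also have "\<dots> \<le> ennreal (measure lborel J)"
            using modular_le_1_slab[OF f J] Jm by simp
          finally show ?thesis by simp
        qed
        finally show ?thesis .
      qed
      have "(\<lambda>n. (LINT z|lborel. indicator (E N) z * \<Phi> (g z / c)) + ((LINT z|lborel. f n z * h z) - (LINT z|lborel. g z * h z)))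
          \<longlonglongrightarrow> (LINT z|lborel. indicator (E N) z * \<Phi> (g z / c)) + ((LINT z|lborel. g z * h z) - (LINT z|lborel. g z * h z))"
        by (intro tendsto_add tendsto_diff tendsto_const lim)
      then have "(LINT z|lborel. indicator (E N) z * \<Phi> (g z / c)) + ((LINT z|lborel. g z * h z) - (LINT z|lborel. g z * h z)) \<le> measure lborel J"
        by (rule LIMSEQ_le_const2) (use le in blast)
      then have "(LINT z|lborel. indicator (E N) z * \<Phi> (g z / c)) \<le> measure lborel J" by simp
      moreover have "(\<integral>\<^sup>+z. ennreal (\<Phi> (g z / c)) * indicator (E N) z \<partial>lborel) = ennreal (LINT z|lborel. indicator (E N) z * \<Phi> (g z / c))"
      proof -
        have "(\<integral>\<^sup>+z. ennreal (\<Phi> (g z / c)) * indicator (E N) z \<partial>lborel) = (\<integral>\<^sup>+z. ennreal (indicator (E N) z * \<Phi> (g z / c)) \<partial>lborel)"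
          by (intro nn_integral_cong) (auto simp: indicator_def)
        also have "\<dots> = ennreal (LINT z|lborel. indicator (E N) z * \<Phi> (g z / c))"
          using i\<Phi> by (intro nn_integral_eq_integral) (auto simp: \<Phi>_nonneg)
        finally show ?thesis .
      qed
      ultimately show ?thesis using Jm by (simp add: ennreal_leI)
    qed
    have sup: "(SUP N. ennreal (\<Phi> (g z / c)) * indicator (E N) z) = ennreal (\<Phi> (g z / c)) * indicator (UNIV \<times> J) z" for z
    proof (cases "snd z \<in> J")
      case True
      obtain N :: nat where "max \<bar>fst z\<bar> \<bar>g z\<bar> \<le> real N" using real_arch_simple by blast
      then have "z \<in> E N" using True by (simp add: E_def)
      then have "ennreal (\<Phi> (g z / c)) \<le> (SUP N. ennreal (\<Phi> (g z / c)) * indicator (E N) z)"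
        by (intro SUP_upper2[of N]) auto
      moreover have "(SUP N. ennreal (\<Phi> (g z / c)) * indicator (E N) z) \<le> ennreal (\<Phi> (g z / c))"
        by (rule SUP_least) (auto simp: indicator_def)
      ultimately show ?thesis using True by (simp add: mem_Times_iff antisym)
    next
      case False
      then show ?thesis by (simp add: E_def mem_Times_iff)
    qed
    have "(\<integral>\<^sup>+z. ennreal (\<Phi> (g z / c)) * indicator (UNIV \<times> J) z \<partial>lborel) = (\<integral>\<^sup>+z. (SUP N. ennreal (\<Phi> (g z / c)) * indicator (E N) z) \<partial>lborel)"
      by (simp add: sup)
    also have "\<dots> = (SUP N. \<integral>\<^sup>+z. ennreal (\<Phi> (g z / c)) * indicator (E N) z \<partial>lborel)"
    proof (rule nn_integral_monotone_convergence_SUP)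
      show "incseq (\<lambda>N z. ennreal (\<Phi> (g z / c)) * indicator (E N) z)"
        by (auto simp: incseq_def le_fun_def E_def indicator_def)
    qed measurable
    also have "\<dots> \<le> emeasure lborel J" by (rule SUP_least) (rule part)
    finally show ?thesis .
  qed
  define G where "G t = (\<integral>\<^sup>+x. ennreal (\<Phi> (g (x, t) / c)) \<partial>lborel)" for t
  have g': "g \<in> borel_measurable (borel \<Otimes>\<^sub>M borel)" using g by (simp add: borel_prod)
  have [measurable]: "G \<in> borel_measurable borel"
  proof -
    have "(\<lambda>(t, x). ennreal (\<Phi> (g (x, t) / c))) \<in> borel_measurable (borel \<Otimes>\<^sub>M lborel)"
      using g' by measurable
    then show ?thesis unfolding G_def using lborel.borel_measurable_nn_integral by blast
  qed
  \<comment> \<open>Taking for \<open>J\<close> the set of times whose modular is at least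
    \<open>1 + 1 / (q + 1)\<close>, the slab bound says that \<open>1 + 1 / (q + 1)\<close> times
    the measure of \<open>J\<close> is at most that measure, so \<open>J\<close> is null.\<close>
  have null: "emeasure lborel {t \<in> {0<..<T}. ennreal (1 + 1 / real (Suc q)) \<le> G t} = 0" for q
  proof -
    define J where "J = {t \<in> {0<..<T}. ennreal (1 + 1 / real (Suc q)) \<le> G t}"
    have J: "J \<in> sets borel" "J \<subseteq> {0<..<T}" unfolding J_def by (auto, measurable)
    have mJ: "emeasure lborel J \<le> ennreal T"
      using emeasure_mono[of J "{0<..<T}" lborel] J \<open>0 < T\<close> by simp
    obtain m where m: "emeasure lborel J = ennreal m" "0 \<le> m"
      using mJ by (cases "emeasure lborel J") (auto simp: top_unique)
    have [measurable]: "UNIV \<times> J \<in> sets (borel :: (real \<times> real) measure)"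
      using J(1) by (simp add: borel_prod[symmetric])
    have meas: "(\<lambda>x. ennreal (\<Phi> (g (x, t) / c))) \<in> borel_measurable lborel" for t
      using g' by measurable
    have "ennreal (1 + 1 / real (Suc q)) * emeasure lborel J = (\<integral>\<^sup>+t. ennreal (1 + 1 / real (Suc q)) * indicator J t \<partial>lborel)"
      using J(1) by (simp add: nn_integral_cmult_indicator)
    also have "\<dots> \<le> (\<integral>\<^sup>+t. G t * indicator J t \<partial>lborel)"
      by (intro nn_integral_mono) (auto simp: indicator_def J_def)
    also have "\<dots> = (\<integral>\<^sup>+t. \<integral>\<^sup>+x. ennreal (\<Phi> (g (x, t) / c)) * indicator (UNIV \<times> J) (x, t) \<partial>lborel \<partial>lborel)"
      by (intro nn_integral_cong) (simp add: indicator_times nn_integral_multc[OF meas] G_def)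
    also have "\<dots> = (\<integral>\<^sup>+z. ennreal (\<Phi> (g z / c)) * indicator (UNIV \<times> J) z \<partial>lborel)"
      by (rule nn_integral_plane[symmetric]) measurable
    also have "\<dots> \<le> emeasure lborel J" by (rule slab[OF J])
    finally have "ennreal ((1 + 1 / real (Suc q)) * m) \<le> ennreal m"
      using m by (simp add: ennreal_mult)
    then have "(1 + 1 / real (Suc q)) * m \<le> m" using m(2) by (simp add: ennreal_le_iff)
    then have "m / real (Suc q) \<le> 0" by (simp add: field_simps)
    then have "m = 0" using m(2) by (simp add: divide_le_0_iff)
    then show ?thesis using m(1) by (simp add: J_def)
  qed
  have "AE t in lborel. \<forall>q. \<not> (t \<in> {0<..<T} \<and> ennreal (1 + 1 / real (Suc q)) \<le> G t)"
    unfolding AE_all_countable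
  proof
    fix q
    have "{t \<in> {0<..<T}. ennreal (1 + 1 / real (Suc q)) \<le> G t} \<in> null_sets lborel"
      using null[of q] by (intro null_setsI) auto
    then show "AE t in lborel. \<not> (t \<in> {0<..<T} \<and> ennreal (1 + 1 / real (Suc q)) \<le> G t)"
      by (rule AE_not_in[THEN eventually_mono]) auto
  qed
  then have "AE t in lborel. t \<in> {0<..<T} \<longrightarrow> G t \<le> 1"
  proof (rule eventually_mono, intro impI)
    fix t assume t: "\<forall>q. \<not> (t \<in> {0<..<T} \<and> ennreal (1 + 1 / real (Suc q)) \<le> G t)" "t \<in> {0<..<T}"
    have "(\<lambda>q. ennreal (1 + 1 / real (Suc q))) \<longlonglongrightarrow> ennreal (1 + 0)"
      by (intro tendsto_ennrealI tendsto_add tendsto_const LIMSEQ_Suc lim_1_over_n)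
    then show "G t \<le> 1"
      by (intro LIMSEQ_le_const[of _ "1 :: ennreal"]) (use t in \<open>auto simp: not_le less_imp_le\<close>)
  qed
  then show ?thesis
    unfolding modular_le_1_def G_def using g g0 by blast
qed

text \<open>Weak convergence is first obtained for the weighted measure. Testing there with
  \<open>H = h * (1 + x^2)\<close> cancels the weight, and \<open>H\<close> is bounded because
  \<open>h\<close> has bounded support in \<open>x\<close>.\<close>

lemma modular_le_1_weakly_compact:
  assumes f: "\<And>n. modular_le_1 T c (f n)" and "0 < c" "0 < T"
  obtains r :: "nat \<Rightarrow> nat" and g where "strict_mono r" "modular_le_1 T c g"
    "\<And>h B R. h \<in> borel_measurable borel \<Longrightarrow> (\<And>z. \<bar>h z\<bar> \<le> B) \<Longrightarrow>
      \<forall>x t. h (x, t) \<noteq> 0 \<longrightarrow> \<bar>x\<bar> \<le> R \<Longrightarrow>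
      (\<lambda>n. LINT z|lborel. f (r n) z * h z) \<longlonglongrightarrow> (LINT z|lborel. g z * h z)"
proof -
  let ?M = "density lborel (\<lambda>z. ennreal (slab_weight T z))"
  note ui = modular_le_1_uniformly_integrable[OF f \<open>0 < c\<close> \<open>0 < T\<close>]
  have setsM: "sets ?M = sets borel" by simp
  obtain r :: "nat \<Rightarrow> nat" and g0 where r: "strict_mono r" and g0: "integrable ?M g0"
    and conv0: "\<And>A. A \<in> sets ?M \<Longrightarrow> (\<lambda>n. LINT z:A|?M. f (r n) z) \<longlonglongrightarrow> (LINT z:A|?M. g0 z)"
    by (rule uniformly_integrable_weak_limit[OF finite_measure_slab_weight[of T] setsM ui]) (rule that)
  \<comment> \<open>The weighted measure does not see times outside (0,T), so the limit is fixed to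
    be 0 there by hand.\<close>
  define g where "g z = indicator {0<..<T} (snd z) * g0 z" for z
  have [measurable]: "g0 \<in> borel_measurable borel" using g0 by auto
  have [measurable]: "f n \<in> borel_measurable borel" for n using f by (rule modular_le_1_measurable)
  have [measurable]: "g \<in> borel_measurable borel" unfolding g_def by measurable
  have gz: "g (x, t) = 0" if "t \<notin> {0<..<T}" for x t using that by (simp add: g_def)
  have conv: "(\<lambda>n. LINT z|lborel. f (r n) z * h z) \<longlonglongrightarrow> (LINT z|lborel. g z * h z)"
    if h[measurable]: "h \<in> borel_measurable borel" and hB: "\<And>z. \<bar>h z\<bar> \<le> B"
      and hR: "\<forall>x t. h (x, t) \<noteq> 0 \<longrightarrow> \<bar>x\<bar> \<le> R" for h B R
  proof -
    define H where "H z = h z * (1 + (fst z)\<^sup>2)" for z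
    have [measurable]: "H \<in> borel_measurable borel" unfolding H_def by measurable
    have HB: "\<bar>H z\<bar> \<le> B * (1 + R\<^sup>2)" for z
    proof (cases "h z = 0")
      case True
      have "0 \<le> B" using hB[of z] by simp
      then show ?thesis using True by (simp add: H_def)
    next
      case False
      then have "\<bar>fst z\<bar> \<le> R" using hR by (cases z) auto
      then have "(fst z)\<^sup>2 \<le> R\<^sup>2" by (simp add: abs_le_square_iff[symmetric])
      then show ?thesis
        unfolding H_def abs_mult using hB[of z] by (intro mult_mono) auto
    qed
    have "(\<lambda>n. LINT z|?M. f (r n) z * H z) \<longlonglongrightarrow> (LINT z|?M. g0 z * H z)"
    proof (rule weak_convergence_bounded_measurable)
      show "integrable ?M (f (r n))" for n by (rule uniformly_integrable_integrable[OF ui(1)])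
      show "(LINT z|?M. \<bar>f (r n) z\<bar>) \<le> c * T" for n by (rule ui(2))
      show "H \<in> borel_measurable ?M" by simp
    qed (fact g0 conv0 HB)+
    moreover have "(LINT z|?M. f (r n) z * H z) = (LINT z|lborel. f (r n) z * h z)" for n
    proof -
      have pos: "1 + (fst z)\<^sup>2 \<noteq> 0" for z :: "real \<times> real"
        using zero_le_power2[of "fst z"] by linarith
      have eq: "slab_weight T z * (f (r n) z * H z) = f (r n) z * h z" for z
      proof (cases "snd z \<in> {0<..<T}")
        case True
        then show ?thesis using pos[of z] by (simp add: slab_weight_def H_def)
      next
        case False
        then have "f (r n) z = 0"
          using f[of "r n"] unfolding modular_le_1_def by (cases z) auto
        then show ?thesis by simp
      qed
      have "(LINT z|?M. f (r n) z * H z) = (LINT z|lborel. slab_weight T z * (f (r n) z * H z))"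
        by (rule density_slab_weight(1)) measurable
      then show ?thesis by (simp only: eq)
    qed
    moreover have "(LINT z|?M. g0 z * H z) = (LINT z|lborel. g z * h z)"
    proof -
      have pos: "1 + (fst z)\<^sup>2 \<noteq> 0" for z :: "real \<times> real"
        using zero_le_power2[of "fst z"] by linarith
      have eq: "slab_weight T z * (g0 z * H z) = g z * h z" for z
        using pos[of z] by (simp add: slab_weight_def H_def g_def)
      have "(LINT z|?M. g0 z * H z) = (LINT z|lborel. slab_weight T z * (g0 z * H z))"
        by (rule density_slab_weight(1)) measurable
      then show ?thesis by (simp only: eq)
    qed
    ultimately show ?thesis by simp
  qed
  have "modular_le_1 T c g"
    using f conv gz by (intro modular_le_1_weak_limit[of T c "\<lambda>n. f (r n)" g] \<open>0 < c\<close> \<open>0 < T\<close>) auto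
  then show thesis by (rule that[OF r]) (rule conv)
qed

section \<open>Passage to the limit in the equation\<close>

text \<open>Tolerances below are divided by \<open>a + 1\<close> because the nonnegative constant
  \<open>a\<close> may vanish.\<close>

lemma divide_mult_cancel_Suc:
  fixes a e k :: real
  assumes "0 \<le> a"
  shows "e / (k * (a + 1)) * (a + 1) = e / k" "(a + 1) * (e / (k * (a + 1))) = e / k"
proof -
  have "a + 1 \<noteq> 0" using assms by simp
  then show "e / (k * (a + 1)) * (a + 1) = e / k" by simp
  then show "(a + 1) * (e / (k * (a + 1))) = e / k" by (simp only: mult.commute)
qed

lemma compact_support_bounded:
  fixes g :: "'a::euclidean_space \<Rightarrow> real"
  assumes "continuous_on UNIV g" "compact C" "\<forall>z. g z \<noteq> 0 \<longrightarrow> z \<in> C"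
  obtains B where "0 \<le> B" "\<And>z. \<bar>g z\<bar> \<le> B"
proof -
  have "compact (g ` C)" using assms(1,2) continuous_on_subset by (blast intro: compact_continuous_image)
  then obtain B where "0 < B" "\<And>y. y \<in> g ` C \<Longrightarrow> norm y \<le> B"
    using compact_imp_bounded bounded_pos by metis
  then have "\<bar>g z\<bar> \<le> B" for z
    using assms(3) by (cases "g z = 0") auto
  then show thesis using that[of B] \<open>0 < B\<close> by simp
qed

lemma integral_uniform_limit_mult:
  fixes w :: "nat \<Rightarrow> 'a::euclidean_space \<Rightarrow> real"
  assumes C: "compact C" and w: "\<And>n. continuous_on C (w n)" and v: "continuous_on C v"
    and lim: "uniform_limit C w v sequentially"
    and g: "g \<in> borel_measurable borel" "\<And>z. \<bar>g z\<bar> \<le> B" "\<forall>z. g z \<noteq> 0 \<longrightarrow> z \<in> C"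
  shows "(\<lambda>n. LINT z|lborel. w n z * g z) \<longlonglongrightarrow> (LINT z|lborel. v z * g z)"
proof (rule LIMSEQ_I)
  fix e :: real assume "0 < e"
  have int: "integrable lborel (\<lambda>z. f z * g z)" if "continuous_on C f" for f :: "'a \<Rightarrow> real"
  proof -
    have "integrable lborel (\<lambda>z. (indicator C z *\<^sub>R f z) * g z)"
      using g by (intro integrable_mult_bounded[where B = B] borel_integrable_compact[OF C that]) auto
    moreover have eq: "(indicator C z *\<^sub>R f z) * g z = f z * g z" for z using g(3) by (cases "z \<in> C") auto
    ultimately show ?thesis by (simp only: eq)
  qed
  have "0 \<le> B" using g(2)[of undefined] by simp
  define Q where "Q = B * measure lborel C"
  have "0 \<le> Q" using \<open>0 \<le> B\<close> by (simp add: Q_def)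
  define \<eta> where "\<eta> = e / (2 * (Q + 1))"
  have "0 < \<eta>" using \<open>0 < e\<close> \<open>0 \<le> Q\<close> by (simp add: \<eta>_def)
  have iC: "integrable lborel (\<lambda>z. indicator C z :: real)"
    using borel_integrable_compact[OF C, of "\<lambda>_. 1::real"] by simp
  obtain n0 where n0: "\<And>n z. n \<ge> n0 \<Longrightarrow> z \<in> C \<Longrightarrow> \<bar>w n z - v z\<bar> < \<eta>"
    using lim \<open>0 < \<eta>\<close> unfolding uniform_limit_sequentially_iff dist_real_def by blast
  show "\<exists>n0. \<forall>n\<ge>n0. norm ((LINT z|lborel. w n z * g z) - (LINT z|lborel. v z * g z)) < e"
  proof (intro exI allI impI)
    fix n assume n: "n0 \<le> n"
    have "\<bar>(LINT z|lborel. w n z * g z) - (LINT z|lborel. v z * g z)\<bar> \<le> (LINT z|lborel. (\<eta> * B) * indicator C z)"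
    proof (rule integral_abs_diff_le)
      show "\<bar>w n z * g z - v z * g z\<bar> \<le> (\<eta> * B) * indicator C z" for z
      proof (cases "z \<in> C")
        case True
        have "\<bar>w n z - v z\<bar> * \<bar>g z\<bar> \<le> \<eta> * B"
          using n0[OF n True] g(2)[of z] \<open>0 < \<eta>\<close> by (intro mult_mono) auto
        then show ?thesis
          unfolding left_diff_distrib[symmetric] abs_mult using True by simp
      next
        case False
        then have "g z = 0" using g(3) by blast
        then show ?thesis using False by simp
      qed
    qed (use int[OF w] int[OF v] iC in auto)
    also have "\<dots> = \<eta> * Q" using iC by (simp add: Q_def)
    also have "\<dots> \<le> \<eta> * (Q + 1)" using \<open>0 < \<eta>\<close> by simp
    also have "\<dots> = e / 2" unfolding \<eta>_def by (rule divide_mult_cancel_Suc(1)[OF \<open>0 \<le> Q\<close>])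
    finally show "norm ((LINT z|lborel. w n z * g z) - (LINT z|lborel. v z * g z)) < e"
      using \<open>0 < e\<close> by simp
  qed
qed

lemma test_function_facts:
  fixes \<phi> :: "real \<times> real \<Rightarrow> real"
  assumes "\<phi> \<in> test_functions (UNIV \<times> {0<..<T})"
  obtains C B R where "compact C" "C \<subseteq> UNIV \<times> {0<..<T}" "0 \<le> B" "\<forall>x t. \<phi> (x, t) \<noteq> 0 \<longrightarrow> \<bar>x\<bar> \<le> R"
    "\<phi> \<in> borel_measurable borel" "\<And>z. \<bar>\<phi> z\<bar> \<le> B" "\<forall>z. \<phi> z \<noteq> 0 \<longrightarrow> z \<in> C"
    "\<And>e. (\<lambda>z. frechet_derivative \<phi> (at z) e) \<in> borel_measurable borel"
    "\<And>e. \<exists>B. \<forall>z. \<bar>frechet_derivative \<phi> (at z) e\<bar> \<le> B"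
    "\<And>e. \<forall>z. frechet_derivative \<phi> (at z) e \<noteq> 0 \<longrightarrow> z \<in> C"
proof -
  obtain C where sm: "smooth \<phi>" and C: "compact C" "C \<subseteq> UNIV \<times> {0<..<T}" "\<forall>z. \<phi> z \<noteq> 0 \<longrightarrow> z \<in> C"
    using assms unfolding test_functions_def by blast
  have dC: "\<forall>z. frechet_derivative \<phi> (at z) e \<noteq> 0 \<longrightarrow> z \<in> C" for e
    using frechet_derivative_support[OF compact_imp_closed[OF C(1)] C(3)] by blast
  have cont: "continuous_on UNIV \<phi>" "continuous_on UNIV (\<lambda>z. frechet_derivative \<phi> (at z) e)" for e
    by (rule smooth_continuous_on[OF sm], rule smooth_continuous_on[OF smooth_deriv[OF sm]])
  obtain B where B: "0 \<le> B" "\<And>z. \<bar>\<phi> z\<bar> \<le> B"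
    using compact_support_bounded[OF cont(1) C(1,3)] by blast
  have dB: "\<exists>B. \<forall>z. \<bar>frechet_derivative \<phi> (at z) e\<bar> \<le> B" for e
    using compact_support_bounded[OF cont(2) C(1) dC] by metis
  obtain R where R: "\<And>z. z \<in> C \<Longrightarrow> norm z \<le> R"
    using compact_imp_bounded[OF C(1)] bounded_iff by metis
  have "\<bar>x\<bar> \<le> R" if "\<phi> (x, t) \<noteq> 0" for x t
    using R[of "(x, t)"] C(3) that norm_fst_le[of x t] by fastforce
  then show thesis
    using that[OF C(1,2) B(1) _ borel_measurable_continuous_onI[OF cont(1)] B(2) C(3)
        borel_measurable_continuous_onI[OF cont(2)] dB dC] by blast
qed

text \<open>Strong times weak convergence. The fixed function \<open>k * \<phi>\<close> is the weak
  test for \<open>f\<close>, the error \<open>(c - k) * f * \<phi>\<close> is at most the supremum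
  of \<open>\<bar>c - k\<bar>\<close> on the support times the \<open>L\<^sup>1\<close> bound of
  \<open>f\<close>, and the term with \<open>L\<close> tends to 0. The equations are assumed only
  for large \<open>n\<close>, since the support of \<phi> has to fit into one period.\<close>

lemma limit_equation:
  fixes w f c :: "nat \<Rightarrow> real \<times> real \<Rightarrow> real" and v k :: "real \<times> real \<Rightarrow> real"
  assumes "0 < T" "0 < q" and f: "\<And>n. modular_le_1 T q (f n)"
    and w: "\<And>n. continuous_on (UNIV \<times> {0..<T}) (w n)" and v: "continuous_on (UNIV \<times> {0..<T}) v"
    and k: "continuous_on (UNIV \<times> {0..<T}) k"
    and wv: "\<And>A. A \<subseteq> UNIV \<times> {0..<T} \<Longrightarrow> bounded A \<Longrightarrow> uniform_limit A w v sequentially"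
    and ck: "\<And>A. A \<subseteq> UNIV \<times> {0..<T} \<Longrightarrow> bounded A \<Longrightarrow> uniform_limit A c k sequentially"
    and L: "L \<longlonglongrightarrow> 0"
    and dx: "\<And>\<phi>. \<phi> \<in> test_functions (UNIV \<times> {0<..<T}) \<Longrightarrow> \<forall>\<^sub>F n in sequentially.
       (LINT z|lborel. w n z * frechet_derivative \<phi> (at z) (1, 0)) = - (LINT z|lborel. f n z * \<phi> z)"
    and dt: "\<And>\<phi>. \<phi> \<in> test_functions (UNIV \<times> {0<..<T}) \<Longrightarrow> \<forall>\<^sub>F n in sequentially.
       integrable lborel (\<lambda>z. c n z * (f n z + L n) * \<phi> z) \<and>
       (LINT z|lborel. w n z * frechet_derivative \<phi> (at z) (0, 1)) = - (LINT z|lborel. c n z * (f n z + L n) * \<phi> z)"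
  obtains g where "modular_le_1 T q g"
    "\<And>\<phi>. \<phi> \<in> test_functions (UNIV \<times> {0<..<T}) \<Longrightarrow> integrable lborel (\<lambda>z. g z * \<phi> z) \<and>
       (LINT z|lborel. v z * frechet_derivative \<phi> (at z) (1, 0)) = - (LINT z|lborel. g z * \<phi> z)"
    "\<And>\<phi>. \<phi> \<in> test_functions (UNIV \<times> {0<..<T}) \<Longrightarrow> integrable lborel (\<lambda>z. k z * g z * \<phi> z) \<and>
       (LINT z|lborel. v z * frechet_derivative \<phi> (at z) (0, 1)) = - (LINT z|lborel. k z * g z * \<phi> z)"
proof -
  obtain r :: "nat \<Rightarrow> nat" and g where r: "strict_mono r" and g: "modular_le_1 T q g"
    and weak: "\<And>h B R. h \<in> borel_measurable borel \<Longrightarrow> (\<And>z. \<bar>h z\<bar> \<le> B) \<Longrightarrow>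
      \<forall>x t. h (x, t) \<noteq> 0 \<longrightarrow> \<bar>x\<bar> \<le> R \<Longrightarrow>
      (\<lambda>n. LINT z|lborel. f (r n) z * h z) \<longlonglongrightarrow> (LINT z|lborel. g z * h z)"
  proof (rule modular_le_1_weakly_compact[of T q f, OF f \<open>0 < q\<close> \<open>0 < T\<close>])
    fix r :: "nat \<Rightarrow> nat" and g
    assume a: "strict_mono r" "modular_le_1 T q g"
      and b: "\<And>h B R. h \<in> borel_measurable borel \<Longrightarrow> (\<And>z. \<bar>h z\<bar> \<le> B) \<Longrightarrow>
      \<forall>x t. h (x, t) \<noteq> 0 \<longrightarrow> \<bar>x\<bar> \<le> R \<Longrightarrow>
      (\<lambda>n. LINT z|lborel. f (r n) z * h z) \<longlonglongrightarrow> (LINT z|lborel. g z * h z)"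
    show thesis by (rule that[OF a]) (rule b)
  qed
  have gi: "integrable lborel g" by (rule modular_le_1_integrable(3)[OF g \<open>0 < q\<close> \<open>0 < T\<close>])
  have filr: "filterlim r sequentially sequentially" using r by (rule filterlim_subseq)
  have CT: "bounded C" "C \<subseteq> UNIV \<times> {0..<T}" if "compact C" "C \<subseteq> UNIV \<times> {0<..<T}" for C :: "(real \<times> real) set"
    using that by (auto simp: compact_imp_bounded)
  have wlim: "(\<lambda>n. LINT z|lborel. w (r n) z * frechet_derivative \<phi> (at z) e) \<longlonglongrightarrow>
      (LINT z|lborel. v z * frechet_derivative \<phi> (at z) e)" if \<phi>: "\<phi> \<in> test_functions (UNIV \<times> {0<..<T})" for \<phi> e
  proof -
    obtain C B R where C: "compact C" "C \<subseteq> UNIV \<times> {0<..<T}"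
      "(\<lambda>z. frechet_derivative \<phi> (at z) e) \<in> borel_measurable borel"
      "\<exists>B. \<forall>z. \<bar>frechet_derivative \<phi> (at z) e\<bar> \<le> B"
      "\<forall>z. frechet_derivative \<phi> (at z) e \<noteq> 0 \<longrightarrow> z \<in> C"
      using test_function_facts[OF \<phi>] by metis
    obtain B' where B': "\<And>z. \<bar>frechet_derivative \<phi> (at z) e\<bar> \<le> B'" using C(4) by blast
    have "(\<lambda>n. LINT z|lborel. w n z * frechet_derivative \<phi> (at z) e) \<longlonglongrightarrow>
      (LINT z|lborel. v z * frechet_derivative \<phi> (at z) e)"
    proof (rule integral_uniform_limit_mult[OF C(1)])
      show "continuous_on C (w n)" for n using w CT(2)[OF C(1,2)] continuous_on_subset by blast
      show "continuous_on C v" using v CT(2)[OF C(1,2)] continuous_on_subset by blast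
      show "uniform_limit C w v sequentially" by (rule wv[OF CT(2,1)[OF C(1,2)]])
    qed (fact C(3) B' C(5))+
    then show ?thesis using filr by (rule filterlim_compose)
  qed
  show thesis
  proof (rule that[OF g])
    fix \<phi> :: "real \<times> real \<Rightarrow> real" assume \<phi>: "\<phi> \<in> test_functions (UNIV \<times> {0<..<T})"
    obtain C B R where C: "compact C" "C \<subseteq> UNIV \<times> {0<..<T}" "0 \<le> B" "\<forall>x t. \<phi> (x, t) \<noteq> 0 \<longrightarrow> \<bar>x\<bar> \<le> R"
      "\<phi> \<in> borel_measurable borel" "\<And>z. \<bar>\<phi> z\<bar> \<le> B" "\<forall>z. \<phi> z \<noteq> 0 \<longrightarrow> z \<in> C"
      using test_function_facts[OF \<phi>] by metis
    note C' = CT[OF C(1,2)]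
    have "(\<lambda>n. - (LINT z|lborel. f (r n) z * \<phi> z)) \<longlonglongrightarrow> - (LINT z|lborel. g z * \<phi> z)"
      by (intro tendsto_minus weak[OF C(5,6,4)])
    moreover have "\<forall>\<^sub>F n in sequentially. - (LINT z|lborel. f (r n) z * \<phi> z)
        = (LINT z|lborel. w (r n) z * frechet_derivative \<phi> (at z) (1, 0))"
      using eventually_compose_filterlim[OF dx[OF \<phi>] filr] by (rule eventually_mono) simp
    ultimately have "(\<lambda>n. LINT z|lborel. w (r n) z * frechet_derivative \<phi> (at z) (1, 0)) \<longlonglongrightarrow> - (LINT z|lborel. g z * \<phi> z)"
      by (rule Lim_transform_eventually)
    then have "(LINT z|lborel. v z * frechet_derivative \<phi> (at z) (1, 0)) = - (LINT z|lborel. g z * \<phi> z)"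
      using wlim[OF \<phi>] LIMSEQ_unique by blast
    then show "integrable lborel (\<lambda>z. g z * \<phi> z) \<and>
       (LINT z|lborel. v z * frechet_derivative \<phi> (at z) (1, 0)) = - (LINT z|lborel. g z * \<phi> z)"
      using integrable_mult_bounded[OF gi, of \<phi> B] C(5,6) by simp
    have kC: "continuous_on C k" using k C'(2) continuous_on_subset by blast
    \<comment> \<open>\<open>k\<close> is controlled on the slab only. Cut off to the compact
      \<open>C\<close> it is Borel measurable and bounded.\<close>
    define kk where "kk z = indicator C z *\<^sub>R k z" for z
    have [measurable]: "kk \<in> borel_measurable borel"
      unfolding kk_def using borel_measurable_continuous_on_indicator[of C k] C(1) kC by (simp add: compact_imp_closed)
    have [measurable]: "\<phi> \<in> borel_measurable borel" by (rule C(5))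
    obtain K0 where K0: "0 < K0" "\<And>z. z \<in> C \<Longrightarrow> \<bar>k z\<bar> \<le> K0"
      using compact_imp_bounded[OF compact_continuous_image[OF kC C(1)]] unfolding bounded_pos by auto
    define h where "h z = kk z * \<phi> z" for z
    have [measurable]: "h \<in> borel_measurable borel" unfolding h_def by measurable
    have hk: "h z = k z * \<phi> z" for z using C(7)[rule_format, of z] by (cases "z \<in> C") (auto simp: h_def kk_def)
    have hB: "\<bar>h z\<bar> \<le> K0 * B" for z
    proof (cases "z \<in> C")
      case True
      then show ?thesis unfolding hk abs_mult using K0 C(6)[of z] by (intro mult_mono) auto
    next
      case False
      then show ?thesis using K0 C(3) by (simp add: h_def kk_def)
    qed
    have hlim: "(\<lambda>n. LINT z|lborel. f (r n) z * h z) \<longlonglongrightarrow> (LINT z|lborel. g z * h z)"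
      by (rule weak[of h "K0 * B" R]) (use hB C(4) in \<open>auto simp: hk\<close>)
    have iC: "integrable lborel (\<lambda>z. indicator C z :: real)"
      using borel_integrable_compact[OF C(1), of "\<lambda>_. 1::real"] by simp
    have err: "(\<lambda>n. (LINT z|lborel. c (r n) z * (f (r n) z + L (r n)) * \<phi> z) - (LINT z|lborel. f (r n) z * h z)) \<longlonglongrightarrow> 0"
    proof (rule LIMSEQ_I)
      fix e :: real assume "0 < e"
      define Q1 where "Q1 = B * (q * T)"
      define Q2 where "Q2 = (K0 + 1) * B * measure lborel C"
      have Q: "0 \<le> Q1" "0 \<le> Q2" using C(3) \<open>0 < q\<close> \<open>0 < T\<close> K0(1) by (auto simp: Q1_def Q2_def)
      \<comment> \<open>The bound by 1 gives \<open>\<bar>c\<bar> \<le> K0 + 1\<close> on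
        \<open>C\<close>; the other entry gives \<open>\<eta> * Q1 < e / 2\<close>.\<close>
      define \<eta> where "\<eta> = min 1 (e / (2 * (Q1 + 1)))"
      have \<eta>: "0 < \<eta>" "\<eta> \<le> 1" "\<eta> * Q1 < e / 2"
      proof -
        show "0 < \<eta>" "\<eta> \<le> 1" using \<open>0 < e\<close> Q(1) by (auto simp: \<eta>_def)
        have "\<eta> * Q1 < \<eta> * (Q1 + 1)" using \<open>0 < \<eta>\<close> by simp
        also have "\<dots> \<le> e / (2 * (Q1 + 1)) * (Q1 + 1)" using Q(1) by (intro mult_right_mono) (auto simp: \<eta>_def)
        also have "\<dots> = e / 2" by (rule divide_mult_cancel_Suc(1)[OF Q(1)])
        finally show "\<eta> * Q1 < e / 2" .
      qed
      have ev1: "\<forall>\<^sub>F n in sequentially. \<forall>z\<in>C. \<bar>c (r n) z - k z\<bar> < \<eta>"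
        using eventually_compose_filterlim[OF uniform_limitD[OF ck[OF C'(2,1)] \<eta>(1)] filr]
        by (simp add: dist_real_def)
      have "(\<lambda>n. \<bar>L (r n)\<bar> * Q2) \<longlonglongrightarrow> \<bar>0\<bar> * Q2"
        by (intro tendsto_intros filterlim_compose[OF L filr])
      then have ev2: "\<forall>\<^sub>F n in sequentially. \<bar>L (r n)\<bar> * Q2 < e / 2"
        using \<open>0 < e\<close> by (intro order_tendstoD(2)[of _ "\<bar>0\<bar> * Q2"]) auto
      have "\<forall>\<^sub>F n in sequentially. norm ((LINT z|lborel. c (r n) z * (f (r n) z + L (r n)) * \<phi> z) - (LINT z|lborel. f (r n) z * h z) - 0) < e"
        using ev1 ev2 eventually_compose_filterlim[OF dt[OF \<phi>] filr]
      proof eventually_elim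
        case (elim n)
        note fi = modular_le_1_integrable(3,4)[OF f[of "r n"] \<open>0 < q\<close> \<open>0 < T\<close>]
        have "\<bar>(LINT z|lborel. c (r n) z * (f (r n) z + L (r n)) * \<phi> z) - (LINT z|lborel. f (r n) z * h z)\<bar>
            \<le> (LINT z|lborel. \<eta> * B * \<bar>f (r n) z\<bar> + (K0 + 1) * \<bar>L (r n)\<bar> * B * indicator C z)"
        proof (rule integral_abs_diff_le)
          show "integrable lborel (\<lambda>z. c (r n) z * (f (r n) z + L (r n)) * \<phi> z)" using elim by blast
          show "integrable lborel (\<lambda>z. f (r n) z * h z)"
            by (rule integrable_mult_bounded[OF fi(1) _ hB]) simp
          show "integrable lborel (\<lambda>z. \<eta> * B * \<bar>f (r n) z\<bar> + (K0 + 1) * \<bar>L (r n)\<bar> * B * indicator C z)"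
            using fi(1) iC by (intro Bochner_Integration.integrable_add integrable_mult_right integrable_abs)
          fix z
          show "\<bar>c (r n) z * (f (r n) z + L (r n)) * \<phi> z - f (r n) z * h z\<bar>
              \<le> \<eta> * B * \<bar>f (r n) z\<bar> + (K0 + 1) * \<bar>L (r n)\<bar> * B * indicator C z"
          proof (cases "z \<in> C")
            case True
            have c1: "\<bar>c (r n) z - k z\<bar> \<le> \<eta>" using elim(1) True by (simp add: less_imp_le)
            have c2: "\<bar>c (r n) z\<bar> \<le> K0 + 1" using c1 K0(2)[OF True] \<eta>(2) by linarith
            have "c (r n) z * (f (r n) z + L (r n)) * \<phi> z - f (r n) z * h z
                = (c (r n) z - k z) * \<phi> z * f (r n) z + c (r n) z * L (r n) * \<phi> z"
              by (simp add: hk algebra_simps)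
            also have "\<bar>\<dots>\<bar> \<le> \<bar>(c (r n) z - k z) * \<phi> z * f (r n) z\<bar> + \<bar>c (r n) z * L (r n) * \<phi> z\<bar>"
              by (rule abs_triangle_ineq)
            also have "\<dots> \<le> \<eta> * B * \<bar>f (r n) z\<bar> + (K0 + 1) * \<bar>L (r n)\<bar> * B"
              unfolding abs_mult using c1 c2 C(3) C(6)[of z] \<eta>(1) K0(1)
              by (intro add_mono mult_mono mult_nonneg_nonneg) auto
            finally show ?thesis using True by simp
          next
            case False
            then have "\<phi> z = 0" using C(7) by blast
            then show ?thesis using False \<eta>(1) C(3) by (simp add: hk)
          qed
        qed
        also have "\<dots> = \<eta> * B * (LINT z|lborel. \<bar>f (r n) z\<bar>) + (K0 + 1) * \<bar>L (r n)\<bar> * B * measure lborel C"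
          using fi(1) iC by (subst Bochner_Integration.integral_add) auto
        also have "\<dots> \<le> \<eta> * B * (q * T) + (K0 + 1) * \<bar>L (r n)\<bar> * B * measure lborel C"
          using fi(2) \<eta>(1) C(3) by (intro add_right_mono mult_left_mono) auto
        also have "\<dots> = \<eta> * Q1 + \<bar>L (r n)\<bar> * Q2" by (simp add: Q1_def Q2_def)
        also have "\<dots> < e" using \<eta>(3) elim(2) by linarith
        finally show ?case by simp
      qed
      then show "\<exists>n0. \<forall>n\<ge>n0. norm ((LINT z|lborel. c (r n) z * (f (r n) z + L (r n)) * \<phi> z) - (LINT z|lborel. f (r n) z * h z) - 0) < e"
        by (simp add: eventually_sequentially)
    qed
    have "(\<lambda>n. - ((LINT z|lborel. c (r n) z * (f (r n) z + L (r n)) * \<phi> z) - (LINT z|lborel. f (r n) z * h z)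
        + (LINT z|lborel. f (r n) z * h z))) \<longlonglongrightarrow> - (0 + (LINT z|lborel. g z * h z))"
      by (intro tendsto_minus tendsto_add err hlim)
    moreover have "\<forall>\<^sub>F n in sequentially. - ((LINT z|lborel. c (r n) z * (f (r n) z + L (r n)) * \<phi> z) - (LINT z|lborel. f (r n) z * h z)
        + (LINT z|lborel. f (r n) z * h z)) = (LINT z|lborel. w (r n) z * frechet_derivative \<phi> (at z) (0, 1))"
      using eventually_compose_filterlim[OF dt[OF \<phi>] filr] by (rule eventually_mono) simp
    ultimately have "(\<lambda>n. LINT z|lborel. w (r n) z * frechet_derivative \<phi> (at z) (0, 1)) \<longlonglongrightarrow> - (0 + (LINT z|lborel. g z * h z))"
      by (rule Lim_transform_eventually)
    then have "(LINT z|lborel. v z * frechet_derivative \<phi> (at z) (0, 1)) = - (LINT z|lborel. g z * h z)"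
      using LIMSEQ_unique[OF wlim[OF \<phi>, of "(0, 1)"]] by simp
    moreover have "integrable lborel (\<lambda>z. g z * h z)"
      by (rule integrable_mult_bounded[OF gi _ hB]) simp
    moreover have "g z * h z = k z * g z * \<phi> z" for z by (simp add: hk)
    ultimately show "integrable lborel (\<lambda>z. k z * g z * \<phi> z) \<and>
       (LINT z|lborel. v z * frechet_derivative \<phi> (at z) (0, 1)) = - (LINT z|lborel. k z * g z * \<phi> z)"
      by simp
  qed
qed

section \<open>Lipschitz continuity in time with values in \<open>L\<^sup>1\<close>\<close>

lemma indicator_scaleR_support:
  fixes f :: "'a \<Rightarrow> real"
  assumes "f x \<noteq> 0 \<Longrightarrow> x \<in> A"
  shows "indicator A x *\<^sub>R f x = f x"
  using assms by (cases "f x = 0") auto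

lemma integral_product_plane:
  fixes f g :: "real \<Rightarrow> real"
  assumes f: "integrable lborel f" and g: "integrable lborel g"
  shows "integrable lborel (\<lambda>z. f (fst z) * g (snd z))"
    and "(LINT z|lborel. f (fst z) * g (snd z)) = (LINT x|lborel. f x) * (LINT t|lborel. g t)"
proof -
  have "integrable (lborel \<Otimes>\<^sub>M lborel) (\<lambda>(y, z). 1 * (f y * g z))"
    by (rule integrable_mult_product[OF f g, of "\<lambda>_ _. 1" 1]) auto
  then have i: "integrable (lborel \<Otimes>\<^sub>M lborel) (\<lambda>(y, z). f y * g z)" by simp
  have "integrable (lborel :: (real \<times> real) measure) (\<lambda>z. f (fst z) * g (snd z))"
    using i unfolding lborel_prod by (simp add: case_prod_unfold)
  then show "integrable lborel (\<lambda>z. f (fst z) * g (snd z))" .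
  have "(LINT x|lborel. LINT y|lborel. f x * g y) = (LINT z|(lborel \<Otimes>\<^sub>M lborel). (case z of (x, y) \<Rightarrow> f x * g y))"
    by (rule lborel_pair.integral_fst[OF i])
  then show "(LINT z|lborel. f (fst z) * g (snd z)) = (LINT x|lborel. f x) * (LINT t|lborel. g t)"
    unfolding lborel_prod by (simp add: case_prod_unfold)
qed

text \<open>Averaging against a mass-one \<rho> over \<open>[a, a + \<delta>]\<close> replaces
  \<open>v\<close> by its slice at \<open>a\<close> up to \<eta>. The average looks forward in time
  only, so that it never leaves \<open>[0,T)\<close> at the left end.\<close>

lemma mollified_time_slice:
  fixes v :: "real \<times> real \<Rightarrow> real" and \<psi> \<rho> :: "real \<Rightarrow> real"
  assumes v: "continuous_on (UNIV \<times> {0..<T}) v" and a: "0 \<le> a" "0 \<le> \<delta>" "a + \<delta> < T"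
    and near: "\<And>x r. r \<in> {a..a + \<delta>} \<Longrightarrow> \<bar>v (x, r) - v (x, a)\<bar> \<le> \<eta>" and "0 \<le> \<eta>"
    and \<psi>: "continuous_on UNIV \<psi>" "\<And>x. \<psi> x \<noteq> 0 \<Longrightarrow> \<bar>x\<bar> \<le> R"
    and \<rho>: "continuous_on UNIV \<rho>" "\<And>r. 0 \<le> \<rho> r" "\<And>r. \<rho> r \<noteq> 0 \<Longrightarrow> r \<in> {a..a + \<delta>}"
    and I: "(LINT r|lborel. \<rho> r) = 1"
  shows "integrable lborel (\<lambda>z. v z * (\<psi> (fst z) * \<rho> (snd z)))"
    and "\<bar>(LINT z|lborel. v z * (\<psi> (fst z) * \<rho> (snd z))) - (LINT x|lborel. v (x, a) * \<psi> x)\<bar>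
           \<le> \<eta> * (LINT x|lborel. \<bar>\<psi> x\<bar>)"
proof -
  let ?C = "{-R..R} \<times> {a..a + \<delta>}"
  have "compact ?C" by (intro compact_Times) auto
  moreover have "continuous_on ?C (\<lambda>z. v z * (\<psi> (fst z) * \<rho> (snd z)))"
  proof (intro continuous_on_mult)
    show "continuous_on ?C v" using v by (rule continuous_on_subset) (use a in auto)
    show "continuous_on ?C (\<lambda>z. \<psi> (fst z))"
      by (rule continuous_on_compose2[OF \<psi>(1)]) (auto intro!: continuous_intros)
    show "continuous_on ?C (\<lambda>z. \<rho> (snd z))"
      by (rule continuous_on_compose2[OF \<rho>(1)]) (auto intro!: continuous_intros)
  qed
  ultimately have "integrable lborel (\<lambda>z. indicator ?C z *\<^sub>R (v z * (\<psi> (fst z) * \<rho> (snd z))))"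
    by (rule borel_integrable_compact)
  moreover have eq: "indicator ?C z *\<^sub>R (v z * (\<psi> (fst z) * \<rho> (snd z))) = v z * (\<psi> (fst z) * \<rho> (snd z))" for z
  proof (rule indicator_scaleR_support)
    assume "v z * (\<psi> (fst z) * \<rho> (snd z)) \<noteq> 0"
    then have "\<bar>fst z\<bar> \<le> R" "snd z \<in> {a..a + \<delta>}" using \<psi>(2) \<rho>(3) by auto
    then show "z \<in> ?C" by (cases z) (auto simp: abs_le_iff)
  qed
  ultimately show i1: "integrable lborel (\<lambda>z. v z * (\<psi> (fst z) * \<rho> (snd z)))" by (simp only: eq)
  have icomp: "integrable lborel f" if "continuous_on {-b..b} f" "\<And>x. f x \<noteq> 0 \<Longrightarrow> \<bar>x\<bar> \<le> b" for f :: "real \<Rightarrow> real" and b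
  proof -
    have "integrable lborel (\<lambda>x. indicator {-b..b} x *\<^sub>R f x)"
      using borel_integrable_atLeastAtMost'[OF that(1)] by (simp add: set_integrable_def)
    moreover have eq: "indicator {-b..b} x *\<^sub>R f x = f x" for x
      by (rule indicator_scaleR_support) (use that(2)[of x] in auto)
    ultimately show ?thesis by (simp only: eq)
  qed
  have cva: "continuous_on UNIV (\<lambda>x. v (x, a))"
    by (rule continuous_on_compose2[OF v]) (use a in \<open>auto intro!: continuous_intros\<close>)
  have iv: "integrable lborel (\<lambda>x. v (x, a) * \<psi> x)"
    by (rule icomp[of R]) (use cva \<psi> in \<open>auto intro!: continuous_intros intro: continuous_on_subset\<close>)
  have i\<psi>: "integrable lborel \<psi>"
    by (rule icomp[of R]) (use \<psi> in \<open>auto intro: continuous_on_subset\<close>)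
  have i\<rho>: "integrable lborel \<rho>"
  proof (rule icomp[of "a + \<delta>"])
    show "continuous_on {- (a + \<delta>)..a + \<delta>} \<rho>" using \<rho>(1) continuous_on_subset by blast
    show "\<bar>x\<bar> \<le> a + \<delta>" if "\<rho> x \<noteq> 0" for x using \<rho>(3)[OF that] a by auto
  qed
  have slice: "(LINT x|lborel. v (x, a) * \<psi> x) = (LINT z|lborel. v (fst z, a) * \<psi> (fst z) * \<rho> (snd z))"
    using integral_product_plane(2)[OF iv i\<rho>] I by simp
  have "\<bar>(LINT z|lborel. v z * (\<psi> (fst z) * \<rho> (snd z))) - (LINT z|lborel. v (fst z, a) * \<psi> (fst z) * \<rho> (snd z))\<bar>
      \<le> (LINT z|lborel. \<eta> * (\<bar>\<psi> (fst z)\<bar> * \<rho> (snd z)))"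
  proof (rule integral_abs_diff_le[OF i1 integral_product_plane(1)[OF iv i\<rho>]])
    show "integrable lborel (\<lambda>z. \<eta> * (\<bar>\<psi> (fst z)\<bar> * \<rho> (snd z)))"
      by (intro integrable_mult_right integral_product_plane(1) integrable_abs i\<psi> i\<rho>)
    fix z :: "real \<times> real"
    have "\<bar>v z - v (fst z, a)\<bar> * (\<bar>\<psi> (fst z)\<bar> * \<rho> (snd z)) \<le> \<eta> * (\<bar>\<psi> (fst z)\<bar> * \<rho> (snd z))"
    proof (cases "\<rho> (snd z) = 0")
      case False
      then have "\<bar>v z - v (fst z, a)\<bar> \<le> \<eta>" using near[OF \<rho>(3), of "snd z" "fst z"] by simp
      then show ?thesis using \<rho>(2) by (intro mult_right_mono) auto
    qed simp
    moreover have "v z * (\<psi> (fst z) * \<rho> (snd z)) - v (fst z, a) * \<psi> (fst z) * \<rho> (snd z)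
        = (v z - v (fst z, a)) * (\<psi> (fst z) * \<rho> (snd z))" by (simp add: algebra_simps)
    ultimately show "\<bar>v z * (\<psi> (fst z) * \<rho> (snd z)) - v (fst z, a) * \<psi> (fst z) * \<rho> (snd z)\<bar>
        \<le> \<eta> * (\<bar>\<psi> (fst z)\<bar> * \<rho> (snd z))"
      using \<rho>(2)[of "snd z"] by (simp add: abs_mult)
  qed
  also have "\<dots> = \<eta> * (LINT x|lborel. \<bar>\<psi> x\<bar>)"
    using integral_product_plane(2)[OF integrable_abs[OF i\<psi>] i\<rho>] I by simp
  finally show "\<bar>(LINT z|lborel. v z * (\<psi> (fst z) * \<rho> (snd z))) - (LINT x|lborel. v (x, a) * \<psi> x)\<bar>
           \<le> \<eta> * (LINT x|lborel. \<bar>\<psi> x\<bar>)" unfolding slice .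
qed

text \<open>Test with \<open>\<psi>(x) \<tau>(r)\<close>, where \<open>\<tau>\<close> is a smoothed indicator of \<open>[s,t]\<close>: then \<open>\<tau>'\<close> is a
  difference of two mollifiers, concentrated near \<open>s\<close> and \<open>t\<close>.\<close>

lemma weak_time_increment:
  fixes v G :: "real \<times> real \<Rightarrow> real"
  assumes v: "continuous_on (UNIV \<times> {0..<T}) v"
    and mod: "\<And>e. 0 < e \<Longrightarrow> \<exists>d>0. \<forall>x. \<forall>s\<in>{0..<T}. \<forall>t\<in>{0..<T}. \<bar>s - t\<bar> \<le> d \<longrightarrow> \<bar>v (x, s) - v (x, t)\<bar> \<le> e"
    and G: "integrable lborel G" "0 \<le> Q"
      "\<And>a b. 0 < a \<Longrightarrow> a < b \<Longrightarrow> b < T \<Longrightarrow> (LINT z|lborel. \<bar>G z\<bar> * indicator {a..b} (snd z)) \<le> Q * (b - a)"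
    and eq: "\<And>\<phi>. \<phi> \<in> test_functions (UNIV \<times> {0<..<T}) \<Longrightarrow>
      (LINT z|lborel. v z * frechet_derivative \<phi> (at z) (0, 1)) = - (LINT z|lborel. G z * \<phi> z)"
    and \<psi>: "smooth \<psi>" "\<And>x. \<bar>\<psi> x\<bar> \<le> m" "\<And>x. \<psi> x \<noteq> 0 \<Longrightarrow> \<bar>x\<bar> \<le> R"
    and st: "0 < s" "s < t" "t < T"
  shows "\<bar>(LINT x|lborel. v (x, t) * \<psi> x) - (LINT x|lborel. v (x, s) * \<psi> x)\<bar> \<le> m * (Q * (t - s))"
proof (rule field_le_epsilon)
  fix e :: real assume "0 < e"
  have "0 \<le> m" using \<psi>(2)[of 0] by simp
  define I where "I = (LINT x|lborel. \<bar>\<psi> x\<bar>)"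
  have "0 \<le> I" unfolding I_def by (intro Bochner_Integration.integral_nonneg) simp
  \<comment> \<open>Mollification errors occur at both \<open>s\<close> and \<open>t\<close>. Each
    gets \<open>e / 4\<close>; the other half of \<open>e\<close> is left for the width of the
    ramps.\<close>
  define \<eta> where "\<eta> = e / (4 * (I + 1))"
  have \<eta>: "0 < \<eta>" "\<eta> * I \<le> e / 4"
  proof -
    show "0 < \<eta>" using \<open>0 < e\<close> \<open>0 \<le> I\<close> by (simp add: \<eta>_def)
    then have "\<eta> * I \<le> \<eta> * (I + 1)" by simp
    also have "\<dots> = e / 4" unfolding \<eta>_def by (rule divide_mult_cancel_Suc(1)[OF \<open>0 \<le> I\<close>])
    finally show "\<eta> * I \<le> e / 4" .
  qed
  obtain d where d: "0 < d" "\<And>x s t. s \<in> {0..<T} \<Longrightarrow> t \<in> {0..<T} \<Longrightarrow> \<bar>s - t\<bar> \<le> d \<Longrightarrow> \<bar>v (x, s) - v (x, t)\<bar> \<le> \<eta>"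
    using mod[OF \<eta>(1)] by blast
  \<comment> \<open>Three demands on the ramp width: the modulus of \<open>v\<close> at tolerance
    \<eta>, room before \<open>T\<close>, and a cost of at most \<open>e / 2\<close> for enlarging
    \<open>[s,t]\<close> to \<open>[s,t + \<delta>]\<close>.\<close>
  define \<delta> where "\<delta> = min (min d ((T - t) / 2)) (e / (2 * (m * Q + 1)))"
  have mQ: "0 \<le> m * Q" using \<open>0 \<le> m\<close> \<open>0 \<le> Q\<close> by simp
  have \<delta>: "0 < \<delta>" "\<delta> \<le> d" "t + \<delta> < T" "m * Q * \<delta> \<le> e / 2"
  proof -
    show "0 < \<delta>" using d(1) st(3) \<open>0 < e\<close> mQ by (simp add: \<delta>_def)
    show "\<delta> \<le> d" unfolding \<delta>_def by (rule order_trans[OF min.cobounded1 min.cobounded1])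
    have "\<delta> \<le> (T - t) / 2" unfolding \<delta>_def by (rule order_trans[OF min.cobounded1 min.cobounded2])
    then have "2 * \<delta> \<le> T - t" by simp
    then show "t + \<delta> < T" using st(3) by linarith
    have "m * Q * \<delta> \<le> (m * Q + 1) * \<delta>" using \<open>0 < \<delta>\<close> by (simp add: algebra_simps)
    also have "\<dots> \<le> (m * Q + 1) * (e / (2 * (m * Q + 1)))" using mQ by (intro mult_left_mono) (auto simp: \<delta>_def)
    also have "\<dots> = e / 2" by (rule divide_mult_cancel_Suc(2)[OF mQ])
    finally show "m * Q * \<delta> \<le> e / 2" .
  qed
  obtain S S' where S: "smooth S" "smooth S'" "\<And>x. (S has_real_derivative S' x) (at x)" "\<And>x. 0 \<le> S' x"
    "\<And>x. x \<le> 0 \<Longrightarrow> S x = 0" "\<And>x. 1 \<le> x \<Longrightarrow> S x = 1" "\<And>x. 0 \<le> S x" "\<And>x. S x \<le> 1"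
    using smooth_step_exists by metis
  \<comment> \<open>\<open>S\<close> attains its minimum 0 at every \<open>x \<le> 0\<close> and its
    maximum 1 at every \<open>x \<ge> 1\<close>, so the derivative vanishes there, end points
    included.\<close>
  have S'0: "S' x = 0" if "x \<le> 0 \<or> 1 \<le> x" for x
  proof (cases "x \<le> 0")
    case True
    then show ?thesis
      using DERIV_local_min[OF S(3), of 1 x] S(5)[OF True] S(7) by simp
  next
    case False
    then show ?thesis
      using DERIV_local_max[OF S(3), of 1 x] S(6)[of x] S(8) that by simp
  qed
  define \<sigma> where "\<sigma> a r = S ((r - a) / \<delta>)" for a r
  define \<rho> where "\<rho> a r = 1 / \<delta> * S' ((r - a) / \<delta>)" for a r
  have aff: "(r - a) / \<delta> = (1 / \<delta>) \<bullet> r + (- a / \<delta>)" for a r :: real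
    using \<delta>(1) by (simp add: inner_real_def field_simps)
  have \<sigma>_smooth: "smooth (\<sigma> a)" for a
    unfolding \<sigma>_def aff by (rule smooth_affine[OF S(1)])
  have \<rho>_smooth: "smooth (\<rho> a)" for a
    unfolding \<rho>_def aff by (intro smooth_mult smooth_const smooth_affine[OF S(2)])
  have \<sigma>_deriv: "(\<sigma> a has_real_derivative \<rho> a r) (at r)" for a r
  proof -
    have "((\<lambda>r. (r - a) / \<delta>) has_real_derivative 1 / \<delta>) (at r)"
      using \<delta>(1) by (auto intro!: derivative_eq_intros)
    from DERIV_chain2[OF S(3) this] show ?thesis
      unfolding \<sigma>_def \<rho>_def by (simp add: mult.commute)
  qed
  have \<rho>_nonneg: "0 \<le> \<rho> a r" for a r using S(4) \<delta>(1) by (simp add: \<rho>_def)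
  have \<rho>_supp: "r \<in> {a..a + \<delta>}" if "\<rho> a r \<noteq> 0" for a r
  proof -
    have "\<not> ((r - a) / \<delta> \<le> 0 \<or> 1 \<le> (r - a) / \<delta>)" using S'0 that by (auto simp: \<rho>_def)
    then show ?thesis using \<delta>(1) by (auto simp: field_simps)
  qed
  have \<rho>_int: "(LINT r|lborel. \<rho> a r) = 1" for a
  proof -
    have "(LINT r|lborel. indicator {a..a + \<delta>} r *\<^sub>R \<rho> a r) = \<sigma> a (a + \<delta>) - \<sigma> a a"
      using \<delta>(1) \<sigma>_deriv smooth_continuous_on[OF \<rho>_smooth]
      by (intro integral_FTC_Icc)
        (auto simp: has_real_derivative_iff_has_vector_derivative[symmetric] intro: has_field_derivative_at_within)
    also have "\<dots> = 1" using \<delta>(1) S(5,6) by (simp add: \<sigma>_def)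
    also have "(\<lambda>r. indicator {a..a + \<delta>} r *\<^sub>R \<rho> a r) = \<rho> a"
      using \<rho>_supp[of a] by (auto simp: fun_eq_iff indicator_def)
    finally show ?thesis .
  qed
  have moll: "integrable lborel (\<lambda>z. v z * (\<psi> (fst z) * \<rho> a (snd z)))"
    "\<bar>(LINT z|lborel. v z * (\<psi> (fst z) * \<rho> a (snd z))) - (LINT x|lborel. v (x, a) * \<psi> x)\<bar> \<le> \<eta> * I"
    if "0 \<le> a" "a + \<delta> < T" for a
  proof -
    have near: "\<bar>v (x, r) - v (x, a)\<bar> \<le> \<eta>" if "r \<in> {a..a + \<delta>}" for x r
      by (rule d(2)) (use that \<open>0 \<le> a\<close> \<open>a + \<delta> < T\<close> \<delta>(1,2) in auto)
    note mts = mollified_time_slice[OF v \<open>0 \<le> a\<close> less_imp_le[OF \<delta>(1)] \<open>a + \<delta> < T\<close> near less_imp_le[OF \<eta>(1)]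
      smooth_continuous_on[OF \<psi>(1)] \<psi>(3) smooth_continuous_on[OF \<rho>_smooth] \<rho>_nonneg \<rho>_supp \<rho>_int]
    show "integrable lborel (\<lambda>z. v z * (\<psi> (fst z) * \<rho> a (snd z)))" by (rule mts(1))
    show "\<bar>(LINT z|lborel. v z * (\<psi> (fst z) * \<rho> a (snd z))) - (LINT x|lborel. v (x, a) * \<psi> x)\<bar> \<le> \<eta> * I"
      unfolding I_def by (rule mts(2))
  qed
  define \<tau> where "\<tau> r = \<sigma> s r - \<sigma> t r" for r
  define \<phi> where "\<phi> z = \<psi> (fst z) * \<tau> (snd z)" for z :: "real \<times> real"
  have fst_eq: "fst z = (1, 0) \<bullet> z + 0" and snd_eq: "snd z = (0, 1) \<bullet> z + 0" for z :: "real \<times> real"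
    by (simp_all add: inner_prod_def inner_real_def)
  have \<tau>_smooth: "smooth \<tau>" unfolding \<tau>_def by (intro smooth_diff \<sigma>_smooth)
  have \<tau>_deriv: "(\<tau> has_real_derivative \<rho> s r - \<rho> t r) (at r)" for r
    unfolding \<tau>_def by (intro DERIV_diff \<sigma>_deriv)
  have \<phi>_smooth: "smooth \<phi>"
    unfolding \<phi>_def fst_eq snd_eq by (intro smooth_mult smooth_affine \<psi>(1) \<tau>_smooth)
  \<comment> \<open>Holds even if the two ramps overlap, because both terms lie in [0,1].\<close>
  have \<tau>_bound: "\<bar>\<tau> r\<bar> \<le> 1" for r
    unfolding \<tau>_def \<sigma>_def using S(7,8)[of "(r - s) / \<delta>"] S(7,8)[of "(r - t) / \<delta>"] by (simp add: abs_le_iff)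
  have \<tau>_supp: "r \<in> {s..t + \<delta>}" if "\<tau> r \<noteq> 0" for r
  proof (rule ccontr)
    assume "r \<notin> {s..t + \<delta>}"
    then consider "r < s" | "t + \<delta> < r" unfolding atLeastAtMost_iff by linarith
    then have "\<sigma> s r = \<sigma> t r"
    proof cases
      case 1
      then have "(r - s) / \<delta> \<le> 0" "(r - t) / \<delta> \<le> 0" using st \<delta>(1) by (auto simp: divide_le_0_iff)
      then show ?thesis unfolding \<sigma>_def using S(5) by simp
    next
      case 2
      then have "1 \<le> (r - s) / \<delta>" "1 \<le> (r - t) / \<delta>" using st \<delta>(1) by (auto simp: field_simps)
      then show ?thesis unfolding \<sigma>_def using S(6) by simp
    qed
    then show False using that by (simp add: \<tau>_def)
  qed
  have \<phi>_test: "\<phi> \<in> test_functions (UNIV \<times> {0<..<T})"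
  proof -
    have "compact ({-R..R} \<times> {s..t + \<delta>})" by (intro compact_Times) auto
    moreover have "{-R..R} \<times> {s..t + \<delta>} \<subseteq> UNIV \<times> {0<..<T}" using st \<delta> by auto
    moreover have "\<forall>z. \<phi> z \<noteq> 0 \<longrightarrow> z \<in> {-R..R} \<times> {s..t + \<delta>}"
    proof (intro allI impI)
      fix z assume "\<phi> z \<noteq> 0"
      then have "\<bar>fst z\<bar> \<le> R" "snd z \<in> {s..t + \<delta>}" using \<psi>(3) \<tau>_supp by (auto simp: \<phi>_def)
      then show "z \<in> {-R..R} \<times> {s..t + \<delta>}" by (cases z) auto
    qed
    ultimately show ?thesis unfolding test_functions_def using \<phi>_smooth by blast
  qed
  have \<phi>_deriv: "frechet_derivative \<phi> (at z) (0, 1) = \<psi> (fst z) * \<rho> s (snd z) - \<psi> (fst z) * \<rho> t (snd z)" for z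
  proof -
    obtain \<psi>' where "\<And>x. (\<psi> has_real_derivative \<psi>' x) (at x)" using smooth_real_deriv[OF \<psi>(1)] by blast
    then have "((\<lambda>z::real \<times> real. \<psi> ((1, 0) \<bullet> z + 0)) has_derivative (\<lambda>e. ((1, 0) \<bullet> e) * \<psi>' ((1, 0) \<bullet> z + 0))) (at z)"
      by (rule has_derivative_affine)
    moreover have "((\<lambda>z::real \<times> real. \<tau> ((0, 1) \<bullet> z + 0)) has_derivative
        (\<lambda>e. ((0, 1) \<bullet> e) * (\<rho> s ((0, 1) \<bullet> z + 0) - \<rho> t ((0, 1) \<bullet> z + 0)))) (at z)"
      by (rule has_derivative_affine[OF \<tau>_deriv])
    ultimately have "(\<phi> has_derivative (\<lambda>e. \<psi> ((1, 0) \<bullet> z + 0) * (((0, 1) \<bullet> e) * (\<rho> s ((0, 1) \<bullet> z + 0) - \<rho> t ((0, 1) \<bullet> z + 0)))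
        + ((1, 0) \<bullet> e) * \<psi>' ((1, 0) \<bullet> z + 0) * \<tau> ((0, 1) \<bullet> z + 0))) (at z)"
      unfolding \<phi>_def fst_eq snd_eq by (rule has_derivative_mult)
    from frechet_derivative_at[OF this, symmetric] show ?thesis
      by (simp add: inner_prod_def inner_real_def algebra_simps)
  qed
  have mt: "0 \<le> t" "t + \<delta> < T" and ms: "0 \<le> s" "s + \<delta> < T" using st \<delta> by auto
  have L: "(LINT z|lborel. v z * frechet_derivative \<phi> (at z) (0, 1))
      = (LINT z|lborel. v z * (\<psi> (fst z) * \<rho> s (snd z))) - (LINT z|lborel. v z * (\<psi> (fst z) * \<rho> t (snd z)))"
    unfolding \<phi>_deriv right_diff_distrib using moll(1)[OF ms] moll(1)[OF mt]
    by (rule Bochner_Integration.integral_diff)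
  have G\<phi>: "\<bar>LINT z|lborel. G z * \<phi> z\<bar> \<le> m * (Q * (t + \<delta> - s))"
  proof -
    have [measurable]: "G \<in> borel_measurable borel" using G(1) by simp
    have iG: "integrable lborel (\<lambda>z. \<bar>G z\<bar> * indicator {s..t + \<delta>} (snd z))"
      by (rule integrable_mult_bounded[OF integrable_abs[OF G(1)], of _ 1]) (auto simp: indicator_def)
    have \<phi>B: "\<bar>\<phi> z\<bar> \<le> m * indicator {s..t + \<delta>} (snd z)" for z
    proof (cases "snd z \<in> {s..t + \<delta>}")
      case True
      have "\<bar>\<psi> (fst z)\<bar> * \<bar>\<tau> (snd z)\<bar> \<le> m * 1" using \<psi>(2) \<tau>_bound \<open>0 \<le> m\<close> by (intro mult_mono) auto
      then show ?thesis using True by (simp add: \<phi>_def abs_mult)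
    next
      case False
      then show ?thesis using \<tau>_supp[of "snd z"] by (auto simp: \<phi>_def)
    qed
    have iG\<phi>: "integrable lborel (\<lambda>z. G z * \<phi> z)"
    proof (rule integrable_mult_bounded[OF G(1), of _ m])
      show "\<phi> \<in> borel_measurable lborel"
        using smooth_continuous_on[OF \<phi>_smooth] by (simp add: borel_measurable_continuous_onI)
      show "\<bar>\<phi> z\<bar> \<le> m" for z
        using \<phi>B[of z] \<open>0 \<le> m\<close> by (cases "snd z \<in> {s..t + \<delta>}") auto
    qed
    have "\<bar>LINT z|lborel. G z * \<phi> z\<bar> \<le> (LINT z|lborel. \<bar>G z * \<phi> z\<bar>)" by (rule integral_abs_bound)
    also have "\<dots> \<le> (LINT z|lborel. m * (\<bar>G z\<bar> * indicator {s..t + \<delta>} (snd z)))"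
    proof (rule integral_mono)
      show "\<bar>G z * \<phi> z\<bar> \<le> m * (\<bar>G z\<bar> * indicator {s..t + \<delta>} (snd z))" for z
        using mult_left_mono[OF \<phi>B[of z], of "\<bar>G z\<bar>"] by (simp add: abs_mult ac_simps)
    qed (use iG iG\<phi> in auto)
    also have "\<dots> = m * (LINT z|lborel. \<bar>G z\<bar> * indicator {s..t + \<delta>} (snd z))" by simp
    also have "\<dots> \<le> m * (Q * (t + \<delta> - s))"
      using G(3)[of s "t + \<delta>"] st \<delta> \<open>0 \<le> m\<close> by (intro mult_left_mono) auto
    finally show ?thesis .
  qed
  have "m * (Q * (t + \<delta> - s)) = m * (Q * (t - s)) + m * Q * \<delta>" by (simp add: algebra_simps)
  then show "\<bar>(LINT x|lborel. v (x, t) * \<psi> x) - (LINT x|lborel. v (x, s) * \<psi> x)\<bar> \<le> m * (Q * (t - s)) + e"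
    using moll(2)[OF ms] moll(2)[OF mt] L eq[OF \<phi>_test] G\<phi> \<eta>(2) \<delta>(4) by linarith
qed

text \<open>The ideal test function is the sign of \<open>w\<close>. It is replaced by the
  continuous \<open>w / (\<bar>w\<bar> + \<epsilon>)\<close>, then by a polynomial within \<epsilon>
  of it, then cut off smoothly. The resulting test function is bounded by
  \<open>1 + \<epsilon>\<close>, and letting \<epsilon> tend to 0 closes the estimate.\<close>

lemma L1_norm_by_duality:
  fixes w :: "real \<Rightarrow> real"
  assumes w: "continuous_on UNIV w" and "0 \<le> D" "0 < R"
    and dual: "\<And>\<psi> m \<rho>. smooth \<psi> \<Longrightarrow> (\<And>x. \<bar>\<psi> x\<bar> \<le> m) \<Longrightarrow> (\<And>x. \<psi> x \<noteq> 0 \<Longrightarrow> \<bar>x\<bar> \<le> \<rho>) \<Longrightarrow>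
      (LINT x|lborel. w x * \<psi> x) \<le> m * D"
  shows "(LINT x:{-R..R}|lborel. \<bar>w x\<bar>) \<le> D"
proof -
  let ?J = "{- (R + 1)..R + 1}"
  obtain S S' where S: "smooth S" "smooth S'" "\<And>x. (S has_real_derivative S' x) (at x)" "\<And>x. 0 \<le> S' x"
    "\<And>x. x \<le> 0 \<Longrightarrow> S x = 0" "\<And>x. 1 \<le> x \<Longrightarrow> S x = 1" "\<And>x. 0 \<le> S x" "\<And>x. S x \<le> 1"
    using smooth_step_exists by metis
  \<comment> \<open>A smooth plateau, equal to 1 on \<open>[-R,R]\<close> and supported in
    \<open>[-R-1,R+1]\<close>.\<close>
  define q where "q x = S (1 \<bullet> x + (R + 1)) - S (1 \<bullet> x + (- R))" for x :: real
  have q_smooth: "smooth q" unfolding q_def by (intro smooth_diff smooth_affine S(1))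
  have q1: "q x = 1" if "\<bar>x\<bar> \<le> R" for x
    using that S(6)[of "x + (R + 1)"] S(5)[of "x + (- R)"] by (simp add: q_def inner_real_def abs_le_iff)
  have q_supp: "\<bar>x\<bar> \<le> R + 1" if "q x \<noteq> 0" for x
  proof (rule ccontr)
    assume "\<not> \<bar>x\<bar> \<le> R + 1"
    then consider "x < - (R + 1)" | "R + 1 < x" by linarith
    then show False
      using that S(5)[of "x + (R + 1)"] S(5)[of "x + (- R)"] S(6)[of "x + (R + 1)"] S(6)[of "x + (- R)"] \<open>0 < R\<close>
      by cases (auto simp: q_def inner_real_def)
  qed
  have q01: "0 \<le> q x" "q x \<le> 1" for x
  proof -
    show "q x \<le> 1" using S(7)[of "x + (- R)"] S(8)[of "x + (R + 1)"] by (simp add: q_def inner_real_def)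
    show "0 \<le> q x"
      using S(5)[of "x + (- R)"] S(6)[of "x + (R + 1)"] S(7)[of "x + (R + 1)"] S(8)[of "x + (- R)"] \<open>0 < R\<close>
      by (cases "x \<le> R") (auto simp: q_def inner_real_def)
  qed
  have wJ: "continuous_on ?J w" using w continuous_on_subset by blast
  obtain W where W: "0 < W" "\<And>x. x \<in> ?J \<Longrightarrow> \<bar>w x\<bar> \<le> W"
    using compact_imp_bounded[OF compact_continuous_image[OF wJ compact_Icc]] unfolding bounded_pos by auto
  have iw: "set_integrable lborel A (\<lambda>x. \<bar>w x\<bar>)" if "A = {-R..R}" for A
    unfolding that by (intro borel_integrable_atLeastAtMost' continuous_intros continuous_on_subset[OF w]) auto
  \<comment> \<open>Collects all errors of first order in \<epsilon>: \<open>D\<close> from the sup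
    bound \<open>1 + \<epsilon>\<close>, and the pointwise error \<open>\<epsilon> * (1 + W)\<close>
    over an interval of length \<open>2 * R + 2\<close>.\<close>
  define K where "K = D + (1 + W) * (2 * R + 2)"
  have "0 < K" using \<open>0 \<le> D\<close> W(1) \<open>0 < R\<close> by (simp add: K_def add_nonneg_pos)
  have bound: "(LINT x:{-R..R}|lborel. \<bar>w x\<bar>) \<le> D + \<epsilon> * K" if "0 < \<epsilon>" for \<epsilon>
  proof -
    define \<theta> where "\<theta> x = w x / (\<bar>w x\<bar> + \<epsilon>)" for x
    have pos: "0 < \<bar>w x\<bar> + \<epsilon>" for x using \<open>0 < \<epsilon>\<close> by (simp add: add_nonneg_pos)
    have "continuous_on ?J \<theta>"
      unfolding \<theta>_def using pos by (intro continuous_intros wJ) (metis less_irrefl)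
    then obtain p where p: "real_polynomial_function p" "\<And>x. x \<in> ?J \<Longrightarrow> \<bar>\<theta> x - p x\<bar> < \<epsilon>"
      using Stone_Weierstrass_real_polynomial_function[of ?J \<theta> \<epsilon>] \<open>0 < \<epsilon>\<close> by auto
    define \<psi> where "\<psi> x = p x * q x" for x
    have \<theta>1: "\<bar>\<theta> x\<bar> \<le> 1" for x
      using pos[of x] \<open>0 < \<epsilon>\<close> by (simp add: \<theta>_def abs_div divide_le_eq)
    have \<psi>_smooth: "smooth \<psi>" unfolding \<psi>_def by (intro smooth_mult smooth_real_polynomial p(1) q_smooth)
    have \<psi>_supp: "\<bar>x\<bar> \<le> R + 1" if "\<psi> x \<noteq> 0" for x using q_supp that by (auto simp: \<psi>_def)
    have \<psi>_bound: "\<bar>\<psi> x\<bar> \<le> 1 + \<epsilon>" for x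
    proof (cases "q x = 0")
      case False
      then have "x \<in> ?J" using q_supp[of x] by (auto simp: abs_le_iff)
      then have "\<bar>p x\<bar> \<le> 1 + \<epsilon>" using p(2)[of x] \<theta>1[of x] by linarith
      then have "\<bar>p x\<bar> * \<bar>q x\<bar> \<le> (1 + \<epsilon>) * 1" using q01[of x] \<open>0 < \<epsilon>\<close> by (intro mult_mono) auto
      then show ?thesis by (simp add: \<psi>_def abs_mult)
    qed (use \<open>0 < \<epsilon>\<close> in \<open>simp add: \<psi>_def\<close>)
    have pt: "indicator {-R..R} x *\<^sub>R \<bar>w x\<bar> \<le> w x * \<psi> x + \<epsilon> * (1 + W) * indicator ?J x" for x
    proof (cases "x \<in> ?J")
      case True
      have "\<bar>w x\<bar> - \<epsilon> \<le> w x * \<theta> x"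
      proof -
        have "(\<bar>w x\<bar> - \<epsilon>) * (\<bar>w x\<bar> + \<epsilon>) \<le> w x * w x"
          using \<open>0 < \<epsilon>\<close> by (simp add: algebra_simps abs_mult_self_eq)
        then show ?thesis using pos[of x] by (simp add: \<theta>_def pos_le_divide_eq)
      qed
      moreover have "\<bar>w x * (p x - \<theta> x)\<bar> \<le> W * \<epsilon>"
        unfolding abs_mult using W True p(2)[OF True] \<open>0 < \<epsilon>\<close> by (intro mult_mono) (auto simp: abs_minus_commute)
      ultimately have wp: "\<bar>w x\<bar> - \<epsilon> * (1 + W) \<le> w x * p x"
        by (simp add: algebra_simps abs_le_iff)
      have "q x * (\<bar>w x\<bar> - \<epsilon> * (1 + W)) \<le> q x * (w x * p x)"
        using wp q01(1) by (rule mult_left_mono)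
      then have "q x * \<bar>w x\<bar> \<le> w x * \<psi> x + q x * (\<epsilon> * (1 + W))"
        by (simp add: \<psi>_def algebra_simps)
      moreover have "q x * (\<epsilon> * (1 + W)) \<le> 1 * (\<epsilon> * (1 + W))"
        using q01(2) \<open>0 < \<epsilon>\<close> W(1) by (intro mult_right_mono) auto
      moreover have "indicator {-R..R} x *\<^sub>R \<bar>w x\<bar> \<le> q x * \<bar>w x\<bar>"
        using q1[of x] q01(1)[of x] by (cases "x \<in> {-R..R}") (auto simp: abs_le_iff)
      ultimately show ?thesis using True by simp
    next
      case False
      then have "x \<notin> {-R..R}" "\<not> \<bar>x\<bar> \<le> R + 1" by (auto simp: abs_le_iff)
      moreover from this(2) have "\<psi> x = 0" using \<psi>_supp by blast
      ultimately have "x \<notin> {-R..R}" "\<psi> x = 0" by blast+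
      then show ?thesis using False by simp
    qed
    have iw\<psi>: "integrable lborel (\<lambda>x. w x * \<psi> x)"
    proof -
      have "integrable lborel (\<lambda>x. indicator ?J x *\<^sub>R (w x * \<psi> x))"
        using borel_integrable_atLeastAtMost'[OF continuous_on_mult[OF wJ smooth_continuous_on[OF \<psi>_smooth]]]
        by (simp add: set_integrable_def)
      moreover have eq: "indicator ?J x *\<^sub>R (w x * \<psi> x) = w x * \<psi> x" for x
        by (rule indicator_scaleR_support) (use \<psi>_supp[of x] in auto)
      ultimately show ?thesis by (simp only: eq)
    qed
    have iJ: "integrable lborel (\<lambda>x. \<epsilon> * (1 + W) * indicator ?J x :: real)"
      by (intro integrable_mult_right integrable_real_indicator) (auto simp: emeasure_lborel_Icc_eq)
    have "(LINT x:{-R..R}|lborel. \<bar>w x\<bar>) \<le> (LINT x|lborel. w x * \<psi> x + \<epsilon> * (1 + W) * indicator ?J x)"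
      unfolding set_lebesgue_integral_def
      using iw[OF refl] iw\<psi> iJ pt by (intro integral_mono Bochner_Integration.integrable_add) (auto simp: set_integrable_def)
    also have "\<dots> = (LINT x|lborel. w x * \<psi> x) + \<epsilon> * (1 + W) * (2 * R + 2)"
      using iw\<psi> iJ \<open>0 < R\<close> by (subst Bochner_Integration.integral_add) auto
    also have "\<dots> \<le> (1 + \<epsilon>) * D + \<epsilon> * (1 + W) * (2 * R + 2)"
      using dual[OF \<psi>_smooth \<psi>_bound \<psi>_supp] by simp
    also have "\<dots> = D + \<epsilon> * K" by (simp add: K_def algebra_simps)
    finally show ?thesis .
  qed
  show ?thesis
  proof (rule field_le_epsilon)
    fix e :: real assume "0 < e"
    then show "(LINT x:{-R..R}|lborel. \<bar>w x\<bar>) \<le> D + e"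
      using bound[of "e / K"] \<open>0 < K\<close> by simp
  qed
qed

text \<open>Duality turns the increment of weak integrals into an \<open>L\<^sup>1\<close> bound on
  bounded intervals for positive times. The initial time is reached by uniform continuity in time,
  and monotone convergence removes the bound on \<open>x\<close>; the constant \<open>Q\<close> is
  independent of the interval.\<close>

lemma L1_time_lipschitz:
  fixes v G :: "real \<times> real \<Rightarrow> real"
  assumes v: "continuous_on (UNIV \<times> {0..<T}) v"
    and mod: "\<And>e. 0 < e \<Longrightarrow> \<exists>d>0. \<forall>x. \<forall>s\<in>{0..<T}. \<forall>t\<in>{0..<T}. \<bar>s - t\<bar> \<le> d \<longrightarrow> \<bar>v (x, s) - v (x, t)\<bar> \<le> e"
    and G: "integrable lborel G" "0 \<le> Q"
      "\<And>a b. 0 < a \<Longrightarrow> a < b \<Longrightarrow> b < T \<Longrightarrow> (LINT z|lborel. \<bar>G z\<bar> * indicator {a..b} (snd z)) \<le> Q * (b - a)"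
    and eq: "\<And>\<phi>. \<phi> \<in> test_functions (UNIV \<times> {0<..<T}) \<Longrightarrow>
      (LINT z|lborel. v z * frechet_derivative \<phi> (at z) (0, 1)) = - (LINT z|lborel. G z * \<phi> z)"
    and st: "s \<in> {0..<T}" "t \<in> {0..<T}"
  shows "(\<integral>\<^sup>+x. ennreal \<bar>v (x, s) - v (x, t)\<bar> \<partial>lborel) \<le> ennreal (Q * \<bar>s - t\<bar>)"
proof -
  have slice: "continuous_on A (\<lambda>x. v (x, t))" if "t \<in> {0..<T}" for t A
    by (rule continuous_on_compose2[OF v]) (use that in \<open>auto intro!: continuous_intros\<close>)
  have pos: "(LINT x:{-R..R}|lborel. \<bar>v (x, t) - v (x, s)\<bar>) \<le> Q * (t - s)"
    if "0 < s" "s < t" "t < T" "0 < R" for s t R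
  proof (rule L1_norm_by_duality)
    show "continuous_on UNIV (\<lambda>x. v (x, t) - v (x, s))"
      using that by (intro continuous_intros slice) auto
    show "0 \<le> Q * (t - s)" using G(2) that by simp
    show "0 < R" by fact
    fix \<psi> :: "real \<Rightarrow> real" and m \<rho>
    assume \<psi>: "smooth \<psi>" "\<And>x. \<bar>\<psi> x\<bar> \<le> m" "\<And>x. \<psi> x \<noteq> 0 \<Longrightarrow> \<bar>x\<bar> \<le> \<rho>"
    have i: "integrable lborel (\<lambda>x. v (x, r) * \<psi> x)" if "r \<in> {0..<T}" for r
    proof -
      have "integrable lborel (\<lambda>x. indicator {-\<rho>..\<rho>} x *\<^sub>R (v (x, r) * \<psi> x))"
        using borel_integrable_atLeastAtMost'[OF continuous_on_mult[OF slice[OF that] smooth_continuous_on[OF \<psi>(1)]]]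
        by (simp add: set_integrable_def)
      moreover have eq: "indicator {-\<rho>..\<rho>} x *\<^sub>R (v (x, r) * \<psi> x) = v (x, r) * \<psi> x" for x
        by (rule indicator_scaleR_support) (use \<psi>(3)[of x] in auto)
      ultimately show ?thesis by (simp only: eq)
    qed
    have "(LINT x|lborel. (v (x, t) - v (x, s)) * \<psi> x) = (LINT x|lborel. v (x, t) * \<psi> x) - (LINT x|lborel. v (x, s) * \<psi> x)"
      unfolding left_diff_distrib using that by (intro Bochner_Integration.integral_diff i) auto
    also have "\<dots> \<le> m * (Q * (t - s))"
      using weak_time_increment[OF v mod G eq \<psi> that(1-3)] by linarith
    finally show "(LINT x|lborel. (v (x, t) - v (x, s)) * \<psi> x) \<le> m * (Q * (t - s))" .
  qed
  have all: "(LINT x:{-R..R}|lborel. \<bar>v (x, t) - v (x, s)\<bar>) \<le> Q * (t - s)"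
    if "0 \<le> s" "s < t" "t < T" "0 < R" for s t R
  proof (cases "s = 0")
    case True
    show ?thesis
    proof (rule field_le_epsilon)
      fix e :: real assume "0 < e"
      \<comment> \<open>Divided by the length of the interval, so that exchanging the slice at 0 for
        the slice at \<open>r\<close> costs exactly \<open>e\<close>.\<close>
      define e' where "e' = e / (2 * R)"
      have "0 < e'" using \<open>0 < e\<close> \<open>0 < R\<close> by (simp add: e'_def)
      obtain d where d: "0 < d" "\<And>x s t. s \<in> {0..<T} \<Longrightarrow> t \<in> {0..<T} \<Longrightarrow> \<bar>s - t\<bar> \<le> d \<Longrightarrow> \<bar>v (x, s) - v (x, t)\<bar> \<le> e'"
        using mod[OF \<open>0 < e'\<close>] by blast
      define r where "r = min d (t / 2)"
      have r: "0 < r" "r < t" "r \<le> d" using d(1) that True by (auto simp: r_def)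
      have int: "set_integrable lborel {-R..R} (\<lambda>x. \<bar>v (x, a) - v (x, b)\<bar>)" if "a \<in> {0..<T}" "b \<in> {0..<T}" for a b
        by (intro borel_integrable_atLeastAtMost' continuous_intros slice that)
      have e'i: "set_integrable lborel {-R..R} (\<lambda>x. e')"
        by (intro borel_integrable_atLeastAtMost' continuous_intros)
      have ri: "set_integrable lborel {-R..R} (\<lambda>x. \<bar>v (x, t) - v (x, r)\<bar>)" using r that by (intro int) auto
      have "(LINT x:{-R..R}|lborel. \<bar>v (x, t) - v (x, s)\<bar>) \<le> (LINT x:{-R..R}|lborel. \<bar>v (x, t) - v (x, r)\<bar> + e')"
      proof (rule set_integral_mono)
        show "set_integrable lborel {-R..R} (\<lambda>x. \<bar>v (x, t) - v (x, s)\<bar>)" using that by (intro int) auto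
        show "set_integrable lborel {-R..R} (\<lambda>x. \<bar>v (x, t) - v (x, r)\<bar> + e')" using ri e'i by (rule set_integral_add)
        show "\<bar>v (x, t) - v (x, s)\<bar> \<le> \<bar>v (x, t) - v (x, r)\<bar> + e'" for x
        proof -
          have "\<bar>v (x, r) - v (x, s)\<bar> \<le> e'" using r that True by (intro d(2)) auto
          then show ?thesis by linarith
        qed
      qed
      also have "\<dots> = (LINT x:{-R..R}|lborel. \<bar>v (x, t) - v (x, r)\<bar>) + e"
        using ri e'i \<open>0 < R\<close> by (subst set_integral_add) (auto simp: set_lebesgue_integral_def e'_def)
      also have "\<dots> \<le> Q * (t - r) + e" using pos[OF r(1,2) that(3,4)] by simp
      also have "\<dots> \<le> Q * (t - s) + e" using G(2) r True by (intro add_right_mono mult_left_mono) auto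
      finally show "(LINT x:{-R..R}|lborel. \<bar>v (x, t) - v (x, s)\<bar>) \<le> Q * (t - s) + e" .
    qed
  qed (use pos that in auto)
  have main: "(\<integral>\<^sup>+x. ennreal \<bar>v (x, t) - v (x, s)\<bar> \<partial>lborel) \<le> ennreal (Q * (t - s))"
    if "0 \<le> s" "s < t" "t < T" for s t
  proof -
    have meas: "(\<lambda>x. \<bar>v (x, t) - v (x, s)\<bar>) \<in> borel_measurable borel"
      using that by (intro borel_measurable_continuous_onI continuous_intros slice) auto
    have part: "(\<integral>\<^sup>+x. ennreal \<bar>v (x, t) - v (x, s)\<bar> * indicator {- real (Suc n)..real (Suc n)} x \<partial>lborel) \<le> ennreal (Q * (t - s))" for n
    proof -
      have int: "set_integrable lborel {- real (Suc n)..real (Suc n)} (\<lambda>x. \<bar>v (x, t) - v (x, s)\<bar>)"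
        using that by (intro borel_integrable_atLeastAtMost' continuous_intros slice) auto
      have "(\<integral>\<^sup>+x. ennreal \<bar>v (x, t) - v (x, s)\<bar> * indicator {- real (Suc n)..real (Suc n)} x \<partial>lborel)
          = (\<integral>\<^sup>+x. ennreal (indicator {- real (Suc n)..real (Suc n)} x *\<^sub>R \<bar>v (x, t) - v (x, s)\<bar>) \<partial>lborel)"
        by (intro nn_integral_cong) (simp split: split_indicator)
      also have "\<dots> = ennreal (LINT x:{- real (Suc n)..real (Suc n)}|lborel. \<bar>v (x, t) - v (x, s)\<bar>)"
        using int unfolding set_lebesgue_integral_def set_integrable_def
        by (intro nn_integral_eq_integral) auto
      also have "\<dots> \<le> ennreal (Q * (t - s))"
        using all[OF that, of "real (Suc n)"] by (intro ennreal_leI) simp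
      finally show ?thesis .
    qed
    have sup: "(SUP n. ennreal \<bar>v (x, t) - v (x, s)\<bar> * indicator {- real (Suc n)..real (Suc n)} x) = ennreal \<bar>v (x, t) - v (x, s)\<bar>" for x
    proof (rule antisym)
      show "(SUP n. ennreal \<bar>v (x, t) - v (x, s)\<bar> * indicator {- real (Suc n)..real (Suc n)} x) \<le> ennreal \<bar>v (x, t) - v (x, s)\<bar>"
        by (rule SUP_least) (simp split: split_indicator)
      obtain n where "\<bar>x\<bar> \<le> real n" using real_arch_simple by blast
      then have "x \<in> {- real (Suc n)..real (Suc n)}" by (auto simp: abs_le_iff)
      then show "ennreal \<bar>v (x, t) - v (x, s)\<bar> \<le> (SUP n. ennreal \<bar>v (x, t) - v (x, s)\<bar> * indicator {- real (Suc n)..real (Suc n)} x)"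
        by (intro SUP_upper2[of n]) auto
    qed
    have "(\<integral>\<^sup>+x. ennreal \<bar>v (x, t) - v (x, s)\<bar> \<partial>lborel)
        = (\<integral>\<^sup>+x. (SUP n. ennreal \<bar>v (x, t) - v (x, s)\<bar> * indicator {- real (Suc n)..real (Suc n)} x) \<partial>lborel)"
      by (simp only: sup)
    also have "\<dots> = (SUP n. \<integral>\<^sup>+x. ennreal \<bar>v (x, t) - v (x, s)\<bar> * indicator {- real (Suc n)..real (Suc n)} x \<partial>lborel)"
    proof (rule nn_integral_monotone_convergence_SUP)
      show "incseq (\<lambda>n x. ennreal \<bar>v (x, t) - v (x, s)\<bar> * indicator {- real (Suc n)..real (Suc n)} x)"
        by (auto simp: incseq_def le_fun_def split: split_indicator)
    qed (use meas in measurable)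
    also have "\<dots> \<le> ennreal (Q * (t - s))" by (rule SUP_least) (rule part)
    finally show ?thesis .
  qed
  consider "s < t" | "t < s" | "s = t" by linarith
  then show ?thesis
  proof cases
    case 1
    then show ?thesis using main[of s t] st by (simp add: abs_minus_commute)
  next
    case 2
    then show ?thesis using main[of t s] st by simp
  qed simp
qed

text \<open>For the norm to tend to 0 the modular must drop to at most 1 at every scale \<mu>. The
  constant \<open>ln (exp 1 + 2 * V / \<mu>) / \<mu>\<close> in front of the
  \<open>L\<^sup>1\<close> norm degenerates as \<mu> tends to 0, but is fixed once \<mu> is.\<close>

lemma C_LlogL_increment:
  fixes v :: "real \<times> real \<Rightarrow> real"
  assumes "0 < T" and v: "continuous_on (UNIV \<times> {0..<T}) v"
    and V: "\<And>x t. t \<in> {0..<T} \<Longrightarrow> \<bar>v (x, t)\<bar> \<le> V" and "0 \<le> Q"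
    and lip: "\<And>s t. s \<in> {0..<T} \<Longrightarrow> t \<in> {0..<T} \<Longrightarrow>
      (\<integral>\<^sup>+x. ennreal \<bar>v (x, s) - v (x, t)\<bar> \<partial>lborel) \<le> ennreal (Q * \<bar>s - t\<bar>)"
  shows "(\<lambda>(x, t). v (x, t) - v (x, 0)) \<in> C_LlogL T UNIV"
proof -
  have slice: "continuous_on A (\<lambda>x. v (x, t))" if "t \<in> {0..<T}" for t A
    by (rule continuous_on_compose2[OF v]) (use that in \<open>auto intro!: continuous_intros\<close>)
  have "0 \<le> V" using V[of 0 0] \<open>0 < T\<close> by simp
  have mod: "(\<integral>\<^sup>+x. ennreal (\<Phi> ((v (x, s) - v (x, t)) / \<mu>)) \<partial>lborel)
      \<le> ennreal (ln (exp 1 + 2 * V / \<mu>) / \<mu> * (Q * \<bar>s - t\<bar>))"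
    if "0 < \<mu>" "s \<in> {0..<T}" "t \<in> {0..<T}" for \<mu> s t
  proof -
    define l where "l = ln (exp 1 + 2 * V / \<mu>)"
    have l: "0 \<le> l" using exp1_plus_abs_ge'[of "2 * V / \<mu>"] \<open>0 \<le> V\<close> \<open>0 < \<mu>\<close> by (simp add: l_def)
    have meas: "(\<lambda>x. \<bar>v (x, s) - v (x, t)\<bar>) \<in> borel_measurable borel"
      using that by (intro borel_measurable_continuous_onI continuous_intros slice) auto
    have "\<Phi> ((v (x, s) - v (x, t)) / \<mu>) \<le> l / \<mu> * \<bar>v (x, s) - v (x, t)\<bar>" for x
    proof -
      let ?w = "\<bar>v (x, s) - v (x, t)\<bar> / \<mu>"
      have "\<bar>v (x, s) - v (x, t)\<bar> \<le> 2 * V" using V[OF that(2), of x] V[OF that(3), of x] by linarith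
      then have "?w \<le> 2 * V / \<mu>" using \<open>0 < \<mu>\<close> by (intro divide_right_mono) auto
      moreover have "0 \<le> ?w" using \<open>0 < \<mu>\<close> by simp
      ultimately have "ln (exp 1 + ?w) \<le> l"
        unfolding l_def by (intro ln_mono) (auto intro: add_pos_nonneg)
      then have "?w * ln (exp 1 + ?w) \<le> ?w * l" using \<open>0 \<le> ?w\<close> by (rule mult_left_mono)
      then show ?thesis using \<open>0 < \<mu>\<close> by (simp add: \<Phi>_def abs_div ac_simps)
    qed
    then have "(\<integral>\<^sup>+x. ennreal (\<Phi> ((v (x, s) - v (x, t)) / \<mu>)) \<partial>lborel)
        \<le> (\<integral>\<^sup>+x. ennreal (l / \<mu>) * ennreal \<bar>v (x, s) - v (x, t)\<bar> \<partial>lborel)"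
      using l \<open>0 < \<mu>\<close> by (intro nn_integral_mono) (simp add: ennreal_mult'[symmetric] ennreal_leI)
    also have "\<dots> = ennreal (l / \<mu>) * (\<integral>\<^sup>+x. ennreal \<bar>v (x, s) - v (x, t)\<bar> \<partial>lborel)"
      using meas by (intro nn_integral_cmult) auto
    also have "\<dots> \<le> ennreal (l / \<mu>) * ennreal (Q * \<bar>s - t\<bar>)"
      using lip[OF that(2,3)] by (intro mult_left_mono) auto
    also have "\<dots> = ennreal (l / \<mu> * (Q * \<bar>s - t\<bar>))"
      using l \<open>0 < \<mu>\<close> \<open>0 \<le> Q\<close> by (subst ennreal_mult) auto
    finally show ?thesis by (simp add: l_def)
  qed
  show ?thesis
    unfolding C_LlogL_def
  proof (intro CollectI ballI conjI)
    fix t assume t: "t \<in> {0..<T}"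
    have zero: "0 \<in> {0..<T}" using \<open>0 < T\<close> by simp
    have "set_integrable lborel (UNIV \<inter> {a..b}) (\<lambda>x. v (x, t) - v (x, 0))" for a b
      using t zero by (simp, intro borel_integrable_atLeastAtMost' continuous_intros slice) auto
    moreover have "(\<integral>\<^sup>+x. ennreal (\<bar>v (x, t) - v (x, 0)\<bar> * ln (exp 1 + \<bar>v (x, t) - v (x, 0)\<bar>)) \<partial>lborel) < \<infinity>"
      using mod[of 1 t 0] t zero by (auto simp: \<Phi>_def intro: le_less_trans)
    ultimately show "(\<lambda>x. case (x, t) of (x, t) \<Rightarrow> v (x, t) - v (x, 0)) \<in> LlogL UNIV"
      unfolding LlogL_def by simp
    show "((\<lambda>s. LlogL_norm UNIV (\<lambda>x. (case (x, s) of (x, t) \<Rightarrow> v (x, t) - v (x, 0)) - (case (x, t) of (x, t) \<Rightarrow> v (x, t) - v (x, 0))))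
        \<longlongrightarrow> 0) (at t within {0..<T})"
    proof (rule order_tendstoI)
      fix a :: ennreal assume "0 < a"
      then obtain b where b: "0 < b" "b < a" using dense by blast
      then have "b \<noteq> top" by auto
      then obtain \<mu> where \<mu>: "b = ennreal \<mu>" "0 < \<mu>"
        using b(1) by (cases b) auto
      define c where "c = ln (exp 1 + 2 * V / \<mu>) / \<mu> * Q"
      have "0 \<le> c"
        using exp1_plus_abs_ge'[of "2 * V / \<mu>"] \<open>0 \<le> V\<close> \<mu>(2) \<open>0 \<le> Q\<close> by (simp add: c_def)
      \<comment> \<open>This radius gives \<open>c * \<bar>s - t\<bar> \<le> 1\<close>, the
        threshold for the modular in the definition of the norm.\<close>
      have "\<forall>\<^sub>F s in at t within {0..<T}. dist s t < 1 / (c + 1) \<and> s \<in> {0..<T}"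
        using \<open>0 \<le> c\<close> unfolding eventually_at by (intro exI[of _ "1 / (c + 1)"]) auto
      then show "\<forall>\<^sub>F s in at t within {0..<T}. LlogL_norm UNIV (\<lambda>x. (case (x, s) of (x, t) \<Rightarrow> v (x, t) - v (x, 0)) - (case (x, t) of (x, t) \<Rightarrow> v (x, t) - v (x, 0))) < a"
      proof (rule eventually_mono)
        fix s assume s: "dist s t < 1 / (c + 1) \<and> s \<in> {0..<T}"
        have "c * \<bar>s - t\<bar> \<le> (c + 1) * (1 / (c + 1))"
          using s \<open>0 \<le> c\<close> by (intro mult_mono) (auto simp: dist_real_def)
        then have c1: "c * \<bar>s - t\<bar> \<le> 1" using \<open>0 \<le> c\<close> by simp
        have "(\<integral>\<^sup>+x\<in>UNIV. ennreal (\<Phi> ((v (x, s) - v (x, t)) / \<mu>)) \<partial>lborel) \<le> ennreal (c * \<bar>s - t\<bar>)"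
          using mod[OF \<mu>(2), of s t] s t by (simp add: c_def mult.assoc)
        also have "\<dots> \<le> 1" using c1 by (simp add: ennreal_le_1)
        finally have "LlogL_norm UNIV (\<lambda>x. v (x, s) - v (x, t)) \<le> ennreal \<mu>"
          by (rule LlogL_norm_leI[OF \<mu>(2)])
        then show "LlogL_norm UNIV (\<lambda>x. (case (x, s) of (x, t) \<Rightarrow> v (x, t) - v (x, 0)) - (case (x, t) of (x, t) \<Rightarrow> v (x, t) - v (x, 0))) < a"
          using b(2) \<mu>(1) by simp
      qed
    qed simp
  qed
qed

section \<open>Convergence of the velocity field\<close>

lemma kernel_tail_small:
  fixes K :: "real \<Rightarrow> real"
  assumes K: "integrable lborel K" and "0 < e"
  obtains \<rho> where "0 < \<rho>" "\<And>r. \<rho> \<le> r \<Longrightarrow> (LINT y:{y. \<bar>y\<bar> \<ge> r}|lborel. \<bar>K y\<bar>) < e"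
proof -
  have [measurable]: "K \<in> borel_measurable borel" using K by simp
  have int: "integrable lborel (\<lambda>y. indicator {y. \<bar>y\<bar> \<ge> r} y *\<^sub>R \<bar>K y\<bar>)" for r :: real
    using K by (intro integrable_mult_indicator integrable_abs) auto
  have "(\<lambda>n. LINT y:{y. \<bar>y\<bar> \<ge> real n}|lborel. \<bar>K y\<bar>) \<longlonglongrightarrow> (LINT y|lborel. K y * 0)"
    unfolding set_lebesgue_integral_def
  proof (rule integral_dominated_convergence[where w = "\<lambda>y. \<bar>K y\<bar>"])
    show "AE y in lborel. (\<lambda>n. indicator {y. \<bar>y\<bar> \<ge> real n} y *\<^sub>R \<bar>K y\<bar>) \<longlonglongrightarrow> K y * 0"
    proof (intro AE_I2)
      fix y :: real
      obtain n0 :: nat where "\<bar>y\<bar> < real n0" using reals_Archimedean2 by blast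
      then have "\<forall>\<^sub>F n in sequentially. indicator {y. \<bar>y\<bar> \<ge> real n} y *\<^sub>R \<bar>K y\<bar> = 0"
        unfolding eventually_sequentially by (intro exI[of _ n0]) auto
      then show "(\<lambda>n. indicator {y. \<bar>y\<bar> \<ge> real n} y *\<^sub>R \<bar>K y\<bar>) \<longlonglongrightarrow> K y * 0"
        by (simp only: mult_zero_right tendsto_eventually)
    qed
    show "AE y in lborel. norm (indicator {y. \<bar>y\<bar> \<ge> real n} y *\<^sub>R \<bar>K y\<bar>) \<le> \<bar>K y\<bar>" for n
      by (intro AE_I2) (simp split: split_indicator)
  qed (use K in auto)
  then have "\<forall>\<^sub>F n in sequentially. (LINT y:{y. \<bar>y\<bar> \<ge> real n}|lborel. \<bar>K y\<bar>) < e"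
    using \<open>0 < e\<close> by (intro order_tendstoD(2)) auto
  then obtain n where n: "(LINT y:{y. \<bar>y\<bar> \<ge> real n}|lborel. \<bar>K y\<bar>) < e"
    by (auto simp: eventually_sequentially)
  show thesis
  \<comment> \<open>The added 1 only ensures a positive radius.\<close>
  proof (rule that[of "real n + 1"])
    fix r :: real assume r: "real n + 1 \<le> r"
    have "(LINT y:{y. \<bar>y\<bar> \<ge> r}|lborel. \<bar>K y\<bar>) \<le> (LINT y:{y. \<bar>y\<bar> \<ge> real n}|lborel. \<bar>K y\<bar>)"
      unfolding set_lebesgue_integral_def using r
      by (intro integral_mono int) (auto split: split_indicator)
    then show "(LINT y:{y. \<bar>y\<bar> \<ge> r}|lborel. \<bar>K y\<bar>) < e" using n by simp
  qed simp
qed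

lemma line_conv_flip: "(LINT z|lborel. K (x - z) * g z) = (LINT z|lborel. K z * g (x - z))" for K g :: "real \<Rightarrow> real"
  using lborel_integral_real_affine[of "-1" "\<lambda>z. K (x - z) * g z" x] by simp

lemma line_conv_bound:
  fixes K g :: "real \<Rightarrow> real"
  assumes K: "integrable lborel K" and g: "continuous_on UNIV g" "\<And>x. \<bar>g x\<bar> \<le> B"
  shows "\<bar>LINT z|lborel. K (x - z) * g z\<bar> \<le> L1_norm K * B"
proof -
  have [measurable]: "g \<in> borel_measurable borel" using g(1) by (rule borel_measurable_continuous_onI)
  have i: "integrable lborel (\<lambda>z. K z * g (x - z))"
    by (rule integrable_mult_bounded[OF K _ g(2)]) measurable
  have "\<bar>LINT z|lborel. K z * g (x - z)\<bar> \<le> (LINT z|lborel. \<bar>K z * g (x - z)\<bar>)" by (rule integral_abs_bound)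
  also have "\<dots> \<le> (LINT z|lborel. \<bar>K z\<bar> * B)"
    using i K g(2) by (intro integral_mono integrable_abs integrable_mult_left) (auto simp: abs_mult intro: mult_left_mono)
  finally show ?thesis by (simp add: line_conv_flip L1_norm_def)
qed

text \<open>After the flip the variable \<open>x\<close> sits in the continuous \<open>v\<close> and
  no longer in the merely integrable \<open>K\<close>, so dominated convergence applies.\<close>

lemma continuous_line_conv:
  fixes K :: "real \<Rightarrow> real" and v :: "real \<times> real \<Rightarrow> real"
  assumes K: "integrable lborel K" and v: "continuous_on (UNIV \<times> {0..<T}) v"
    and B: "\<And>x t. t \<in> {0..<T} \<Longrightarrow> \<bar>v (x, t)\<bar> \<le> B"
  shows "continuous_on (UNIV \<times> {0..<T}) (\<lambda>z. LINT y|lborel. K (fst z - y) * v (y, snd z))"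
proof -
  have flip: "(LINT y|lborel. K (fst z - y) * v (y, snd z)) = (LINT y|lborel. K y * v (fst z - y, snd z))" for z
    by (rule line_conv_flip[of K "fst z" "\<lambda>y. v (y, snd z)"])
  show ?thesis
    unfolding flip continuous_on_sequentially
  proof (intro allI impI ballI, unfold o_def)
    fix Z :: "nat \<Rightarrow> real \<times> real" and z assume z: "z \<in> UNIV \<times> {0..<T}" and Z: "(\<forall>n. Z n \<in> UNIV \<times> {0..<T}) \<and> Z \<longlonglongrightarrow> z"
    have [measurable]: "K \<in> borel_measurable borel" using K by simp
    have slice: "(\<lambda>y. v (x - y, t)) \<in> borel_measurable borel" if "t \<in> {0..<T}" for x t
      by (intro borel_measurable_continuous_onI continuous_on_compose2[OF v])
        (use that in \<open>auto intro!: continuous_intros\<close>)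
    have t: "snd z \<in> {0..<T}" "snd (Z n) \<in> {0..<T}" for n using z Z by (auto simp: mem_Times_iff)
    show "(\<lambda>n. LINT y|lborel. K y * v (fst (Z n) - y, snd (Z n))) \<longlonglongrightarrow> (LINT y|lborel. K y * v (fst z - y, snd z))"
    proof (rule integral_dominated_convergence[where w = "\<lambda>y. \<bar>K y\<bar> * B"])
      show "(\<lambda>y. K y * v (fst z - y, snd z)) \<in> borel_measurable lborel" using slice[OF t(1)] by simp
      show "(\<lambda>y. K y * v (fst (Z n) - y, snd (Z n))) \<in> borel_measurable lborel" for n using slice[OF t(2)] by simp
      show "integrable lborel (\<lambda>y. \<bar>K y\<bar> * B)" using K by (intro integrable_mult_left integrable_abs)
      show "AE y in lborel. (\<lambda>n. K y * v (fst (Z n) - y, snd (Z n))) \<longlonglongrightarrow> K y * v (fst z - y, snd z)"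
      proof (intro AE_I2 tendsto_mult tendsto_const)
        fix y
        have "(\<lambda>n. (fst (Z n) - y, snd (Z n))) \<longlonglongrightarrow> (fst z - y, snd z)"
          using Z by (intro tendsto_intros) auto
        then show "(\<lambda>n. v (fst (Z n) - y, snd (Z n))) \<longlonglongrightarrow> v (fst z - y, snd z)"
          by (rule continuous_on_tendsto_compose[OF v]) (use t in auto)
      qed
      show "AE y in lborel. norm (K y * v (fst (Z n) - y, snd (Z n))) \<le> \<bar>K y\<bar> * B" for n
        using B[OF t(2)] by (intro AE_I2) (auto simp: abs_mult intro: mult_left_mono)
    qed
  qed
qed

text \<open>For \<open>\<bar>z\<bar> < \<rho>\<close>, inside the cell since
  \<open>\<rho> \<le> P\<close>, the two functions are close. Beyond \<rho> each is at most
  \<open>B\<close>, so the tail of \<open>K\<close> is paid twice.\<close>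

lemma torus_line_conv_diff:
  fixes K a b :: "real \<Rightarrow> real"
  assumes K: "integrable lborel K" and a: "continuous_on UNIV a" "\<And>x. \<bar>a x\<bar> \<le> B"
    and b: "continuous_on UNIV b" "\<And>x. \<bar>b x\<bar> \<le> B"
    and \<rho>: "\<rho> \<le> P" and \<eta>: "\<And>z. \<bar>z\<bar> \<le> \<rho> \<Longrightarrow> \<bar>a (x - z) - b (x - z)\<bar> \<le> \<eta>" "0 \<le> \<eta>"
  shows "\<bar>(LINT z:{-P..P}|lborel. K z * a (x - z)) - (LINT z|lborel. K z * b (x - z))\<bar>
    \<le> L1_norm K * \<eta> + 2 * B * (LINT y:{y. \<bar>y\<bar> \<ge> \<rho>}|lborel. \<bar>K y\<bar>)"
proof -
  have [measurable]: "K \<in> borel_measurable borel" using K by simp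
  have [measurable]: "a \<in> borel_measurable borel" "b \<in> borel_measurable borel"
    using a(1) b(1) by (auto intro: borel_measurable_continuous_onI)
  have "0 \<le> B" using a(2)[of 0] by simp
  let ?E = "{y. \<bar>y\<bar> \<ge> \<rho>}"
  have iE: "integrable lborel (\<lambda>z. indicator ?E z *\<^sub>R \<bar>K z\<bar>)"
    using K by (intro integrable_mult_indicator integrable_abs) auto
  have ia: "integrable lborel (\<lambda>z. K z * a (x - z))" by (rule integrable_mult_bounded[OF K _ a(2)]) measurable
  have "\<bar>(LINT z|lborel. indicator {-P..P} z *\<^sub>R (K z * a (x - z))) - (LINT z|lborel. K z * b (x - z))\<bar>
      \<le> (LINT z|lborel. \<bar>K z\<bar> * \<eta> + 2 * B * (indicator ?E z *\<^sub>R \<bar>K z\<bar>))"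
  proof (rule integral_abs_diff_le)
    show "integrable lborel (\<lambda>z. indicator {-P..P} z *\<^sub>R (K z * a (x - z)))"
      using ia by (intro integrable_mult_indicator) auto
    show "integrable lborel (\<lambda>z. K z * b (x - z))" by (rule integrable_mult_bounded[OF K _ b(2)]) measurable
    show "integrable lborel (\<lambda>z. \<bar>K z\<bar> * \<eta> + 2 * B * (indicator ?E z *\<^sub>R \<bar>K z\<bar>))"
      using K iE by (intro Bochner_Integration.integrable_add integrable_mult_left integrable_mult_right integrable_abs)
    fix z
    show "\<bar>indicator {-P..P} z *\<^sub>R (K z * a (x - z)) - K z * b (x - z)\<bar>
        \<le> \<bar>K z\<bar> * \<eta> + 2 * B * (indicator ?E z *\<^sub>R \<bar>K z\<bar>)"
    proof (cases "\<rho> \<le> \<bar>z\<bar>")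
      case False
      then have "z \<in> {-P..P}" using \<rho> by (auto simp: abs_le_iff)
      then have "\<bar>indicator {-P..P} z *\<^sub>R (K z * a (x - z)) - K z * b (x - z)\<bar> = \<bar>K z\<bar> * \<bar>a (x - z) - b (x - z)\<bar>"
        by (simp add: abs_mult[symmetric] right_diff_distrib)
      also have "\<dots> \<le> \<bar>K z\<bar> * \<eta>" using False \<eta>(1)[of z] by (intro mult_left_mono) auto
      finally show ?thesis using False by simp
    next
      case True
      have Ka: "\<bar>K z * a (x - z)\<bar> \<le> B * \<bar>K z\<bar>" "\<bar>K z * b (x - z)\<bar> \<le> B * \<bar>K z\<bar>"
        using mult_right_mono[OF a(2)[of "x - z"], of "\<bar>K z\<bar>"] mult_right_mono[OF b(2)[of "x - z"], of "\<bar>K z\<bar>"]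
        by (simp_all add: abs_mult mult.commute)
      have ind: "\<bar>indicator {-P..P} z *\<^sub>R (K z * a (x - z))\<bar> \<le> \<bar>K z * a (x - z)\<bar>"
        by (simp split: split_indicator)
      have "\<bar>indicator {-P..P} z *\<^sub>R (K z * a (x - z)) - K z * b (x - z)\<bar>
          \<le> \<bar>indicator {-P..P} z *\<^sub>R (K z * a (x - z))\<bar> + \<bar>K z * b (x - z)\<bar>"
        by (rule abs_triangle_ineq4)
      also have "\<dots> \<le> B * \<bar>K z\<bar> + B * \<bar>K z\<bar>"
        by (rule add_mono[OF order_trans[OF ind Ka(1)] Ka(2)])
      finally have "\<bar>indicator {-P..P} z *\<^sub>R (K z * a (x - z)) - K z * b (x - z)\<bar> \<le> 2 * B * \<bar>K z\<bar>" by simp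
      moreover have "0 \<le> \<bar>K z\<bar> * \<eta>" using \<eta>(2) by simp
      ultimately show ?thesis using True by simp
    qed
  qed
  also have "\<dots> = L1_norm K * \<eta> + 2 * B * (LINT z:?E|lborel. \<bar>K z\<bar>)"
    by (simp only: L1_norm_def set_lebesgue_integral_def integral_mult_left_zero integral_mult_right_zero
        Bochner_Integration.integral_add[OF integrable_mult_left[OF integrable_abs[OF K]] integrable_mult_right[OF iE]])
  finally show ?thesis by (simp only: set_lebesgue_integral_def)
qed

text \<open>The convolutions are nonlocal while \<open>w\<close> converges on bounded sets only. The
  integrable tail of \<open>K\<close> confines the interaction to distance \<rho>, up to an error
  controlled by the common sup bound.\<close>

lemma uniform_limit_velocity:
  fixes K :: "real \<Rightarrow> real" and w :: "nat \<Rightarrow> real \<times> real \<Rightarrow> real"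
  assumes K: "integrable lborel K" and P: "\<And>n. 0 < P n" "filterlim P at_top sequentially" and M: "\<And>n. 0 < M n"
    and w: "\<And>n. continuous_on (UNIV \<times> {0..<T}) (w n)" "\<And>n x t. t \<in> {0..<T} \<Longrightarrow> \<bar>w n (x, t)\<bar> \<le> B"
    and v: "continuous_on (UNIV \<times> {0..<T}) v" "\<And>x t. t \<in> {0..<T} \<Longrightarrow> \<bar>v (x, t)\<bar> \<le> B" and "0 \<le> B"
    and wv: "\<And>A. A \<subseteq> UNIV \<times> {0..<T} \<Longrightarrow> bounded A \<Longrightarrow> uniform_limit A w v sequentially"
    and \<epsilon>: "\<epsilon> \<longlonglongrightarrow> 0"
      "\<And>n X t. t \<in> {0..<T} \<Longrightarrow>
        \<bar>1 / (2 * P n) * torus_conv (P n) (fejer (P n) (M n)) (\<lambda>y. w n (y, t)) X - w n (X, t)\<bar> \<le> \<epsilon> n"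
    and A: "A \<subseteq> UNIV \<times> {0..<T}" "bounded A"
  shows "uniform_limit A (\<lambda>n z. torus_conv (P n) (sigma K (P n) (M n)) (\<lambda>y. w n (y, snd z)) (fst z))
     (\<lambda>z. LINT y|lborel. K (fst z - y) * v (y, snd z)) sequentially"
proof (rule uniform_limitI)
  fix e :: real assume "0 < e"
  have slice: "continuous_on UNIV (\<lambda>x. f (x, t))" if "t \<in> {0..<T}" "continuous_on (UNIV \<times> {0..<T}) f"
    for t and f :: "real \<times> real \<Rightarrow> real"
    by (rule continuous_on_compose2[OF that(2)]) (use that(1) in \<open>auto intro!: continuous_intros\<close>)
  have K0: "0 \<le> L1_norm K" unfolding L1_norm_def by (intro Bochner_Integration.integral_nonneg) simp
  \<comment> \<open>The tail of \<open>K\<close> enters six times with factor \<open>B\<close>: four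
    from the correction in the regularized kernel, two from the truncation at \<rho>. Together they
    may cost \<open>e / 3\<close>, whence 18.\<close>
  have "0 < e / (18 * (B + 1))" using \<open>0 < e\<close> \<open>0 \<le> B\<close> by simp
  then obtain \<rho> where \<rho>: "0 < \<rho>" "\<And>r. \<rho> \<le> r \<Longrightarrow> (LINT y:{y. \<bar>y\<bar> \<ge> r}|lborel. \<bar>K y\<bar>) < e / (18 * (B + 1))"
    using kernel_tail_small[OF K] by blast
  have tail: "6 * B * (LINT y:{y. \<bar>y\<bar> \<ge> r}|lborel. \<bar>K y\<bar>) \<le> e / 3" if "\<rho> \<le> r" for r
  proof -
    have "0 \<le> (LINT y:{y. \<bar>y\<bar> \<ge> r}|lborel. \<bar>K y\<bar>)"
      unfolding set_lebesgue_integral_def by (intro Bochner_Integration.integral_nonneg) simp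
    then have "6 * B * (LINT y:{y. \<bar>y\<bar> \<ge> r}|lborel. \<bar>K y\<bar>) \<le> 6 * ((B + 1) * (e / (18 * (B + 1))))"
      unfolding mult.assoc using \<rho>(2)[OF that] \<open>0 \<le> B\<close> by (intro mult_left_mono mult_mono) auto
    also have "\<dots> = e / 3" unfolding divide_mult_cancel_Suc(2)[OF \<open>0 \<le> B\<close>] by simp
    finally show ?thesis .
  qed
  define \<eta> where "\<eta> = e / (6 * (L1_norm K + 1))"
  have \<eta>: "0 < \<eta>" using \<open>0 < e\<close> K0 by (simp add: \<eta>_def)
  have \<eta>K: "L1_norm K * \<eta> \<le> e / 6"
  proof -
    have "L1_norm K * \<eta> \<le> (L1_norm K + 1) * \<eta>" using \<eta> by (simp add: distrib_right)
    also have "\<dots> = e / 6" unfolding \<eta>_def by (rule divide_mult_cancel_Suc(2)[OF K0])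
    finally show ?thesis .
  qed
  \<comment> \<open>The points seen from \<open>A\<close> within distance \<rho>; uniform
    convergence is needed on this larger bounded set.\<close>
  define A' where "A' = {z \<in> UNIV \<times> {0..<T}. \<exists>x t y. (x, t) \<in> A \<and> \<bar>y\<bar> \<le> \<rho> \<and> z = (x - y, t)}"
  have "bounded A'"
  proof -
    obtain R where R: "\<And>z. z \<in> A \<Longrightarrow> norm z \<le> R" using A(2) bounded_iff by metis
    have "norm z \<le> R + \<rho>" if z: "z \<in> A'" for z
    proof -
      obtain x t y where y: "(x, t) \<in> A" "\<bar>y\<bar> \<le> \<rho>" "z = (x - y, t)" using z unfolding A'_def by blast
      have "norm ((x, t) - (y, 0)) \<le> norm (x, t) + norm (y, 0::real)" by (rule norm_triangle_ineq4)
      then show ?thesis using R[OF y(1)] y(2,3) by (simp add: norm_Pair)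
    qed
    then show ?thesis unfolding bounded_iff by blast
  qed
  moreover have "A' \<subseteq> UNIV \<times> {0..<T}" by (auto simp: A'_def)
  ultimately have ev1: "\<forall>\<^sub>F n in sequentially. \<forall>z\<in>A'. dist (w n z) (v z) < \<eta>"
    using wv \<eta> by (blast dest: uniform_limitD)
  have ev2: "\<forall>\<^sub>F n in sequentially. \<rho> \<le> P n"
    using P(2) unfolding filterlim_at_top by blast
  have "(\<lambda>n. 5 * L1_norm K * \<epsilon> n) \<longlonglongrightarrow> 5 * L1_norm K * 0" by (intro tendsto_intros \<epsilon>(1))
  then have ev3: "\<forall>\<^sub>F n in sequentially. 5 * L1_norm K * \<epsilon> n < e / 3"
    using \<open>0 < e\<close> by (intro order_tendstoD(2)) auto
  show "\<forall>\<^sub>F n in sequentially. \<forall>z\<in>A. dist (torus_conv (P n) (sigma K (P n) (M n)) (\<lambda>y. w n (y, snd z)) (fst z))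
     (LINT y|lborel. K (fst z - y) * v (y, snd z)) < e"
    using ev1 ev2 ev3
  proof eventually_elim
    case (elim n)
    show ?case
    proof
      fix z assume z: "z \<in> A"
      obtain x t where xt: "z = (x, t)" by (cases z)
      have t: "t \<in> {0..<T}" using z A(1) xt by auto
      let ?\<kappa> = "\<lambda>r. (LINT y:{y. \<bar>y\<bar> \<ge> r}|lborel. \<bar>K y\<bar>)"
      have near: "\<bar>w n (x - y, t) - v (x - y, t)\<bar> \<le> \<eta>" if "\<bar>y\<bar> \<le> \<rho>" for y
      proof -
        have "(x - y, t) \<in> A'" unfolding A'_def using z xt t that by blast
        then show ?thesis using elim(1) by (auto simp: dist_real_def less_imp_le)
      qed
      have a: "\<bar>torus_conv (P n) (sigma K (P n) (M n)) (\<lambda>y. w n (y, t)) x - (LINT y:{-P n..P n}|lborel. K y * w n (x - y, t))\<bar>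
          \<le> 5 * L1_norm K * \<epsilon> n + 4 * ?\<kappa> (P n) * B"
        by (rule torus_conv_sigma_approx[OF P(1) M K slice[OF t w(1)] w(2)[OF t] \<epsilon>(2)[OF t]])
      have b: "\<bar>(LINT y:{-P n..P n}|lborel. K y * w n (x - y, t)) - (LINT y|lborel. K y * v (x - y, t))\<bar>
          \<le> L1_norm K * \<eta> + 2 * B * ?\<kappa> \<rho>"
        by (rule torus_line_conv_diff[OF K slice[OF t w(1)] w(2)[OF t] slice[OF t v(1)] v(2)[OF t] elim(2) near less_imp_le[OF \<eta>]])
      have "6 * B * ?\<kappa> (P n) \<le> e / 3" "6 * B * ?\<kappa> \<rho> \<le> e / 3" using tail elim(2) by auto
      then have "4 * ?\<kappa> (P n) * B + 2 * B * ?\<kappa> \<rho> \<le> e / 3"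
        by (simp add: mult.commute mult.left_commute)
      then have "\<bar>torus_conv (P n) (sigma K (P n) (M n)) (\<lambda>y. w n (y, t)) x - (LINT y|lborel. K y * v (x - y, t))\<bar> < e"
        using a b \<eta>K elim(3) \<open>0 < e\<close> by linarith
      then show "dist (torus_conv (P n) (sigma K (P n) (M n)) (\<lambda>y. w n (y, snd z)) (fst z))
         (LINT y|lborel. K (fst z - y) * v (y, snd z)) < e"
        by (simp only: xt dist_real_def fst_conv snd_conv line_conv_flip[of K x "\<lambda>y. v (y, t)"])
    qed
  qed
qed

text \<open>Almost every time slice has \<open>L\<^sup>1\<close> norm at most \<open>q\<close>,
  because the modular density dominates. This is the source of the Lipschitz constant in
  time.\<close>

lemma modular_le_1_L1_slab:
  assumes g: "modular_le_1 T q g" and "0 < q" "0 < T" and ab: "0 < a" "a < b" "b < T"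
  shows "(LINT z|lborel. \<bar>g z\<bar> * indicator {a..b} (snd z)) \<le> q * (b - a)"
proof -
  have [measurable]: "g \<in> borel_measurable borel" using g by (rule modular_le_1_measurable)
  note I = modular_le_1_integrable[OF g \<open>0 < q\<close> \<open>0 < T\<close>]
  have i\<Phi>: "integrable lborel (\<lambda>z. \<Phi> (g z / q) * indicator {a..b} (snd z))"
    by (rule integrable_mult_bounded[OF I(1), of _ 1]) (auto split: split_indicator)
  have ig: "integrable lborel (\<lambda>z. \<bar>g z\<bar> * indicator {a..b} (snd z))"
    by (rule integrable_mult_bounded[OF integrable_abs[OF I(3)], of _ 1]) (auto split: split_indicator)
  have "ennreal (LINT z|lborel. \<Phi> (g z / q) * indicator {a..b} (snd z))
      = (\<integral>\<^sup>+z. ennreal (\<Phi> (g z / q) * indicator {a..b} (snd z)) \<partial>lborel)"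
    using i\<Phi> by (intro nn_integral_eq_integral[symmetric]) (auto simp: \<Phi>_nonneg)
  also have "\<dots> = (\<integral>\<^sup>+z. ennreal (\<Phi> (g z / q)) * indicator (UNIV \<times> {a..b}) z \<partial>lborel)"
    by (intro nn_integral_cong) (auto split: split_indicator)
  also have "\<dots> \<le> emeasure lborel {a..b}" using ab by (intro modular_le_1_slab[OF g]) auto
  also have "\<dots> = ennreal (b - a)" using ab by simp
  finally have le: "(LINT z|lborel. \<Phi> (g z / q) * indicator {a..b} (snd z)) \<le> b - a"
    using ab by simp
  have "(LINT z|lborel. \<bar>g z\<bar> * indicator {a..b} (snd z)) \<le> (LINT z|lborel. q * (\<Phi> (g z / q) * indicator {a..b} (snd z)))"
  proof (rule integral_mono[OF ig integrable_mult_right[OF i\<Phi>]])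
    fix z
    have "\<bar>g z\<bar> \<le> q * \<Phi> (g z / q)"
      using mult_left_mono[OF abs_le_\<Phi>[of "g z / q"], of q] \<open>0 < q\<close> by simp
    then show "\<bar>g z\<bar> * indicator {a..b} (snd z) \<le> q * (\<Phi> (g z / q) * indicator {a..b} (snd z))"
      by (simp split: split_indicator)
  qed
  also have "\<dots> = q * (LINT z|lborel. \<Phi> (g z / q) * indicator {a..b} (snd z))" by simp
  also have "\<dots> \<le> q * (b - a)" using le \<open>0 < q\<close> by (intro mult_left_mono) auto
  finally show ?thesis .
qed

lemma modular_le_1_Linf_LlogL:
  assumes g: "modular_le_1 T q g" and "0 < q"
  shows "g \<in> Linf_LlogL T UNIV"
proof -
  have [measurable]: "g \<in> borel_measurable borel" using g by (rule modular_le_1_measurable)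
  have [measurable]: "UNIV \<times> {0<..<T} \<in> sets (borel :: (real \<times> real) measure)"
    by (simp add: borel_prod[symmetric])
  have m: "set_borel_measurable lborel (UNIV \<times> {0<..<T}) g"
    unfolding set_borel_measurable_def by measurable
  have "Linf_LlogL_norm T UNIV g \<le> ennreal q"
    unfolding Linf_LlogL_norm_def
  proof (rule esssup_I)
    show "(\<lambda>t. LlogL_norm UNIV (\<lambda>x. g (x, t))) \<in> borel_measurable (restrict_space lborel {0<..<T})"
      using measurable_LlogL_norm[of g UNIV] by (intro measurable_restrict_space1) auto
    have "AE t in lborel. t \<in> {0<..<T} \<longrightarrow> (\<integral>\<^sup>+x. ennreal (\<Phi> (g (x, t) / q)) \<partial>lborel) \<le> 1"
      using g by (simp add: modular_le_1_def)
    then have "AE t in lborel. t \<in> {0<..<T} \<longrightarrow> LlogL_norm UNIV (\<lambda>x. g (x, t)) \<le> ennreal q"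
      by (rule eventually_mono) (auto intro!: LlogL_norm_leI \<open>0 < q\<close>)
    then show "AE t in restrict_space lborel {0<..<T}. LlogL_norm UNIV (\<lambda>x. g (x, t)) \<le> ennreal q"
      by (subst AE_restrict_space_iff) auto
  qed
  then have "Linf_LlogL_norm T UNIV g < \<infinity>" by (rule le_less_trans) simp
  with m show ?thesis by (simp add: Linf_LlogL_def)
qed

section \<open>Convergence of the scheme\<close>

lemma modulus_dist_small:
  assumes "0 \<le> C" "0 < e"
  obtains d where "0 < d"
    "\<And>z z' :: real \<times> real. dist z z' < d \<Longrightarrow> C * (log_modulus \<bar>fst z - fst z'\<bar> + log_modulus \<bar>snd z - snd z'\<bar>) < e"
    "\<And>h. 0 \<le> h \<Longrightarrow> h \<le> d \<Longrightarrow> C * log_modulus h < e"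
proof -
  have pos: "0 < e / (2 * (C + 1))" using assms by simp
  obtain d where d: "0 < d" "\<And>r. 0 \<le> r \<Longrightarrow> r \<le> d \<Longrightarrow> log_modulus r < e / (2 * (C + 1))"
    using log_modulus_small[OF pos] by blast
  have C1: "C * a < e / 2" if "0 \<le> a" "a < e / (2 * (C + 1))" for a
  proof -
    have "C * a \<le> (C + 1) * a" using that(1) by (simp add: distrib_right)
    also have "\<dots> < (C + 1) * (e / (2 * (C + 1)))" using that(2) assms(1) by (intro mult_strict_left_mono) auto
    also have "\<dots> = e / 2" by (rule divide_mult_cancel_Suc(2)[OF assms(1)])
    finally show ?thesis .
  qed
  have half: "C * log_modulus h < e / 2" if "0 \<le> h" "h \<le> d" for h
    using C1 log_modulus_nonneg[OF that(1)] d(2)[OF that] by blast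
  show thesis
  proof (rule that[OF d(1)])
    fix z z' :: "real \<times> real" assume "dist z z' < d"
    then have "dist (fst z) (fst z') < d" "dist (snd z) (snd z') < d"
      using dist_fst_le[of z z'] dist_snd_le[of z z'] by linarith+
    then have le: "\<bar>fst z - fst z'\<bar> \<le> d" "\<bar>snd z - snd z'\<bar> \<le> d" by (auto simp: dist_real_def)
    show "C * (log_modulus \<bar>fst z - fst z'\<bar> + log_modulus \<bar>snd z - snd z'\<bar>) < e"
      using half[OF abs_ge_zero le(1)] half[OF abs_ge_zero le(2)] unfolding distrib_left by linarith
  next
    show "C * log_modulus h < e" if "0 \<le> h" "h \<le> d" for h
      using half[OF that] assms(2) by simp
  qed
qed

text \<open>Fixes one constant for a whole family. It is preserved by pointwise limits, so both
  passages to the limit and the diagonal sequence share it.\<close>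

definition has_log_modulus :: "real \<Rightarrow> real \<Rightarrow> (real \<times> real \<Rightarrow> real) \<Rightarrow> bool" where
  "has_log_modulus T C f \<longleftrightarrow> (\<forall>x y. \<forall>s\<in>{0..<T}. \<forall>t\<in>{0..<T}.
     \<bar>f (x, s) - f (y, t)\<bar> \<le> C * (log_modulus \<bar>x - y\<bar> + log_modulus \<bar>s - t\<bar>))"

lemma has_log_modulusD:
  "has_log_modulus T C f \<Longrightarrow> s \<in> {0..<T} \<Longrightarrow> t \<in> {0..<T} \<Longrightarrow>
     \<bar>f (x, s) - f (y, t)\<bar> \<le> C * (log_modulus \<bar>x - y\<bar> + log_modulus \<bar>s - t\<bar>)"
  unfolding has_log_modulus_def by blast

lemma has_log_modulus_equicontinuous:
  assumes f: "\<And>n. has_log_modulus T C (f n)" and "0 \<le> C" "0 < e"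
  shows "\<exists>d>0. \<forall>n. \<forall>z\<in>UNIV \<times> {0..<T}. \<forall>z'\<in>UNIV \<times> {0..<T}. dist z z' < d \<longrightarrow> \<bar>f n z - f n z'\<bar> < e"
proof -
  obtain d where d: "0 < d"
    "\<And>z z' :: real \<times> real. dist z z' < d \<Longrightarrow> C * (log_modulus \<bar>fst z - fst z'\<bar> + log_modulus \<bar>snd z - snd z'\<bar>) < e"
    using modulus_dist_small[OF assms(2,3)] by metis
  have "\<bar>f n z - f n z'\<bar> < e" if "z \<in> UNIV \<times> {0..<T}" "z' \<in> UNIV \<times> {0..<T}" "dist z z' < d" for n z z'
  proof -
    have "\<bar>f n (fst z, snd z) - f n (fst z', snd z')\<bar> \<le> C * (log_modulus \<bar>fst z - fst z'\<bar> + log_modulus \<bar>snd z - snd z'\<bar>)"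
      using that by (intro has_log_modulusD[OF f]) (auto simp: mem_Times_iff)
    then show ?thesis using d(2)[OF that(3)] by simp
  qed
  then show ?thesis using d(1) by blast
qed

lemma has_log_modulus_continuous:
  assumes "has_log_modulus T C f" "0 \<le> C"
  shows "continuous_on (UNIV \<times> {0..<T}) f"
  unfolding continuous_on_iff dist_real_def
proof (intro ballI allI impI)
  fix z :: "real \<times> real" and e assume z: "z \<in> UNIV \<times> {0..<T}" and e: "(0 :: real) < e"
  obtain d where "0 < d" "\<forall>z\<in>UNIV \<times> {0..<T}. \<forall>z'\<in>UNIV \<times> {0..<T}. dist z z' < d \<longrightarrow> \<bar>f z - f z'\<bar> < e"
    using has_log_modulus_equicontinuous[of T C "\<lambda>_. f", OF assms e] by auto
  then show "\<exists>d>0. \<forall>z'\<in>UNIV \<times> {0..<T}. dist z' z < d \<longrightarrow> \<bar>f z' - f z\<bar> < e"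
    using z by (intro exI[of _ d]) blast
qed

lemma has_log_modulus_time:
  assumes f: "has_log_modulus T C f" "0 \<le> C" "0 < e"
  shows "\<exists>d>0. \<forall>x. \<forall>s\<in>{0..<T}. \<forall>t\<in>{0..<T}. \<bar>s - t\<bar> \<le> d \<longrightarrow> \<bar>f (x, s) - f (x, t)\<bar> \<le> e"
proof -
  obtain d where d: "0 < d" "\<And>h. 0 \<le> h \<Longrightarrow> h \<le> d \<Longrightarrow> C * log_modulus h < e"
    using modulus_dist_small[OF assms(2,3)] by metis
  have "\<bar>f (x, s) - f (x, t)\<bar> \<le> e" if "s \<in> {0..<T}" "t \<in> {0..<T}" "\<bar>s - t\<bar> \<le> d" for x s t
    using has_log_modulusD[OF f(1) that(1,2), of x x] d(2)[of "\<bar>s - t\<bar>"] that(3)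
    by (simp add: log_modulus_def[of 0])
  then show ?thesis using d(1) by blast
qed

lemma has_log_modulus_limit:
  assumes f: "\<And>n. has_log_modulus T C (f n)"
    and lim: "\<And>z. z \<in> UNIV \<times> {0..<T} \<Longrightarrow> (\<lambda>n. f n z) \<longlonglongrightarrow> g z"
  shows "has_log_modulus T C g"
  unfolding has_log_modulus_def
proof (intro allI ballI)
  fix x y s t assume st: "s \<in> {0..<T}" "t \<in> {0..<T}"
  have "(\<lambda>n. \<bar>f n (x, s) - f n (y, t)\<bar>) \<longlonglongrightarrow> \<bar>g (x, s) - g (y, t)\<bar>"
    using st by (intro tendsto_intros lim) auto
  then show "\<bar>g (x, s) - g (y, t)\<bar> \<le> C * (log_modulus \<bar>x - y\<bar> + log_modulus \<bar>s - t\<bar>)"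
    by (rule LIMSEQ_le_const2) (use has_log_modulusD[OF f st] in blast)
qed

lemma uniform_limit_pointwise:
  fixes f :: "nat \<Rightarrow> 'a::metric_space \<Rightarrow> real"
  assumes "\<And>A. A \<subseteq> S \<Longrightarrow> bounded A \<Longrightarrow> uniform_limit A f g sequentially" "z \<in> S"
  shows "(\<lambda>n. f n z) \<longlonglongrightarrow> g z"
  using tendsto_uniform_limitI[OF assms(1)[of "{z}"], of z] assms(2) by simp

text \<open>Ascoli gives uniform convergence on bounded sets. Each point reduces to the cell by a
  period, for the sequence and hence for its limit, which makes the convergence uniform in all
  \<open>x\<close>.\<close>

lemma torus_limit:
  assumes sol: "\<And>l. associated_solution T K v0 C P (M l) (u l)" and P: "P > 0" and T: "T > 0"
    and B0: "\<And>x. \<bar>v0 x\<bar> \<le> B0"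
  obtains sub :: "nat \<Rightarrow> nat" and U where "strict_mono sub"
    "uniform_limit (UNIV \<times> {0..<T}) (\<lambda>l. u (sub l)) U sequentially"
    "has_log_modulus T (6 * max C 0) U"
    "\<And>x t. t \<in> {0..<T} \<Longrightarrow> \<bar>U (x, t)\<bar> \<le> 2 * B0 + 6 * max C 0 * log_modulus T"
    "\<And>x. U (x, 0) = u_init v0 P x"
proof -
  let ?S = "UNIV \<times> {0..<T} :: (real \<times> real) set"
  let ?B = "2 * B0 + 6 * max C 0 * log_modulus T"
  have mod: "has_log_modulus T (6 * max C 0) (u l)" for l
    unfolding has_log_modulus_def using associated_solution_modulus[OF sol] by blast
  have bnd: "\<bar>u l (x, t)\<bar> \<le> ?B" if "t \<in> {0..<T}" for l x t
    by (rule associated_solution_bound[OF sol P that B0])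
  have per: "u l (x + 2 * P, t) = u l (x, t)" if "t \<in> {0..<T}" for l x t
    using sol[of l] that unfolding associated_solution_def Let_def by blast
  obtain sub :: "nat \<Rightarrow> nat" and U where sub: "strict_mono sub"
    and lim: "\<And>A. A \<subseteq> ?S \<Longrightarrow> bounded A \<Longrightarrow> uniform_limit A (\<lambda>l. u (sub l)) U sequentially"
  proof (rule uniformly_equicontinuous_subseq[of ?S u ?B])
    show "\<bar>u n z\<bar> \<le> ?B" if "z \<in> ?S" for n z using bnd[of "snd z" n "fst z"] that by (auto simp: mem_Times_iff)
    show "\<exists>d>0. \<forall>n. \<forall>z\<in>?S. \<forall>z'\<in>?S. dist z z' < d \<longrightarrow> \<bar>u n z - u n z'\<bar> < e" if "0 < e" for e
      using that by (intro has_log_modulus_equicontinuous[OF mod]) auto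
  qed (rule that)
  have pw: "(\<lambda>l. u (sub l) z) \<longlonglongrightarrow> U z" if "z \<in> ?S" for z
    by (rule uniform_limit_pointwise[OF lim that])
  define red where "red x = x + 2 * P * of_int (- \<lfloor>(x + P) / (2 * P)\<rfloor>)" for x
  have red: "red x \<in> {-P..P}" for x
    using cell_reduction[OF P, of x] by (simp add: red_def)
  have ured: "u l (x, t) = u l (red x, t)" if "t \<in> {0..<T}" for l x t
    unfolding red_def
    by (rule periodic_add_int[of "\<lambda>x. u l (x, t)" P, symmetric]) (rule per[OF that])
  have Ured: "U (x, t) = U (red x, t)" if "t \<in> {0..<T}" for x t
  proof (rule LIMSEQ_unique)
    show "(\<lambda>l. u (sub l) (x, t)) \<longlonglongrightarrow> U (x, t)" using that by (intro pw) auto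
    show "(\<lambda>l. u (sub l) (x, t)) \<longlonglongrightarrow> U (red x, t)"
      unfolding ured[OF that, of _ x] using that by (intro pw) auto
  qed
  have unif: "uniform_limit ?S (\<lambda>l. u (sub l)) U sequentially"
  proof (rule uniform_limitI)
    fix e :: real assume "0 < e"
    have sub1: "{-P..P} \<times> {0..<T} \<subseteq> ?S" by auto
    have b1: "bounded ({-P..P} \<times> {0..<T})" by (intro bounded_Times) auto
    have "\<forall>\<^sub>F l in sequentially. \<forall>z\<in>{-P..P} \<times> {0..<T}. dist (u (sub l) z) (U z) < e"
      by (rule uniform_limitD[OF lim[OF sub1 b1] \<open>0 < e\<close>])
    then show "\<forall>\<^sub>F l in sequentially. \<forall>z\<in>?S. dist (u (sub l) z) (U z) < e"
    proof (rule eventually_mono)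
      fix l assume l: "\<forall>z\<in>{-P..P} \<times> {0..<T}. dist (u (sub l) z) (U z) < e"
      show "\<forall>z\<in>?S. dist (u (sub l) z) (U z) < e"
      proof
        fix z :: "real \<times> real" assume "z \<in> ?S"
        then obtain x t where z: "z = (x, t)" "t \<in> {0..<T}" by auto
        have "dist (u (sub l) (red x, t)) (U (red x, t)) < e" using l red z(2) by blast
        then show "dist (u (sub l) z) (U z) < e" unfolding z(1) ured[OF z(2), of _ x] Ured[OF z(2), of x] .
      qed
    qed
  qed
  show thesis
  proof (rule that[OF sub unif])
    show "has_log_modulus T (6 * max C 0) U" by (rule has_log_modulus_limit[OF mod pw])
    show "\<bar>U (x, t)\<bar> \<le> ?B" if "t \<in> {0..<T}" for x t
    proof (rule LIMSEQ_le_const2)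
      show "(\<lambda>l. \<bar>u (sub l) (x, t)\<bar>) \<longlonglongrightarrow> \<bar>U (x, t)\<bar>" using that by (intro tendsto_intros pw) auto
    qed (use bnd[OF that] in blast)
    show "U (x, 0) = u_init v0 P x" for x
    proof (rule LIMSEQ_unique)
      show "(\<lambda>l. u (sub l) (x, 0)) \<longlonglongrightarrow> U (x, 0)" using T by (intro pw) auto
      have "u l (x, 0) = u_init v0 P x" for l
        using sol[of l] unfolding associated_solution_def Let_def by blast
      then show "(\<lambda>l. u (sub l) (x, 0)) \<longlonglongrightarrow> u_init v0 P x" by simp
    qed
  qed
qed

lemma fejer_log_modulus_approximation:
  assumes f: "has_log_modulus T C f" "0 \<le> C" and t: "t \<in> {0..<T}" and P: "0 < P" and m: "0 < m"
    and \<delta>: "0 < \<delta>" "\<delta> \<le> P" and per: "\<And>x. f (x + 2 * P, t) = f (x, t)" and B: "\<And>x. \<bar>f (x, t)\<bar> \<le> B"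
  shows "\<bar>1 / (2 * P) * torus_conv P (fejer P m) (\<lambda>y. f (y, t)) X - f (X, t)\<bar>
    \<le> C * log_modulus \<delta> + 4 * B / (real m * (1 - cos (pi * \<delta> / P)))"
proof (rule fejer_approximation[where u = "\<lambda>y. f (y, t)", OF P m \<delta> _ per B])
  show "continuous_on UNIV (\<lambda>y. f (y, t))"
    by (rule continuous_on_compose2[OF has_log_modulus_continuous[OF f]]) (use t in \<open>auto intro!: continuous_intros\<close>)
  fix x y :: real assume xy: "\<bar>x - y\<bar> \<le> \<delta>"
  have "\<bar>f (x, t) - f (y, t)\<bar> \<le> C * (log_modulus \<bar>x - y\<bar> + log_modulus \<bar>t - t\<bar>)"
    by (rule has_log_modulusD[OF f(1) t t])
  also have "\<dots> \<le> C * log_modulus \<delta>"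
    using xy f(2) by (intro mult_left_mono) (auto simp: log_modulus_def[of 0] intro: log_modulus_mono)
  finally show "\<bar>f (x, t) - f (y, t)\<bar> \<le> C * log_modulus \<delta>" .
qed

lemma distr_deriv_line:
  fixes f g :: "real \<times> real \<Rightarrow> real"
  assumes eq: "\<And>\<phi>. \<phi> \<in> test_functions (UNIV \<times> {0<..<T}) \<Longrightarrow> integrable lborel (\<lambda>z. g z * \<phi> z) \<and>
    (LINT z|lborel. f z * frechet_derivative \<phi> (at z) e) = - (LINT z|lborel. g z * \<phi> z)"
  shows "distr_deriv (test_functions (UNIV \<times> {0<..<T})) (UNIV \<times> {0<..<T}) e f g"
  unfolding distr_deriv_def
proof
  fix \<phi> :: "real \<times> real \<Rightarrow> real" assume \<phi>: "\<phi> \<in> test_functions (UNIV \<times> {0<..<T})"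
  obtain C where C: "C \<subseteq> UNIV \<times> {0<..<T}" "\<forall>z. \<phi> z \<noteq> 0 \<longrightarrow> z \<in> C"
    "\<forall>z. frechet_derivative \<phi> (at z) e \<noteq> 0 \<longrightarrow> z \<in> C"
  proof (rule test_function_facts[OF \<phi>])
    fix C and B R :: real assume C: "C \<subseteq> UNIV \<times> {0<..<T}" "\<forall>z. \<phi> z \<noteq> 0 \<longrightarrow> z \<in> C"
      and d: "\<And>e. \<forall>z. frechet_derivative \<phi> (at z) e \<noteq> 0 \<longrightarrow> z \<in> C"
    show thesis by (rule that[OF C d])
  qed
  have a: "indicator (UNIV \<times> {0<..<T}) z *\<^sub>R (g z * \<phi> z) = g z * \<phi> z" for z
  proof (rule indicator_scaleR_support)
    assume "g z * \<phi> z \<noteq> 0"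
    then have "\<phi> z \<noteq> 0" by simp
    then show "z \<in> UNIV \<times> {0<..<T}" using C(1,2) by blast
  qed
  have b: "indicator (UNIV \<times> {0<..<T}) z *\<^sub>R (f z * frechet_derivative \<phi> (at z) e) = f z * frechet_derivative \<phi> (at z) e" for z
  proof (rule indicator_scaleR_support)
    assume "f z * frechet_derivative \<phi> (at z) e \<noteq> 0"
    then have "frechet_derivative \<phi> (at z) e \<noteq> 0" by simp
    then show "z \<in> UNIV \<times> {0<..<T}" using C(1,3) by blast
  qed
  show "set_integrable lborel (UNIV \<times> {0<..<T}) (\<lambda>z. g z * \<phi> z) \<and>
      (LINT z:UNIV \<times> {0<..<T}|lborel. f z * frechet_derivative \<phi> (at z) e) = - (LINT z:UNIV \<times> {0<..<T}|lborel. g z * \<phi> z)"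
    using eq[OF \<phi>] unfolding set_integrable_def set_lebesgue_integral_def a b .
qed

lemma Linf_norm_continuous_bounded:
  fixes v :: "'a::euclidean_space \<Rightarrow> real"
  assumes "continuous_on S v" "S \<in> sets borel" "\<And>z. z \<in> S \<Longrightarrow> \<bar>v z\<bar> \<le> B"
  shows "Linf_norm S v < \<infinity>"
proof -
  have "v \<in> borel_measurable (restrict_space borel S)"
    by (rule borel_measurable_continuous_on_restrict[OF assms(1)])
  then have [measurable]: "v \<in> borel_measurable (restrict_space lborel S)"
    by (simp cong: measurable_cong_sets sets_restrict_space_cong)
  have "Linf_norm S v \<le> ennreal B"
    unfolding Linf_norm_def
  proof (rule esssup_I)
    show "AE z in restrict_space lborel S. ennreal \<bar>v z\<bar> \<le> ennreal B"
      using assms(3) by (intro AE_I2) (auto simp: space_restrict_space intro: ennreal_leI)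
  qed measurable
  then show ?thesis by (rule le_less_trans) simp
qed

theorem proposition1:
  fixes T C_GE :: real
    and v0 K :: "real \<Rightarrow> real"
    and M :: "nat \<Rightarrow> nat"
    and P :: "nat \<Rightarrow> real"
    and u :: "nat \<Rightarrow> nat \<Rightarrow> real \<times> real \<Rightarrow> real"
  assumes T: "T > 0"
    and v0_cont: "continuous_on UNIV v0"
    and v0_mono: "mono v0"
    and v0_bounded: "Linf_norm UNIV v0 < \<infinity>"
    and v0_deriv: "\<exists>g. distr_deriv (test_functions UNIV) UNIV 1 v0 g \<and>
                       integrable lborel g \<and> g \<in> LlogL UNIV"
    and K_L1: "integrable lborel K"
    and K_even: "\<And>x. K (- x) = K x"
    and K_mean: "(LINT x|lborel. K x) = 0"
    and K_fourier: "\<And>\<xi>. \<xi> \<noteq> 0 \<Longrightarrow> fourier K \<xi> \<in> \<real>\<^sub>\<le>\<^sub>0"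
    and M_pos: "\<And>l. M l > 0"
    and M_lim: "filterlim M at_top sequentially"
    and P_0: "P 0 \<ge> 1"
    and P_mono: "incseq P"
    and P_lim: "filterlim P at_top sequentially"
    and u_sol: "\<And>k l. associated_solution T K v0 C_GE (P k) (M l) (u k l)"
  shows "\<exists>v :: real \<times> real \<Rightarrow> real.
    continuous_on (UNIV \<times> {0..<T}) v \<and>
    Linf_norm (UNIV \<times> {0<..<T}) v < \<infinity> \<and>
    (\<lambda>(x, t). v (x, t) - v0 x) \<in> C_LlogL T UNIV \<and>
    (\<exists>(sub :: nat \<Rightarrow> nat \<Rightarrow> nat) (U :: nat \<Rightarrow> real \<times> real \<Rightarrow> real) (sub' :: nat \<Rightarrow> nat).
       (\<forall>k. strict_mono (sub k) \<and>
            uniform_limit (UNIV \<times> {0..<T}) (\<lambda>l. u k (sub k l)) (U k) sequentially) \<and>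
       strict_mono sub' \<and>
       (\<forall>S. compact S \<and> S \<subseteq> UNIV \<times> {0<..<T} \<longrightarrow>
            uniform_limit S (\<lambda>k. U (sub' k)) v sequentially)) \<and>
    (\<exists>vx. vx \<in> Linf_LlogL T UNIV \<and>
       distr_deriv (test_functions (UNIV \<times> {0<..<T})) (UNIV \<times> {0<..<T}) (1, 0) v vx \<and>
       distr_deriv (test_functions (UNIV \<times> {0<..<T})) (UNIV \<times> {0<..<T}) (0, 1) v
         (\<lambda>(x, t). (LINT z|lborel. K (x - z) * v (z, t)) * vx (x, t))) \<and>
    (\<forall>x. v (x, 0) = v0 x)"
proof -

  \<comment> \<open>Bounds uniform in both indices\<close>
  let ?S = "UNIV \<times> {0..<T} :: (real \<times> real) set"
  obtain B0 where B0: "0 \<le> B0" "\<And>x. \<bar>v0 x\<bar> \<le> B0"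
    using mono_essentially_bounded[OF v0_mono v0_bounded] by blast
  define C where "C = 6 * max C_GE 0"
  have C: "0 \<le> C" by (simp add: C_def)
  define B where "B = 2 * B0 + C * log_modulus T"
  have B: "0 \<le> B" using B0(1) C log_modulus_nonneg[of T] T by (simp add: B_def)
  \<comment> \<open>The scale at which \<open>associated_solution_line\<close> supplies the modular
    bound.\<close>
  define q where "q = max C_GE 0 + 1"
  have q: "0 < q" by (simp add: q_def add_nonneg_pos)
  have P1: "1 \<le> P k" for k using P_0 incseqD[OF P_mono, of 0 k] by simp
  have P_pos: "0 < P k" for k using P1[of k] by simp
  have u_mod: "has_log_modulus T C (u k l)" for k l
    unfolding has_log_modulus_def C_def using associated_solution_modulus[OF u_sol] by blast
  have u_bnd: "\<bar>u k l (x, t)\<bar> \<le> B" if "t \<in> {0..<T}" for k l x t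
    using associated_solution_bound[where ?v0.0 = v0, OF u_sol P_pos that B0(2)] by (simp add: B_def C_def)
  have u_per: "u k l (x + 2 * P k, t) = u k l (x, t)" if "t \<in> {0..<T}" for k l x t
    using u_sol[of k l] that unfolding associated_solution_def Let_def by blast

  \<comment> \<open>The limit in \<open>l\<close> for each \<open>k\<close>\<close>
  have "\<exists>sub U. strict_mono (sub :: nat \<Rightarrow> nat) \<and> uniform_limit ?S (\<lambda>l. u k (sub l)) U sequentially \<and>
      has_log_modulus T C U \<and> (\<forall>x. \<forall>t\<in>{0..<T}. \<bar>U (x, t)\<bar> \<le> B) \<and> (\<forall>x. U (x, 0) = u_init v0 (P k) x)" for k
  proof (rule torus_limit[of T K v0 C_GE "P k" M "u k" B0, OF u_sol P_pos T B0(2)])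
    fix sub :: "nat \<Rightarrow> nat" and U
    assume "strict_mono sub" "uniform_limit ?S (\<lambda>l. u k (sub l)) U sequentially"
      "has_log_modulus T (6 * max C_GE 0) U"
      "\<And>x t. t \<in> {0..<T} \<Longrightarrow> \<bar>U (x, t)\<bar> \<le> 2 * B0 + 6 * max C_GE 0 * log_modulus T"
      "\<And>x. U (x, 0) = u_init v0 (P k) x"
    then show ?thesis unfolding C_def B_def by blast
  qed
  then obtain sub :: "nat \<Rightarrow> nat \<Rightarrow> nat" and U where sub: "\<And>k. strict_mono (sub k)"
    and U: "\<And>k. uniform_limit ?S (\<lambda>l. u k (sub k l)) (U k) sequentially"
    and U_mod: "\<And>k. has_log_modulus T C (U k)"
    and U_bnd: "\<And>k x t. t \<in> {0..<T} \<Longrightarrow> \<bar>U k (x, t)\<bar> \<le> B"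
    and U_init: "\<And>k x. U k (x, 0) = u_init v0 (P k) x"
    by metis

  \<comment> \<open>The limit in \<open>k\<close>\<close>
  obtain sub' :: "nat \<Rightarrow> nat" and v where sub': "strict_mono sub'"
    and Uv: "\<And>A. A \<subseteq> ?S \<Longrightarrow> bounded A \<Longrightarrow> uniform_limit A (\<lambda>n. U (sub' n)) v sequentially"
  proof (rule uniformly_equicontinuous_subseq[of ?S U B])
    show "\<bar>U n z\<bar> \<le> B" if "z \<in> ?S" for n z using U_bnd[of "snd z" n "fst z"] that by (auto simp: mem_Times_iff)
    show "\<exists>d>0. \<forall>n. \<forall>z\<in>?S. \<forall>z'\<in>?S. dist z z' < d \<longrightarrow> \<bar>U n z - U n z'\<bar> < e" if "0 < e" for e
      by (rule has_log_modulus_equicontinuous[OF U_mod C that])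
  qed (rule that)
  have pw: "(\<lambda>n. U (sub' n) z) \<longlonglongrightarrow> v z" if "z \<in> ?S" for z
    by (rule uniform_limit_pointwise[OF Uv that])
  have v_mod: "has_log_modulus T C v" by (rule has_log_modulus_limit[OF U_mod pw])
  have v_cont: "continuous_on ?S v" by (rule has_log_modulus_continuous[OF v_mod C])
  have v_bnd: "\<bar>v (x, t)\<bar> \<le> B" if "t \<in> {0..<T}" for x t
  proof (rule LIMSEQ_le_const2)
    show "(\<lambda>n. \<bar>U (sub' n) (x, t)\<bar>) \<longlonglongrightarrow> \<bar>v (x, t)\<bar>" using that by (intro tendsto_intros pw) auto
  qed (use U_bnd[OF that] in blast)

  \<comment> \<open>Half-periods, mean slopes and the initial value\<close>
  define p where "p n = P (sub' n)" for n
  have p: "0 < p n" "1 \<le> p n" for n using P1 P_pos by (auto simp: p_def)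
  have p_lim: "filterlim p at_top sequentially"
    unfolding p_def using filterlim_compose[OF P_lim filterlim_subseq[OF sub']] .
  define L where "L n = mean_slope v0 (p n)" for n
  have L_lim: "L \<longlonglongrightarrow> 0"
  proof (rule Lim_null_comparison)
    show "\<forall>\<^sub>F n in sequentially. norm (L n) \<le> B0 / p n"
      using mean_slope_bound[where ?v0.0 = v0, OF B0(2) p(1)] by (simp add: L_def)
    show "(\<lambda>n. B0 / p n) \<longlonglongrightarrow> 0"
      by (rule tendsto_divide_0[OF tendsto_const filterlim_at_top_imp_at_infinity[OF p_lim]])
  qed
  have v_init: "v (x, 0) = v0 x" for x
  proof (rule LIMSEQ_unique)
    show "(\<lambda>n. U (sub' n) (x, 0)) \<longlonglongrightarrow> v (x, 0)" using T by (intro pw) auto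
    \<comment> \<open>A fixed \<open>x\<close> eventually lies in the open cell, where the periodic
      datum differs from \<open>v0\<close> only by the linear term, whose slope tends to 0.\<close>
    have "\<forall>\<^sub>F n in sequentially. \<bar>x\<bar> < p n"
      using p_lim unfolding filterlim_at_top_dense by blast
    then have ev: "\<forall>\<^sub>F n in sequentially. v0 x - L n * x = U (sub' n) (x, 0)"
      by (rule eventually_mono) (simp add: U_init p_def L_def u_init_cell)
    have "(\<lambda>n. v0 x - L n * x) \<longlonglongrightarrow> v0 x - 0 * x"
      by (intro tendsto_intros L_lim)
    from Lim_transform_eventually[OF this ev] show "(\<lambda>n. U (sub' n) (x, 0)) \<longlonglongrightarrow> v0 x"
      by simp
  qed

  \<comment> \<open>The diagonal sequence\<close>
  define \<delta> where "\<delta> n = 1 / real (Suc n)" for n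
  \<comment> \<open>The bound by 1 keeps \<delta> below the half-period \<open>p n\<close>, so the
    angle \<open>pi * \<delta> n / p n\<close> lies in (0,pi] and its cosine is below 1.\<close>
  have \<delta>: "0 < \<delta> n" "\<delta> n \<le> 1" for n by (auto simp: \<delta>_def)
  have \<delta>_lim: "\<delta> \<longlonglongrightarrow> 0" unfolding \<delta>_def by (rule LIMSEQ_Suc[OF lim_1_over_n])
  \<comment> \<open>Once \<open>n\<close> is fixed so is the cosine, and only \<open>M\<close> grows
    with \<open>l\<close>; both conditions therefore hold for all large \<open>l\<close>.\<close>
  have "\<exists>l. (\<forall>z\<in>?S. \<bar>u (sub' n) (sub (sub' n) l) z - U (sub' n) z\<bar> < \<delta> n) \<and>
      4 * B / (real (M (sub (sub' n) l)) * (1 - cos (pi * \<delta> n / p n))) < \<delta> n" for n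
  proof -
    define a where "a = 1 - cos (pi * \<delta> n / p n)"
    have "cos (pi * \<delta> n / p n) < cos 0"
      using \<delta>[of n] p[of n] by (intro cos_monotone_0_pi) (auto simp: divide_le_eq)
    then have "0 < a" by (simp add: a_def)
    have "\<forall>\<^sub>F l in sequentially. \<forall>z\<in>?S. dist (u (sub' n) (sub (sub' n) l) z) (U (sub' n) z) < \<delta> n"
      by (rule uniform_limitD[OF U \<delta>(1)])
    moreover have "\<forall>\<^sub>F l in sequentially. 4 * B / (real (M (sub (sub' n) l)) * a) < \<delta> n"
    proof -
      have f1: "filterlim (\<lambda>l. real (M (sub (sub' n) l))) at_top sequentially"
        by (intro filterlim_compose[OF filterlim_real_sequentially] filterlim_compose[OF M_lim] filterlim_subseq sub)
      have "filterlim (\<lambda>l. real (M (sub (sub' n) l)) * a) at_top sequentially"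
        using \<open>0 < a\<close> by (intro filterlim_at_top_mult_tendsto_pos[OF tendsto_const _ f1])
      then have "(\<lambda>l. 4 * B / (real (M (sub (sub' n) l)) * a)) \<longlonglongrightarrow> 0"
        by (intro tendsto_divide_0[OF tendsto_const] filterlim_at_top_imp_at_infinity)
      then show ?thesis using \<delta>(1) by (rule order_tendstoD)
    qed
    ultimately have "\<forall>\<^sub>F l in sequentially. (\<forall>z\<in>?S. dist (u (sub' n) (sub (sub' n) l) z) (U (sub' n) z) < \<delta> n) \<and>
        4 * B / (real (M (sub (sub' n) l)) * a) < \<delta> n"
      by (rule eventually_conj)
    then show ?thesis
      unfolding a_def dist_real_def using eventually_happens'[OF sequentially_bot] by blast
  qed
  then obtain l where l: "\<And>n z. z \<in> ?S \<Longrightarrow> \<bar>u (sub' n) (sub (sub' n) (l n)) z - U (sub' n) z\<bar> < \<delta> n"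
    "\<And>n. 4 * B / (real (M (sub (sub' n) (l n))) * (1 - cos (pi * \<delta> n / p n))) < \<delta> n"
    by metis
  define w where "w n = u (sub' n) (sub (sub' n) (l n))" for n
  define m where "m n = M (sub (sub' n) (l n))" for n
  have w_sol: "associated_solution T K v0 C_GE (p n) (m n) (w n)" for n
    unfolding w_def m_def p_def by (rule u_sol)
  have w_mod: "has_log_modulus T C (w n)" for n unfolding w_def by (rule u_mod)
  have w_bnd: "\<bar>w n (x, t)\<bar> \<le> B" if "t \<in> {0..<T}" for n x t unfolding w_def by (rule u_bnd[OF that])
  have w_cont: "continuous_on ?S (w n)" for n by (rule has_log_modulus_continuous[OF w_mod C])
  have wv: "uniform_limit A w v sequentially" if A: "A \<subseteq> ?S" "bounded A" for A
  proof (rule uniform_limitI)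
    fix e :: real assume "0 < e"
    have "\<forall>\<^sub>F n in sequentially. \<forall>z\<in>A. dist (U (sub' n) z) (v z) < e / 2"
      using \<open>0 < e\<close> by (intro uniform_limitD[OF Uv[OF A]]) simp
    moreover have "\<forall>\<^sub>F n in sequentially. \<delta> n < e / 2"
      using \<open>0 < e\<close> by (intro order_tendstoD(2)[OF \<delta>_lim]) simp
    ultimately show "\<forall>\<^sub>F n in sequentially. \<forall>z\<in>A. dist (w n z) (v z) < e"
    proof eventually_elim
      case (elim n)
      show ?case
      proof
        fix z assume z: "z \<in> A"
        have "\<bar>w n z - U (sub' n) z\<bar> < \<delta> n" unfolding w_def using z A(1) by (intro l(1)) blast
        moreover have "\<bar>U (sub' n) z - v z\<bar> < e / 2" using elim(1) z by (simp add: dist_real_def)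
        ultimately show "dist (w n z) (v z) < e" using elim(2) unfolding dist_real_def by linarith
      qed
    qed
  qed

  \<comment> \<open>Convergence of the Fejer means\<close>
  define \<epsilon> where "\<epsilon> n = C * log_modulus (\<delta> n) + \<delta> n" for n
  have \<epsilon>_lim: "\<epsilon> \<longlonglongrightarrow> 0"
  proof -
    have "(\<lambda>n. C * log_modulus (\<delta> n)) \<longlonglongrightarrow> 0"
    proof (rule LIMSEQ_I)
      fix e :: real assume e: "0 < e"
      obtain d where d: "0 < d" "\<And>h. 0 \<le> h \<Longrightarrow> h \<le> d \<Longrightarrow> C * log_modulus h < e"
      proof (rule modulus_dist_small[OF C e])
        fix d assume d: "0 < d" and h: "\<And>h. 0 \<le> h \<Longrightarrow> h \<le> d \<Longrightarrow> C * log_modulus h < e"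
        show thesis by (rule that[OF d h])
      qed
      obtain n0 where "\<And>n. n0 \<le> n \<Longrightarrow> \<delta> n < d"
        using order_tendstoD(2)[OF \<delta>_lim d(1)] by (auto simp: eventually_sequentially)
      then have "norm (C * log_modulus (\<delta> n) - 0) < e" if "n0 \<le> n" for n
        using d(2)[of "\<delta> n"] \<delta>(1)[of n] that C log_modulus_nonneg[of "\<delta> n"] by (simp add: less_imp_le)
      then show "\<exists>n0. \<forall>n\<ge>n0. norm (C * log_modulus (\<delta> n) - 0) < e" by blast
    qed
    then have "(\<lambda>n. C * log_modulus (\<delta> n) + \<delta> n) \<longlonglongrightarrow> 0 + 0" using \<delta>_lim by (rule tendsto_add)
    then show ?thesis by (simp add: \<epsilon>_def[abs_def])
  qed
  have fejer: "\<bar>1 / (2 * p n) * torus_conv (p n) (fejer (p n) (m n)) (\<lambda>y. w n (y, t)) X - w n (X, t)\<bar> \<le> \<epsilon> n"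
    if t: "t \<in> {0..<T}" for n X t
  proof -
    have "\<bar>1 / (2 * p n) * torus_conv (p n) (fejer (p n) (m n)) (\<lambda>y. w n (y, t)) X - w n (X, t)\<bar>
        \<le> C * log_modulus (\<delta> n) + 4 * B / (real (m n) * (1 - cos (pi * \<delta> n / p n)))"
    proof (rule fejer_log_modulus_approximation[OF w_mod C t p(1)])
      show "0 < m n" unfolding m_def by (rule M_pos)
      show "\<delta> n \<le> p n" using \<delta>(2)[of n] p(2)[of n] by simp
      show "w n (x + 2 * p n, t) = w n (x, t)" for x unfolding w_def p_def by (rule u_per[OF t])
    qed (use \<delta>(1) w_bnd[OF t] in auto)
    then show ?thesis using l(2)[of n] unfolding m_def \<epsilon>_def by linarith
  qed

  \<comment> \<open>Convergence, continuity and size of the velocities\<close>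
  define c where "c n z = torus_conv (p n) (sigma K (p n) (m n)) (\<lambda>y. w n (y, snd z)) (fst z)" for n z
  define k where "k z = (LINT y|lborel. K (fst z - y) * v (y, snd z))" for z
  have ck: "uniform_limit A c k sequentially" if A: "A \<subseteq> ?S" "bounded A" for A
    unfolding c_def[abs_def] k_def[abs_def]
    by (rule uniform_limit_velocity[OF K_L1 p(1) p_lim _ w_cont w_bnd v_cont v_bnd B wv \<epsilon>_lim fejer A])
      (simp_all add: m_def M_pos)
  have k_cont: "continuous_on ?S k"
    unfolding k_def[abs_def] by (rule continuous_line_conv[OF K_L1 v_cont v_bnd])
  have k_bnd: "\<bar>k z\<bar> \<le> L1_norm K * B" if "z \<in> ?S" for z
    unfolding k_def
  proof (rule line_conv_bound[OF K_L1])
    show "continuous_on UNIV (\<lambda>y. v (y, snd z))"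
      by (rule continuous_on_compose2[OF v_cont]) (use that in \<open>auto intro!: continuous_intros simp: mem_Times_iff\<close>)
    show "\<bar>v (x, snd z)\<bar> \<le> B" for x using v_bnd that by (auto simp: mem_Times_iff)
  qed

  \<comment> \<open>Equations along the diagonal sequence\<close>
  define eqs where "eqs n g \<phi> \<longleftrightarrow>
        (LINT z|lborel. w n z * frechet_derivative \<phi> (at z) (1, 0)) = - (LINT z|lborel. g z * \<phi> z) \<and>
        integrable lborel (\<lambda>z. c n z * (g z + L n) * \<phi> z) \<and>
        (LINT z|lborel. w n z * frechet_derivative \<phi> (at z) (0, 1)) = - (LINT z|lborel. c n z * (g z + L n) * \<phi> z)"
    for n g and \<phi> :: "real \<times> real \<Rightarrow> real"
  have "\<exists>f. modular_le_1 T q f \<and>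
      (\<forall>\<phi> R. \<phi> \<in> test_functions (UNIV \<times> {0<..<T}) \<longrightarrow> (\<forall>x t. \<phi> (x, t) \<noteq> 0 \<longrightarrow> \<bar>x\<bar> \<le> R) \<longrightarrow> R < p n \<longrightarrow> eqs n f \<phi>)" for n
  proof (rule associated_solution_line[OF w_sol p(1) T])
    fix f assume f: "f \<in> borel_measurable borel"
      "\<And>z. z \<notin> {- p n..p n} \<times> {0<..<T} \<Longrightarrow> f z = 0"
      "AE t in lborel. t \<in> {0<..<T} \<longrightarrow> (\<integral>\<^sup>+x. ennreal (\<Phi> (f (x, t) / (max C_GE 0 + 1))) \<partial>lborel) \<le> 1"
      "\<And>\<phi> R. \<phi> \<in> test_functions (UNIV \<times> {0<..<T}) \<Longrightarrow> \<forall>x t. \<phi> (x, t) \<noteq> 0 \<longrightarrow> \<bar>x\<bar> \<le> R \<Longrightarrow> R < p n \<Longrightarrow>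
         integrable lborel (\<lambda>z. f z * \<phi> z) \<and>
         (LINT z|lborel. w n z * frechet_derivative \<phi> (at z) (1, 0)) = - (LINT z|lborel. f z * \<phi> z)"
      "\<And>\<phi> R. \<phi> \<in> test_functions (UNIV \<times> {0<..<T}) \<Longrightarrow> \<forall>x t. \<phi> (x, t) \<noteq> 0 \<longrightarrow> \<bar>x\<bar> \<le> R \<Longrightarrow> R < p n \<Longrightarrow>
         integrable lborel (\<lambda>z. torus_conv (p n) (sigma K (p n) (m n)) (\<lambda>y. w n (y, snd z)) (fst z) * (f z + mean_slope v0 (p n)) * \<phi> z) \<and>
         (LINT z|lborel. w n z * frechet_derivative \<phi> (at z) (0, 1)) =
           - (LINT z|lborel. torus_conv (p n) (sigma K (p n) (m n)) (\<lambda>y. w n (y, snd z)) (fst z) * (f z + mean_slope v0 (p n)) * \<phi> z)"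
    have "modular_le_1 T q f"
      unfolding modular_le_1_def q_def using f(1,3) by (auto intro!: f(2))
    then show ?thesis
      unfolding eqs_def c_def L_def using f(4,5) by (intro exI[of _ f] conjI allI impI) blast+
  qed
  then obtain f where f: "\<And>n. modular_le_1 T q (f n)"
    and f_eq: "\<And>n \<phi> R. \<phi> \<in> test_functions (UNIV \<times> {0<..<T}) \<Longrightarrow> \<forall>x t. \<phi> (x, t) \<noteq> 0 \<longrightarrow> \<bar>x\<bar> \<le> R \<Longrightarrow> R < p n \<Longrightarrow> eqs n (f n) \<phi>"
    by metis
  \<comment> \<open>The half-periods tend to infinity, so the support of \<phi> fits into one cell
    from some index on.\<close>
  have ev: "\<forall>\<^sub>F n in sequentially. eqs n (f n) \<phi>" if \<phi>: "\<phi> \<in> test_functions (UNIV \<times> {0<..<T})" for \<phi>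
  proof -
    obtain R where R: "\<forall>x t. \<phi> (x, t) \<noteq> 0 \<longrightarrow> \<bar>x\<bar> \<le> R"
    proof (rule test_function_facts[OF \<phi>])
      fix C and B R :: real assume "\<forall>x t. \<phi> (x, t) \<noteq> 0 \<longrightarrow> \<bar>x\<bar> \<le> R"
      then show thesis by (rule that)
    qed
    have "\<forall>\<^sub>F n in sequentially. R < p n" using p_lim unfolding filterlim_at_top_dense by blast
    then show ?thesis by (rule eventually_mono) (rule f_eq[OF \<phi> R])
  qed

  \<comment> \<open>The equation for the limit\<close>
  obtain vx where vx: "modular_le_1 T q vx"
    and vx_x: "\<And>\<phi>. \<phi> \<in> test_functions (UNIV \<times> {0<..<T}) \<Longrightarrow> integrable lborel (\<lambda>z. vx z * \<phi> z) \<and>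
       (LINT z|lborel. v z * frechet_derivative \<phi> (at z) (1, 0)) = - (LINT z|lborel. vx z * \<phi> z)"
    and vx_t: "\<And>\<phi>. \<phi> \<in> test_functions (UNIV \<times> {0<..<T}) \<Longrightarrow> integrable lborel (\<lambda>z. k z * vx z * \<phi> z) \<and>
       (LINT z|lborel. v z * frechet_derivative \<phi> (at z) (0, 1)) = - (LINT z|lborel. k z * vx z * \<phi> z)"
  proof (rule limit_equation[where w = w and c = c and k = k, OF T q f w_cont v_cont k_cont _ _ L_lim])
    show "uniform_limit A w v sequentially" if "A \<subseteq> ?S" "bounded A" for A using that by (rule wv)
    show "uniform_limit A c k sequentially" if "A \<subseteq> ?S" "bounded A" for A using that by (rule ck)
    show "\<forall>\<^sub>F n in sequentially.
       (LINT z|lborel. w n z * frechet_derivative \<phi> (at z) (1, 0)) = - (LINT z|lborel. f n z * \<phi> z)"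
      if "\<phi> \<in> test_functions (UNIV \<times> {0<..<T})" for \<phi>
      using ev[OF that] unfolding eqs_def by (rule eventually_mono) blast
    show "\<forall>\<^sub>F n in sequentially.
       integrable lborel (\<lambda>z. c n z * (f n z + L n) * \<phi> z) \<and>
       (LINT z|lborel. w n z * frechet_derivative \<phi> (at z) (0, 1)) = - (LINT z|lborel. c n z * (f n z + L n) * \<phi> z)"
      if "\<phi> \<in> test_functions (UNIV \<times> {0<..<T})" for \<phi>
      using ev[OF that] unfolding eqs_def by (rule eventually_mono) blast
    fix g assume "modular_le_1 T q g"
      "\<And>\<phi>. \<phi> \<in> test_functions (UNIV \<times> {0<..<T}) \<Longrightarrow> integrable lborel (\<lambda>z. g z * \<phi> z) \<and>
         (LINT z|lborel. v z * frechet_derivative \<phi> (at z) (1, 0)) = - (LINT z|lborel. g z * \<phi> z)"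
      "\<And>\<phi>. \<phi> \<in> test_functions (UNIV \<times> {0<..<T}) \<Longrightarrow> integrable lborel (\<lambda>z. k z * g z * \<phi> z) \<and>
         (LINT z|lborel. v z * frechet_derivative \<phi> (at z) (0, 1)) = - (LINT z|lborel. k z * g z * \<phi> z)"
    then show thesis by (rule that)
  qed

  \<comment> \<open>Continuity in time with values in \<open>L log L\<close>\<close>
  have C_LlogL: "(\<lambda>(x, t). v (x, t) - v (x, 0)) \<in> C_LlogL T UNIV"
  proof (rule C_LlogL_increment[OF T v_cont v_bnd])
    \<comment> \<open>The Lipschitz constant is the sup bound of the velocity times the
      \<open>L\<^sup>1\<close> bound of the slope on almost every time slice.\<close>
    let ?Q = "L1_norm K * B * q"
    \<comment> \<open>\<open>k\<close> is known to be continuous and bounded on the slab only. The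
      indicator makes the factor measurable and bounded on the plane, and the product is unchanged
      because \<open>vx\<close> vanishes outside the slab.\<close>
    let ?G = "\<lambda>z. indicator (UNIV \<times> {0<..<T}) z *\<^sub>R k z * vx z"
    have K0: "0 \<le> L1_norm K" unfolding L1_norm_def by (intro Bochner_Integration.integral_nonneg) simp
    show Q: "0 \<le> ?Q" using K0 B q by simp
    have [measurable]: "vx \<in> borel_measurable borel" using vx by (rule modular_le_1_measurable)
    have Sm: "UNIV \<times> {0<..<T} \<in> sets (borel :: (real \<times> real) measure)"
      by (simp add: borel_prod[symmetric])
    have "continuous_on (UNIV \<times> {0<..<T}) k" using k_cont by (rule continuous_on_subset) auto
    then have km: "(\<lambda>z. indicator (UNIV \<times> {0<..<T}) z *\<^sub>R k z) \<in> borel_measurable borel"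
      by (rule borel_measurable_continuous_on_indicator[OF Sm])
    have kB: "\<bar>indicator (UNIV \<times> {0<..<T}) z *\<^sub>R k z\<bar> \<le> L1_norm K * B" for z
    proof (cases "z \<in> UNIV \<times> {0<..<T}")
      case True
      then have "z \<in> ?S" by auto
      then show ?thesis using k_bnd[of z] True by simp
    qed (use K0 B in simp)
    have vxi: "integrable lborel vx" by (rule modular_le_1_integrable(3)[OF vx q T])
    have Gi: "integrable lborel ?G"
      using integrable_mult_bounded[OF vxi, of "\<lambda>z. indicator (UNIV \<times> {0<..<T}) z *\<^sub>R k z" "L1_norm K * B"] km kB
      by (simp add: mult.commute)
    have Gk: "?G z = k z * vx z" for z
    proof (cases "z \<in> UNIV \<times> {0<..<T}")
      case False
      then have "vx z = 0" using vx unfolding modular_le_1_def by (cases z) auto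
      then show ?thesis by simp
    qed simp
    have GQ: "(LINT z|lborel. \<bar>?G z\<bar> * indicator {a..b} (snd z)) \<le> ?Q * (b - a)" if ab: "0 < a" "a < b" "b < T" for a b
    proof -
      have iv: "integrable lborel (\<lambda>z. \<bar>vx z\<bar> * indicator {a..b} (snd z))"
        by (rule integrable_mult_bounded[OF integrable_abs[OF vxi], of _ 1]) (auto split: split_indicator)
      have iG: "integrable lborel (\<lambda>z. \<bar>?G z\<bar> * indicator {a..b} (snd z))"
        by (rule integrable_mult_bounded[OF integrable_abs[OF Gi], of _ 1]) (auto split: split_indicator)
      have "(LINT z|lborel. \<bar>?G z\<bar> * indicator {a..b} (snd z)) \<le> (LINT z|lborel. L1_norm K * B * (\<bar>vx z\<bar> * indicator {a..b} (snd z)))"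
      proof (rule integral_mono[OF iG integrable_mult_right[OF iv]])
        fix z
        have "\<bar>?G z\<bar> \<le> L1_norm K * B * \<bar>vx z\<bar>"
          unfolding abs_mult[of "indicator (UNIV \<times> {0<..<T}) z *\<^sub>R k z"] using kB[of z] by (intro mult_right_mono) auto
        then show "\<bar>?G z\<bar> * indicator {a..b} (snd z) \<le> L1_norm K * B * (\<bar>vx z\<bar> * indicator {a..b} (snd z))"
          by (simp split: split_indicator)
      qed
      also have "\<dots> = L1_norm K * B * (LINT z|lborel. \<bar>vx z\<bar> * indicator {a..b} (snd z))"
        by (rule integral_mult_right_zero)
      also have "\<dots> \<le> L1_norm K * B * (q * (b - a))"
        using modular_le_1_L1_slab[OF vx q T ab] K0 B by (intro mult_left_mono) auto
      finally show ?thesis by (simp add: mult.assoc)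
    qed
    show "(\<integral>\<^sup>+x. ennreal \<bar>v (x, s) - v (x, t)\<bar> \<partial>lborel) \<le> ennreal (?Q * \<bar>s - t\<bar>)"
      if "s \<in> {0..<T}" "t \<in> {0..<T}" for s t
      using vx_t by (intro L1_time_lipschitz[OF v_cont has_log_modulus_time[OF v_mod C] Gi Q GQ _ that]) (simp_all only: Gk)
  qed

  \<comment> \<open>Assembly of the assertions on \<open>v\<close>\<close>
  have Uv_compact: "uniform_limit S (\<lambda>n. U (sub' n)) v sequentially"
    if "compact S" "S \<subseteq> UNIV \<times> {0<..<T}" for S
    using that by (intro Uv) (auto simp: compact_imp_bounded)
  have Linf: "Linf_norm (UNIV \<times> {0<..<T}) v < \<infinity>"
  proof (rule Linf_norm_continuous_bounded)
    show "continuous_on (UNIV \<times> {0<..<T}) v" using v_cont by (rule continuous_on_subset) auto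
    show "UNIV \<times> {0<..<T} \<in> sets (borel :: (real \<times> real) measure)" by (simp add: borel_prod[symmetric])
    show "\<bar>v z\<bar> \<le> B" if "z \<in> UNIV \<times> {0<..<T}" for z
      using v_bnd[of "snd z" "fst z"] that by (auto simp: mem_Times_iff)
  qed
  have dx: "distr_deriv (test_functions (UNIV \<times> {0<..<T})) (UNIV \<times> {0<..<T}) (1, 0) v vx"
    by (rule distr_deriv_line[OF vx_x])
  have "distr_deriv (test_functions (UNIV \<times> {0<..<T})) (UNIV \<times> {0<..<T}) (0, 1) v (\<lambda>z. k z * vx z)"
    by (rule distr_deriv_line[OF vx_t])
  then have dt: "distr_deriv (test_functions (UNIV \<times> {0<..<T})) (UNIV \<times> {0<..<T}) (0, 1) v
         (\<lambda>(x, t). (LINT z|lborel. K (x - z) * v (z, t)) * vx (x, t))"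
    by (simp add: k_def case_prod_unfold)
  show ?thesis
  proof (rule exI[of _ v], intro conjI)
    show "(\<lambda>(x, t). v (x, t) - v0 x) \<in> C_LlogL T UNIV" using C_LlogL by (simp add: v_init)
    show "\<exists>sub U sub'. (\<forall>k. strict_mono (sub k) \<and>
            uniform_limit ?S (\<lambda>l. u k (sub k l)) (U k) sequentially) \<and>
       strict_mono sub' \<and>
       (\<forall>S. compact S \<and> S \<subseteq> UNIV \<times> {0<..<T} \<longrightarrow> uniform_limit S (\<lambda>k. U (sub' k)) v sequentially)"
      by (intro exI[of _ sub] exI[of _ U] exI[of _ sub'] conjI allI impI sub U sub' Uv_compact) blast+
    show "\<exists>vx. vx \<in> Linf_LlogL T UNIV \<and>
       distr_deriv (test_functions (UNIV \<times> {0<..<T})) (UNIV \<times> {0<..<T}) (1, 0) v vx \<and>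
       distr_deriv (test_functions (UNIV \<times> {0<..<T})) (UNIV \<times> {0<..<T}) (0, 1) v
         (\<lambda>(x, t). (LINT z|lborel. K (x - z) * v (z, t)) * vx (x, t))"
      by (intro exI[of _ vx] conjI modular_le_1_Linf_LlogL[OF vx q] dx dt)
    show "\<forall>x. v (x, 0) = v0 x" by (rule allI) (rule v_init)
    show "continuous_on ?S v" by (rule v_cont)
    show "Linf_norm (UNIV \<times> {0<..<T}) v < \<infinity>" by (rule Linf)
  qed
qed

end
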